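(* Let $A>0$ and let $(K_B)_{B>0}$ be a family of positive constants. Then there is a constant $M>0$, depending only on $A$ and on the family $(K_B)_{B>0}$, such that the following holds for all real $Q\ge 1$ and $X\ge 2$, with $L=\log X$. Let $c:\mathbb{Z}[i]\to\mathbb{C}$ be a function with $|c(z)|\le 1$ for all $z$, supported on odd primitive Gaussian integers $z$ with $1<|z|^2\le X$, and satisfying the Siegel–Walfisz condition at $X$ with constants $(K_B)$. Then $$S(Q,X)=\sum_{q\le Q}\ \mathop{\sum\sum}_{u_1v_2\equiv u_2v_1\,(\mathrm{mod}\, q)} c(u_1+iv_1)\,\overline{c}(u_2+iv_2)$$ satisfies $$|S(Q,X)|\le M\left(Q\,L^{28A+148}+X\,L^{-A}\right)X .$$
   Context: In $S(Q,X)$, $q$ runs over positive integers $q\le Q$, and the inner sum is over all integers $u_1,v_1,u_2,v_2$ satisfying the congruence (a finite sum, by the support of $c$); $\overline{c}(z)$ denotes the complex conjugate of $c(z)$. A Gaussian integer $z=u+iv$ ($u,v\in\mathbb{Z}$) is called odd primitive here if $u\not\equiv v \pmod 2$, $\gcd(u,v)=1$ and $uv\ne 0$. Siegel–Walfisz condition at $X$ with constants $(K_B)_{B>0}$: for every $B>0$, all integers $k\ge 0$ and $\ell\ge 1$, all $\alpha\in\mathbb{Z}[i]$ and all $t\in\mathbb{R}$, $$\Bigl|\sum_{z\equiv\alpha\,(\mathrm{mod}\,\ell)} c(z)\,(\overline{z}/z)^k\,|z|^{it}\Bigr|\le K_B\,\ell^2(k^2+1)(t^2+1)\,X\,(\log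 X)^{-B},$$ where the sum is over Gaussian integers $z$ in the support of $c$ (so $|z|^2\le X$) congruent to $\alpha$ modulo $\ell$ in $\mathbb{Z}[i]$, and $\overline z$ is the complex conjugate of $z$. *)

theory Defs
  imports "HOL-Analysis.Analysis" "HOL-Number_Theory.Cong"
begin

text \<open>
  The ring of Gaussian integers is represented as a subset of the complex numbers.
  A function on it is a total function \<open>c :: complex \<Rightarrow> complex\<close>; only its values on
  \<open>gauss_ints\<close> are ever used below, so the values elsewhere play no role.
\<close>

definition gauss_int :: "int \<Rightarrow> int \<Rightarrow> complex" where
  "gauss_int u v = of_int u + \<i> * of_int v"

definition gauss_ints :: "complex set" where
  "gauss_ints = {gauss_int u v | u v. True}"

definition gauss_cong :: "complex \<Rightarrow> complex \<Rightarrow> nat \<Rightarrow> bool" where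
  "gauss_cong z \<alpha> l \<longleftrightarrow> (\<exists>w\<in>gauss_ints. z - \<alpha> = of_nat l * w)"

definition odd_primitive :: "complex \<Rightarrow> bool" where
  "odd_primitive z \<longleftrightarrow>
     (\<exists>u v :: int. z = gauss_int u v \<and> \<not> [u = v] (mod 2) \<and> gcd u v = 1 \<and> u * v \<noteq> 0)"

definition gauss_support :: "(complex \<Rightarrow> complex) \<Rightarrow> complex set" where
  "gauss_support c = {z \<in> gauss_ints. c z \<noteq> 0}"

text \<open>
  The sum is over \<open>gauss_support c\<close>, which is finite and does not contain 0 for
  the functions \<open>c\<close> under consideration. Only the values of \<open>K\<close> at positive
  arguments matter.
\<close>

definition siegel_walfisz :: "(real \<Rightarrow> real) \<Rightarrow> real \<Rightarrow> (complex \<Rightarrow> complex) \<Rightarrow> bool" where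
  "siegel_walfisz K X c \<longleftrightarrow>
     (\<forall>B>0. \<forall>k::nat. \<forall>l::nat. \<forall>\<alpha>\<in>gauss_ints. \<forall>t::real. l \<ge> 1 \<longrightarrow>
        cmod (\<Sum>z | z \<in> gauss_support c \<and> gauss_cong z \<alpha> l.
                c z * (cnj z / z) ^ k * complex_of_real (cmod z) powr (\<i> * complex_of_real t))
        \<le> K B * (real l)\<^sup>2 * ((real k)\<^sup>2 + 1) * (t\<^sup>2 + 1) * X * (ln X) powr (- B))"

text \<open>
  The parameter \<open>X\<close> of the sum enters only through the support of \<open>c\<close>, which
  makes the infinite sum a finite one.
\<close>

definition det_sum :: "(complex \<Rightarrow> complex) \<Rightarrow> real \<Rightarrow> complex" where
  "det_sum c Q =
     (\<Sum>q | q \<ge> (1::nat) \<and> real q \<le> Q.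
        \<Sum>\<^sub>\<infinity>(u1, v1, u2, v2) \<in> {(u1, v1, u2, v2). [u1 * v2 = u2 * v1] (mod int q)}.
          c (gauss_int u1 v1) * cnj (c (gauss_int u2 v2)))"

end

theory Submission
  imports Defs
begin

text \<open>
  For each \<open>q\<close> the inner sum is \<open>S_q = \<Sum> |c(C)|\<^sup>2\<close> over the classes \<open>C\<close> of support vectors that agree
  in the projective line over \<open>\<int>/q\<close>; in particular \<open>S_q \<ge> 0\<close>. A class modulo \<open>q\<close> splits into at
  most \<open>p + 1\<close> classes modulo \<open>q p\<close>, so \<open>S_q \<le> (p + 1) S_(q p)\<close>, and averaging over primes \<open>p\<close>
  reduces all \<open>q < N = X / L^b\<close> to the moduli \<open>m \<in> [N / L\<^sup>2, N)\<close>.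

  For such \<open>m\<close> write the determinant as \<open>D = m r\<close>. The number of admissible \<open>r\<close> is the number of
  divisors of \<open>D\<close> in a window around \<open>|D| / N\<close>, which is at most a power of \<open>L\<close>. Replace this window by
  a fixed one of the same logarithmic length: the resulting form is a sum of \<open>S_r\<close> with small \<open>r\<close> and
  is controlled by the Siegel-Walfisz condition with \<open>k = 0\<close>, \<open>t = 0\<close>. In the difference every
  additive character \<open>e(\<beta> D)\<close> has a coefficient \<open>\<Sum> 1/r\<close> over a difference of two windows of equal
  logarithmic length, which is tiny for every denominator; a single Cauchy-Schwarz over the second
  variable, localised to boxes on which \<open>|D|\<close> is nearly constant, then suffices. The remaining
  moduli \<open>q \<ge> N\<close> are bounded trivially by the number of \<open>r \<le> X / N\<close>.
\<close>

section \<open>Primitive vectors and lines modulo q\<close>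

text \<open>The window for the complementary divisor \<open>r = D / m\<close> depends on
  \<open>z\<close> and \<open>w\<close> jointly, and the Siegel-Walfisz condition is useful only for
  moduli up to a power of \<open>L\<close>. Staying just below \<open>N = X / L^b\<close> makes
  \<open>r\<close> that small. Replacing \<open>|D|\<close> by its value at the corner of a box of
  side \<open>H\<close> leaves a window depending on \<open>z\<close> and the box alone, so that
  \<open>w\<close> can be summed freely over the box. The exponents come from balancing losses,
  measured against \<open>X^2\<close>. Let \<open>n\<close> be the ceiling of \<open>A\<close>. The
  transfer costs \<open>L^2\<close>, so a saving of \<open>L^(n+2)\<close> is needed. Pairs with
  corner value at most \<open>Y\<close> lose about \<open>Y L^2 / X\<close>, whence
  \<open>Y = X / L^(n+4)\<close>. The Cauchy-Schwarz step loses \<open>(N / Y) sqrt R\<close> with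
  \<open>R\<close> of order \<open>L^(b+2)\<close>; the equation
  \<open>b - (n + 4) = (n + 2) + (b + 2) / 2\<close> has the solution \<open>b = 4 n + 14\<close>.
  Edge effects lose \<open>R H L / sqrt X\<close>, whence \<open>H\<close> is about
  \<open>sqrt X / L^(5n+19)\<close>. The moduli above \<open>N\<close> then contribute
  \<open>Q X L^(2b)\<close>, and \<open>2 b = 8 n + 28\<close> is well below
  \<open>28 A + 148\<close>.\<close>

definition wedge :: "int \<times> int \<Rightarrow> int \<times> int \<Rightarrow> int" where
  "wedge z w = fst z * snd w - fst w * snd z"

definition primitive :: "int \<times> int \<Rightarrow> bool" where
  "primitive z \<longleftrightarrow> coprime (fst z) (snd z)"

lemma wedge_self [simp]: "wedge z z = 0"
  by (simp add: wedge_def)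

lemma wedge_swap: "wedge w z = - wedge z w"
  by (simp add: wedge_def algebra_simps)

lemma dvd_wedge_commute: "d dvd wedge w z \<longleftrightarrow> d dvd wedge z w"
  by (subst wedge_swap) simp

text \<open>The three-term Pluecker relation. Taken with \<open>wedge a b = 1\<close>, it expresses
  \<open>wedge z w\<close> through the coordinates of \<open>z\<close> and \<open>w\<close> in the
  basis \<open>a\<close>, \<open>b\<close>, so nothing has to be inverted modulo a composite
  number.\<close>

lemma wedge_pluecker:
  "wedge z w * wedge a b = wedge z b * wedge a w - wedge w b * wedge a z"
  by (simp add: wedge_def algebra_simps)

lemma primitive_obtain_dual:
  assumes "primitive z"
  obtains b where "wedge z b = 1"
proof -
  obtain x y where "x * fst z + y * snd z = 1"
    using assms bezout_int[of "fst z" "snd z"] by (auto simp: primitive_def)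
  then have "wedge z (-y, x) = 1"
    by (simp add: wedge_def algebra_simps)
  then show ?thesis by (rule that)
qed

lemma dvd_wedge_trans:
  assumes "primitive y" "d dvd wedge z y" "d dvd wedge y w"
  shows "d dvd wedge z w"
proof -
  obtain b where b: "wedge y b = 1"
    using primitive_obtain_dual[OF assms(1)] .
  have "wedge z w = wedge z b * wedge y w - wedge w b * wedge y z"
    using wedge_pluecker[of z w y b] b by simp
  moreover have "d dvd wedge y z"
    using assms(2) dvd_wedge_commute by blast
  ultimately show ?thesis
    using assms(3) by simp
qed

definition proj_rel :: "(int \<times> int) set \<Rightarrow> nat \<Rightarrow> ((int \<times> int) \<times> (int \<times> int)) set" where
  "proj_rel V q = {(z, w). z \<in> V \<and> w \<in> V \<and> int q dvd wedge z w}"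

lemma equiv_proj_rel:
  assumes "\<And>z. z \<in> V \<Longrightarrow> primitive z"
  shows "equiv V (proj_rel V q)"
proof (rule equivI)
  show "proj_rel V q \<subseteq> V \<times> V"
    by (auto simp: proj_rel_def)
  show "refl_on V (proj_rel V q)"
    by (auto simp: proj_rel_def refl_on_def)
  show "sym (proj_rel V q)"
    unfolding sym_def proj_rel_def using dvd_wedge_commute by blast
  show "trans (proj_rel V q)"
    unfolding trans_def proj_rel_def using dvd_wedge_trans assms by blast
qed

section \<open>Correlations as squared sums over equivalence classes\<close>

definition class_norm :: "('a \<times> 'a) set \<Rightarrow> 'a set \<Rightarrow> ('a \<Rightarrow> complex) \<Rightarrow> real" where
  "class_norm E V f = (\<Sum>C\<in>V // E. (cmod (\<Sum>z\<in>C. f z))\<^sup>2)"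

lemma class_norm_nonneg: "class_norm E V f \<ge> 0"
  by (simp add: class_norm_def sum_nonneg)

lemma sum_over_classes:
  assumes "finite V" "equiv V E"
  shows "sum g V = (\<Sum>C\<in>V // E. sum g C)"
proof -
  have "sum g (\<Union>(V // E)) = sum (sum g) (V // E)"
  proof (subst sum.Union_disjoint)
    show "\<forall>C\<in>V // E. finite C"
      using assms by (meson finite_equiv_class equiv_type)
    show "\<forall>C\<in>V // E. \<forall>D\<in>V // E. C \<noteq> D \<longrightarrow> C \<inter> D = {}"
      using quotient_disj[OF assms(2)] by blast
  qed (simp add: comp_def)
  then show ?thesis
    using Union_quotient[OF assms(2)] by simp
qed

lemma correlation_eq_class_norm:
  assumes "finite V" "equiv V E"
  shows "(\<Sum>z\<in>V. \<Sum>w\<in>E `` {z}. f z * cnj (f w)) = of_real (class_norm E V f)"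
proof -
  have "(\<Sum>z\<in>V. \<Sum>w\<in>E `` {z}. f z * cnj (f w)) =
        (\<Sum>C\<in>V // E. \<Sum>z\<in>C. \<Sum>w\<in>E `` {z}. f z * cnj (f w))"
    by (rule sum_over_classes[OF assms])
  also have "\<dots> = (\<Sum>C\<in>V // E. of_real ((cmod (\<Sum>z\<in>C. f z))\<^sup>2))"
  proof (rule sum.cong[OF refl])
    fix C assume C: "C \<in> V // E"
    have "(\<Sum>z\<in>C. \<Sum>w\<in>E `` {z}. f z * cnj (f w)) = (\<Sum>z\<in>C. \<Sum>w\<in>C. f z * cnj (f w))"
    proof (rule sum.cong[OF refl])
      fix z assume "z \<in> C"
      then have "E `` {z} = C"
        using C assms(2) by (metis Image_singleton_iff equiv_class_eq_iff quotientE)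
      then show "(\<Sum>w\<in>E `` {z}. f z * cnj (f w)) = (\<Sum>w\<in>C. f z * cnj (f w))"
        by simp
    qed
    also have "\<dots> = (\<Sum>z\<in>C. f z) * cnj (\<Sum>z\<in>C. f z)"
      by (simp add: sum_product)
    finally show "(\<Sum>z\<in>C. \<Sum>w\<in>E `` {z}. f z * cnj (f w)) = of_real ((cmod (\<Sum>z\<in>C. f z))\<^sup>2)"
      by (simp only: complex_norm_square)
  qed
  finally show ?thesis by (simp add: class_norm_def)
qed

lemma norm_sum_sq_le_card:
  fixes g :: "'a \<Rightarrow> complex"
  assumes "finite S"
  shows "(cmod (\<Sum>x\<in>S. g x))\<^sup>2 \<le> real (card S) * (\<Sum>x\<in>S. (cmod (g x))\<^sup>2)"
proof -
  have "(cmod (\<Sum>x\<in>S. g x))\<^sup>2 \<le> (\<Sum>x\<in>S. 1 * cmod (g x))\<^sup>2"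
    by (intro power_mono) (auto intro: norm_sum)
  also have "\<dots> \<le> (\<Sum>x\<in>S. 1\<^sup>2) * (\<Sum>x\<in>S. (cmod (g x))\<^sup>2)"
    by (rule Cauchy_Schwarz_ineq_sum)
  finally show ?thesis by simp
qed

text \<open>Each coarse class sum is a sum of at most \<open>k\<close> fine class sums, and
  Cauchy-Schwarz loses exactly that factor. A fine class lies in only one coarse class, so it is
  counted once.\<close>

lemma class_norm_refine:
  assumes fin: "finite V" and E: "equiv V E" and E': "equiv V E'"
    and sub: "E' \<subseteq> E"
    and card: "\<And>C. C \<in> V // E \<Longrightarrow> card {C' \<in> V // E'. C' \<subseteq> C} \<le> k"
  shows "class_norm E V f \<le> real k * class_norm E' V f"
proof -
  let ?ch = "\<lambda>C. {C' \<in> V // E'. C' \<subseteq> C}"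
  have finq: "finite (V // E')" "finite (V // E)"
    using fin equiv_type[OF E] equiv_type[OF E'] by (auto intro!: finite_quotient)
  have Un: "\<Union>(?ch C) = C" if C: "C \<in> V // E" for C
  proof
    show "C \<subseteq> \<Union>(?ch C)"
    proof
      fix z assume z: "z \<in> C"
      then have zV: "z \<in> V" using C E by (meson in_quotient_imp_subset subsetD)
      have "E `` {z} = C"
        using C E z by (metis Image_singleton_iff equiv_class_eq_iff quotientE)
      then have "E' `` {z} \<subseteq> C" using sub by auto
      moreover have "E' `` {z} \<in> V // E'" using zV by (rule quotientI)
      moreover have "z \<in> E' `` {z}" using zV E' by (rule equiv_class_self[rotated])
      ultimately show "z \<in> \<Union>(?ch C)" by blast
    qed
  qed auto
  have step: "(cmod (\<Sum>z\<in>C. f z))\<^sup>2 \<le> real k * (\<Sum>C'\<in>?ch C. (cmod (\<Sum>z\<in>C'. f z))\<^sup>2)"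
    if C: "C \<in> V // E" for C
  proof -
    have "(\<Sum>z\<in>C. f z) = sum (sum f) (?ch C)"
    proof (subst Un[OF C, symmetric], subst sum.Union_disjoint)
      show "\<forall>A\<in>?ch C. finite A"
        using fin E' by (metis (no_types, lifting) finite_equiv_class equiv_type mem_Collect_eq)
      show "\<forall>A\<in>?ch C. \<forall>B\<in>?ch C. A \<noteq> B \<longrightarrow> A \<inter> B = {}"
        using quotient_disj[OF E'] by blast
    qed (simp add: comp_def)
    then have "(cmod (\<Sum>z\<in>C. f z))\<^sup>2 \<le> real (card (?ch C)) * (\<Sum>C'\<in>?ch C. (cmod (\<Sum>z\<in>C'. f z))\<^sup>2)"
      using norm_sum_sq_le_card[of "?ch C" "sum f"] finq by simp
    also have "\<dots> \<le> real k * (\<Sum>C'\<in>?ch C. (cmod (\<Sum>z\<in>C'. f z))\<^sup>2)"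
      using card[OF C] by (intro mult_right_mono) (auto intro: sum_nonneg)
    finally show ?thesis .
  qed
  have "class_norm E V f \<le> (\<Sum>C\<in>V // E. real k * (\<Sum>C'\<in>?ch C. (cmod (\<Sum>z\<in>C'. f z))\<^sup>2))"
    unfolding class_norm_def by (intro sum_mono step)
  also have "\<dots> = real k * (\<Sum>C'\<in>(\<Union>C\<in>V // E. ?ch C). (cmod (\<Sum>z\<in>C'. f z))\<^sup>2)"
  proof -
    have "?ch C \<inter> ?ch D = {}" if "C \<in> V // E" "D \<in> V // E" "C \<noteq> D" for C D
    proof -
      have "C \<inter> D = {}" using quotient_disj[OF E that(1,2)] that(3) by blast
      moreover have "C' \<noteq> {}" if "C' \<in> V // E'" for C'
        using that E' in_quotient_imp_non_empty by blast
      ultimately show ?thesis by blast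
    qed
    then have "(\<Sum>C'\<in>(\<Union>C\<in>V // E. ?ch C). (cmod (\<Sum>z\<in>C'. f z))\<^sup>2) =
          (\<Sum>C\<in>V // E. \<Sum>C'\<in>?ch C. (cmod (\<Sum>z\<in>C'. f z))\<^sup>2)"
      using finq by (intro sum.UNION_disjoint) auto
    then show ?thesis by (simp add: sum_distrib_left)
  qed
  also have "\<dots> \<le> real k * class_norm E' V f"
    unfolding class_norm_def using finq
    by (intro mult_left_mono sum_mono2) auto
  finally show ?thesis .
qed

lemma proj_rel_children:
  assumes V: "\<And>z. z \<in> V \<Longrightarrow> primitive z" and fin: "finite V"
    and p: "prime p" and q: "q > 0" and C: "C \<in> V // proj_rel V q"
  shows "card {C' \<in> V // proj_rel V (q * p). C' \<subseteq> C} \<le> p + 1"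
proof -
  define E where "E = proj_rel V q"
  define E' where "E' = proj_rel V (q * p)"
  have eE: "equiv V E" and eE': "equiv V E'"
    using V by (auto simp: E_def E'_def intro!: equiv_proj_rel)
  obtain z0 where z0: "z0 \<in> V" "C = E `` {z0}"
    using C by (auto simp: E_def quotient_def)
  obtain b where b: "wedge z0 b = 1"
    using primitive_obtain_dual[OF V[OF z0(1)]] .
  \<comment> \<open>\<open>x z\<close> and \<open>q * s z\<close> are the coordinates of
    \<open>z\<close> in the basis \<open>z0\<close>, \<open>b\<close>. By \<open>key\<close>,
    members of \<open>C\<close> agree modulo \<open>q p\<close> exactly when their pairs
    \<open>(x, s)\<close> are parallel modulo \<open>p\<close>, which turns the count into one over
    the field with \<open>p\<close> elements.\<close>
  define x where "x z = wedge z b" for z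
  define s where "s z = wedge z0 z div int q" for z
  have s: "wedge z0 z = int q * s z" if "z \<in> C" for z
    using that z0 q by (auto simp: E_def proj_rel_def s_def)
  have key: "wedge z w = int q * (x z * s w - x w * s z)" if "z \<in> C" "w \<in> C" for z w
    using wedge_pluecker[of z w z0 b] b s[OF that(1)] s[OF that(2)]
    by (simp add: x_def algebra_simps)
  have "\<exists>y. int p dvd (x z * y - 1)" if "\<not> int p dvd x z" for z
  proof -
    have "coprime (x z) (int p)"
      using that p by (metis coprime_commute prime_imp_coprime prime_int_iff prime_nat_int_transfer)
    then obtain u v where "u * x z + v * int p = 1"
      using bezout_int[of "x z" "int p"] by auto
    then have "x z * u - 1 = int p * (- v)" by (simp add: algebra_simps)
    then show ?thesis by (metis dvd_triv_left)
  qed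
  then obtain y where y: "\<And>z. \<not> int p dvd x z \<Longrightarrow> int p dvd (x z * y z - 1)"
    by metis
  \<comment> \<open>The affine coordinate \<open>s / x\<close> modulo \<open>p\<close>, with
    \<open>y\<close> inverting \<open>x\<close>. The extra value \<open>p\<close> stands for the
    point at infinity, so there are \<open>p + 1\<close> labels.\<close>
  define lab where "lab z = (if int p dvd x z then int p else (s z * y z) mod int p)" for z
  have p0: "p > 0" using p by (simp add: prime_gt_0_nat)
  have lab_range: "lab z \<in> {0..int p}" for z
    using p0 by (auto simp: lab_def intro: order.strict_implies_order)
  have lab_inj: "(z, w) \<in> E'" if "z \<in> C" "w \<in> C" "lab z = lab w" for z w
  proof -
    have lt: "(s z * y z) mod int p < int p" for z using p0 by simp
    have "int p dvd x z * s w - x w * s z"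
    proof (cases "int p dvd x z")
      case True
      then have "int p dvd x w"
        using that(3) lt[of w] by (auto simp: lab_def split: if_splits)
      then show ?thesis using True by simp
    next
      case False
      then have F: "\<not> int p dvd x w"
        using that(3) lt[of z] by (auto simp: lab_def split: if_splits)
      have "(s z * y z) mod int p = (s w * y w) mod int p"
        using that(3) False F by (simp add: lab_def)
      then have 1: "int p dvd s z * y z - s w * y w"
        by (simp add: mod_eq_dvd_iff)
      \<comment> \<open>Cross-multiplied equality of the affine coordinates; each inverse enters
        only through \<open>x y - 1\<close>, a multiple of \<open>p\<close>.\<close>
      have "x z * s w - x w * s z =
          (x w * s z) * (x z * y z - 1) - (x z * s w) * (x w * y w - 1)
            - x z * x w * (s z * y z - s w * y w)"
        by (simp add: algebra_simps)
      then show ?thesis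
        using dvd_diff[OF dvd_diff[OF dvd_mult[OF y[OF False]] dvd_mult[OF y[OF F]]] dvd_mult[OF 1]]
        by (simp only:)
    qed
    then have "int q * int p dvd wedge z w"
      using key[OF that(1,2)] q by (simp add: mult_dvd_mono)
    moreover have "z \<in> V" "w \<in> V"
      using that z0 by (auto simp: E_def proj_rel_def)
    ultimately show ?thesis by (auto simp: E'_def proj_rel_def)
  qed
  define rep where "rep C' = (SOME z. z \<in> C')" for C' :: "(int \<times> int) set"
  have rep: "rep C' \<in> C'" if "C' \<in> V // E'" for C'
    unfolding rep_def using in_quotient_imp_non_empty[OF eE' that] by (simp add: some_in_eq)
  have "inj_on (\<lambda>C'. lab (rep C')) {C' \<in> V // E'. C' \<subseteq> C}"
  proof (rule inj_onI)
    fix A B assume A: "A \<in> {C' \<in> V // E'. C' \<subseteq> C}" and B: "B \<in> {C' \<in> V // E'. C' \<subseteq> C}"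
      and l: "lab (rep A) = lab (rep B)"
    have "(rep A, rep B) \<in> E'"
      using A B l rep by (intro lab_inj) blast+
    then show "A = B"
      using A B rep quotient_eqI[OF eE', of A B "rep A" "rep B"] by simp
  qed
  then have "card {C' \<in> V // E'. C' \<subseteq> C} \<le> card {0..int p}"
    by (rule card_inj_on_le) (simp_all add: image_subset_iff lab_range del: atLeastAtMost_iff)
  also have "card {0..int p} = p + 1" by simp
  finally show ?thesis unfolding E'_def .
qed

definition line_norm :: "(int \<times> int) set \<Rightarrow> (int \<times> int \<Rightarrow> complex) \<Rightarrow> nat \<Rightarrow> real" where
  "line_norm V f q = class_norm (proj_rel V q) V f"

lemma line_norm_nonneg: "line_norm V f q \<ge> 0"
  by (simp add: line_norm_def class_norm_nonneg)

lemma line_norm_le_prime_multiple: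
  assumes "\<And>z. z \<in> V \<Longrightarrow> primitive z" "finite V" "prime p" "q > 0"
  shows "line_norm V f q \<le> real (p + 1) * line_norm V f (q * p)"
  unfolding line_norm_def
proof (rule class_norm_refine)
  show "proj_rel V (q * p) \<subseteq> proj_rel V q"
    by (auto simp: proj_rel_def dest: dvd_mult_left)
  show "card {C' \<in> V // proj_rel V (q * p). C' \<subseteq> C} \<le> p + 1"
    if "C \<in> V // proj_rel V q" for C
    by (rule proj_rel_children[OF assms that])
  show "equiv V (proj_rel V q)" "equiv V (proj_rel V (q * p))"
    by (rule equiv_proj_rel[OF assms(1)], assumption)+
qed (fact assms(2))

lemma line_norm_eq:
  assumes "\<And>z. z \<in> V \<Longrightarrow> primitive z" "finite V"
  shows "of_real (line_norm V f q) =
    (\<Sum>z\<in>V. \<Sum>w\<in>{w\<in>V. int q dvd wedge z w}. f z * cnj (f w))"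
proof -
  have "proj_rel V q `` {z} = {w\<in>V. int q dvd wedge z w}" if "z \<in> V" for z
    using that by (auto simp: proj_rel_def)
  then show ?thesis
    using correlation_eq_class_norm[OF assms(2) equiv_proj_rel[OF assms(1)], where f=f and q1=q]
    by (simp add: line_norm_def)
qed

section \<open>Chebyshev's lower bound and transfer to large moduli\<close>

text \<open>The numbers \<open>1 / (k * (n choose k))\<close> form the Leibniz harmonic triangle.
  Each is a difference of two entries with \<open>k\<close> smaller by one, so by induction it is an
  integer combination of the \<open>1 / j\<close> with \<open>j \<le> n\<close>, whose denominators
  \<open>M\<close> clears.\<close>

lemma reciprocal_leibniz_triangle_Ints:
  assumes "1 \<le> k" "k \<le> n" "\<And>j. 1 \<le> j \<Longrightarrow> j \<le> n \<Longrightarrow> j dvd (M::nat)"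
  shows "real M / (real k * real (n choose k)) \<in> \<int>"
  using assms
proof (induction k arbitrary: n rule: nat_induct_at_least)
  case base
  then have "n dvd M" by simp
  then obtain t where "M = n * t" by (elim dvdE)
  then have "real M / (real 1 * real (n choose 1)) = real t"
    using base by simp
  then show ?case by (metis Ints_of_nat)
next
  case (Suc k)
  have k: "k \<ge> 1" "k < n" using Suc by auto
  define c where "c = real (n choose k)"
  have c: "c > 0" using k by (simp add: c_def)
  have "Suc k * (n choose Suc k) = (n - k) * (n choose k)"
    using binomial_absorption[of k n] binomial_absorb_comp[of n k] by simp
  then have 1: "real (Suc k) * real (n choose Suc k) = real (n - k) * c"
    unfolding c_def of_nat_mult[symmetric] by simp
  have "(n - k) * (n choose k) = n * ((n - 1) choose k)"
    by (rule binomial_absorb_comp)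
  then have "real (n - k) * c = real n * real ((n - 1) choose k)"
    unfolding c_def of_nat_mult[symmetric] by simp
  then have 2: "real ((n - 1) choose k) = real (n - k) * c / real n"
    using k by (simp add: field_simps)
  have nk: "real (n - k) = real n - real k" "real n - real k > 0" "real n > 0" "real k > 0"
    using k by (auto simp: of_nat_diff)
  have "real M / (real (Suc k) * real (n choose Suc k)) =
        real M / (real k * real ((n - 1) choose k)) - real M / (real k * real (n choose k))"
    unfolding 1 2 c_def[symmetric] nk(1) using nk(2-4) c
    by (simp add: divide_simps) (simp add: algebra_simps)
  moreover have "real M / (real k * real ((n - 1) choose k)) \<in> \<int>"
    using Suc.prems k by (intro Suc.IH) auto
  moreover have "real M / (real k * real (n choose k)) \<in> \<int>"
    using Suc.prems k by (intro Suc.IH) auto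
  ultimately show ?case by simp
qed

text \<open>For \<open>k \<ge> 1\<close> the Leibniz triangle shows that
  \<open>k * (n choose k)\<close> divides \<open>M\<close>. Hence each of the \<open>n + 1\<close>
  binomials in row \<open>n\<close> is at most \<open>M\<close>, and they add up to
  \<open>2 ^ n\<close>.\<close>

lemma two_power_le_common_multiple:
  assumes "\<And>j. 1 \<le> j \<Longrightarrow> j \<le> n \<Longrightarrow> j dvd (M::nat)" "M > 0"
  shows "2 ^ n \<le> (n + 1) * M"
proof -
  have "n choose k \<le> M" if "k \<le> n" for k
  proof (cases "k = 0")
    case False
    define y where "y = real M / (real k * real (n choose k))"
    have pos: "real k * real (n choose k) > 0"
      using False that by simp
    have "y \<in> \<int>"
      unfolding y_def using False that assms(1) by (intro reciprocal_leibniz_triangle_Ints) auto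
    moreover have "y > 0"
      using pos assms(2) by (simp add: y_def)
    ultimately have "y \<ge> 1"
      by (elim Ints_cases) simp
    then have "real k * real (n choose k) \<le> real M"
      using pos by (simp add: y_def field_simps)
    then have "k * (n choose k) \<le> M"
      unfolding of_nat_mult[symmetric] of_nat_le_iff .
    moreover have "n choose k \<le> k * (n choose k)"
      using False by simp
    ultimately show ?thesis by linarith
  qed (use assms in auto)
  then have "(\<Sum>k\<le>n. n choose k) \<le> (\<Sum>k\<le>n. M)"
    by (intro sum_mono) auto
  then show ?thesis
    by (simp add: choose_row_sum)
qed

text \<open>Apply the previous bound to the least common multiple of \<open>1, ..., n\<close>,
  written as a product of maximal prime powers. Each of these divides some \<open>j \<le> n\<close>,
  so it is at most \<open>n\<close>, and there is one factor per prime.\<close>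

lemma chebyshev_lower:
  assumes "n \<ge> 1"
  shows "2 ^ n \<le> (n + 1) * n ^ card {p. prime p \<and> p \<le> n}"
proof -
  define e where "e p = Max (multiplicity p ` {1..n})" for p :: nat
  let ?P = "{p. prime p \<and> p \<le> n}"
  define M where "M = (\<Prod>p\<in>?P. p ^ e p)"
  have fin: "finite ?P" by simp
  have e_ge: "multiplicity p j \<le> e p" if "1 \<le> j" "j \<le> n" for p j
    unfolding e_def using that by (intro Max_ge) auto
  have e_le: "p ^ e p \<le> n" for p
  proof -
    have "e p \<in> multiplicity p ` {1..n}"
      unfolding e_def using assms by (intro Max_in) auto
    then obtain j where j: "1 \<le> j" "j \<le> n" "e p = multiplicity p j" by auto
    have "p ^ multiplicity p j dvd j" by (rule multiplicity_dvd)
    then show ?thesis using j by (metis dvd_imp_le le_trans less_le_trans zero_less_one)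
  qed
  have "j dvd M" if "1 \<le> j" "j \<le> n" for j
  proof -
    have "j = (\<Prod>p\<in>prime_factors j. p ^ multiplicity p j)"
      using that by (intro prime_factorization_nat) auto
    also have "\<dots> dvd (\<Prod>p\<in>prime_factors j. p ^ e p)"
      using e_ge[OF that] by (intro prod_dvd_prod) (auto intro: le_imp_power_dvd)
    also have "\<dots> dvd M"
      unfolding M_def using that fin
    proof (intro prod_dvd_prod_subset)
      show "prime_factors j \<subseteq> ?P"
        using that by (auto simp: in_prime_factors_iff intro: order.trans[OF dvd_imp_le])
    qed auto
    finally show ?thesis .
  qed
  moreover have "M > 0"
    unfolding M_def by (intro prod_pos) (auto simp: prime_gt_0_nat)
  ultimately have "2 ^ n \<le> (n + 1) * M"
    by (intro two_power_le_common_multiple) auto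
  moreover have "M \<le> (\<Prod>p\<in>?P. n)"
    unfolding M_def using e_le by (intro prod_mono) auto
  ultimately show ?thesis
    by (simp add: order.trans mult_le_mono2 del: mult_Suc)
qed

text \<open>Because \<open>ln P \<le> L\<close>, Chebyshev's bound gives at least
  \<open>P / (2 L)\<close> primes below \<open>P\<close>. The window is wide enough that discarding
  all integers below \<open>P / L^2\<close>, prime or not, removes at most half of that.\<close>

lemma prime_count_window:
  fixes L P :: real
  assumes L: "L \<ge> 30" and P: "P > L\<^sup>2" "P \<le> exp L"
  shows "real (card {p. prime p \<and> P / L\<^sup>2 \<le> real p \<and> real p < P}) \<ge> P / (4 * L)"
proof -
  \<comment> \<open>The largest integer strictly below \<open>P\<close>, so that
    \<open>p \<le> n\<close> means \<open>p < P\<close>.\<close>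
  define n where "n = nat (\<lceil>P\<rceil> - 1)"
  have "L\<^sup>2 \<ge> 900" using power_mono[of 30 L 2] L by simp
  then have P900: "P > 900" using P by linarith
  have n: "real n < P" "real n \<ge> P - 1" and n_iff: "p \<le> n \<longleftrightarrow> real p < P" for p
    unfolding n_def using P900 by linarith+
  let ?A = "{p. prime p \<and> p \<le> n}"
  let ?B = "{p. prime p \<and> real p < P / L\<^sup>2}"
  have "real n * ln 2 = ln (2 ^ n)" by (simp add: ln_realpow)
  also have "\<dots> \<le> ln (real ((n + 1) * n ^ card ?A))"
  proof -
    have "n \<ge> 1" using n P900 by linarith
    then have "(2::nat) ^ n \<le> (n + 1) * n ^ card ?A" by (rule chebyshev_lower)
    then have "real (2 ^ n) \<le> real ((n + 1) * n ^ card ?A)"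
      by (rule of_nat_mono)
    then have "ln (real (2 ^ n)) \<le> ln (real ((n + 1) * n ^ card ?A))"
      by (rule ln_mono) simp
    then show ?thesis unfolding of_nat_power of_nat_numeral .
  qed
  also have "\<dots> = ln (real (n + 1)) + real (card ?A) * ln (real n)"
  proof -
    have "real n > 0" using n P900 by linarith
    then show ?thesis
      unfolding of_nat_mult of_nat_power by (simp add: ln_mult ln_realpow del: of_nat_add of_nat_Suc)
  qed
  also have "\<dots> \<le> real n / 10 + real (card ?A) * L"
  proof (intro add_mono mult_left_mono)
    have "ln (real (n + 1)) = 2 * ln (sqrt (real (n + 1)))"
      by (simp add: ln_sqrt)
    also have "\<dots> \<le> 2 * sqrt (real (n + 1))"
      using ln_le_minus_one[of "sqrt (real (n + 1))"] by simp
    also have "\<dots> \<le> real n / 10"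
    proof -
      have "(20::real)\<^sup>2 * real (n + 1) \<le> (real n)\<^sup>2"
      proof -
        have sq: "400 * (x + 1) \<le> x * x" if "x \<ge> 899" for x :: real
        proof -
          define y where "y = x * x"
          have "899 * x \<le> y" unfolding y_def using that by (intro mult_right_mono) auto
          then show ?thesis unfolding y_def[symmetric] using that by argo
        qed
        have "real n \<ge> 899" using n P900 by linarith
        from sq[OF this] show ?thesis by (simp add: power2_eq_square add.commute)
      qed
      then have "sqrt ((20::real)\<^sup>2 * real (n + 1)) \<le> real n"
        by (intro real_le_lsqrt) auto
      then have "20 * sqrt (real (n + 1)) \<le> real n"
        unfolding real_sqrt_mult by (simp del: of_nat_add of_nat_Suc)
      then show ?thesis by linarith
    qed
    finally show "ln (real (n + 1)) \<le> real n / 10" .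
    have "real n \<le> exp L" using n P by linarith
    moreover have "real n > 0" using n P900 by linarith
    ultimately have "ln (real n) \<le> ln (exp L)" by (rule ln_mono)
    then show "ln (real n) \<le> L" by simp
  qed simp
  finally have "real n * (ln 2 - 1 / 10) \<le> real (card ?A) * L" by (simp add: algebra_simps)
  \<comment> \<open>\<open>ln 2 \<ge> 2 / 3\<close> leaves the factor \<open>17 / 30\<close>; its
    excess over \<open>1 / 2\<close> absorbs the loss from \<open>P\<close> to
    \<open>P - 1\<close>.\<close>
  moreover have "real n * (ln 2 - 1 / 10) \<ge> P / 2"
  proof -
    have "real n * (ln 2 - 1 / 10) \<ge> real n * (17 / 30)"
      using ln2_ge_two_thirds by (intro mult_left_mono) auto
    then show ?thesis using n P900 by linarith
  qed
  ultimately have A: "real (card ?A) \<ge> P / (2 * L)"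
    using L by (simp add: field_simps)
  have "?B \<subseteq> {1..nat \<lfloor>P / L\<^sup>2\<rfloor>}"
  proof
    fix p assume "p \<in> ?B"
    then have "p \<ge> 1" "real p \<le> P / L\<^sup>2" using prime_ge_1_nat[of p] by auto
    then show "p \<in> {1..nat \<lfloor>P / L\<^sup>2\<rfloor>}" by (simp add: le_nat_floor)
  qed
  then have finB: "finite ?B" and "card ?B \<le> nat \<lfloor>P / L\<^sup>2\<rfloor>"
    using card_mono[of "{1..nat \<lfloor>P / L\<^sup>2\<rfloor>}" ?B] by (auto intro: finite_subset)
  moreover have "real (nat \<lfloor>P / L\<^sup>2\<rfloor>) \<le> P / L\<^sup>2"
    using P900 by (simp add: of_nat_floor)
  ultimately have B: "real (card ?B) \<le> P / L\<^sup>2" by linarith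
  have eq: "{p. prime p \<and> P / L\<^sup>2 \<le> real p \<and> real p < P} = ?A - ?B"
    using n_iff by auto
  have "card ?A - card ?B \<le> card (?A - ?B)"
    using finB by (intro diff_card_le_card_Diff)
  then have "card ?A \<le> card (?A - ?B) + card ?B" by linarith
  then have "real (card ?A) \<le> real (card (?A - ?B)) + real (card ?B)"
    unfolding of_nat_add[symmetric] by (rule of_nat_mono)
  then have "real (card (?A - ?B)) \<ge> P / (2 * L) - P / L\<^sup>2"
    using A B by linarith
  moreover have "P / L\<^sup>2 \<le> P / (4 * L)"
    using L P900 by (intro divide_left_mono) (auto simp: power2_eq_square)
  moreover have "P / (2 * L) = 2 * (P / (4 * L))" by simp
  ultimately show ?thesis
    unfolding eq by linarith
qed

lemma two_power_card_prime_factors_le: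
  assumes "(m::nat) > 0"
  shows "2 ^ card (prime_factors m) \<le> m"
proof -
  have "2 ^ card (prime_factors m) = (\<Prod>p\<in>prime_factors m. 2::nat)" by simp
  also have "\<dots> \<le> (\<Prod>p\<in>prime_factors m. p ^ multiplicity p m)"
  proof (rule prod_mono)
    fix p assume p: "p \<in> prime_factors m"
    then have "2 \<le> p" using prime_ge_2_nat in_prime_factors_imp_prime by blast
    moreover have "multiplicity p m \<ge> 1"
      using p by (simp add: prime_factors_multiplicity)
    then have "p ^ 1 \<le> p ^ multiplicity p m"
      using \<open>2 \<le> p\<close> by (intro power_increasing) auto
    ultimately show "0 \<le> (2::nat) \<and> 2 \<le> p ^ multiplicity p m" by simp
  qed
  also have "\<dots> = m"
    using prime_factorization_nat[of m] assms by simp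
  finally show ?thesis .
qed

text \<open>
  Averaging \<open>T q \<le> (p + 1) T (q p)\<close> over the primes \<open>p\<close> that move \<open>q\<close> into \<open>[N / L\<^sup>2, N)\<close>
  transfers all the mass to the top of the range.
\<close>

lemma sum_le_sum_large_multiples:
  fixes L N :: real and T :: "nat \<Rightarrow> real"
  assumes L: "L \<ge> 30" and N: "N \<le> exp L"
    and T0: "\<And>q. T q \<ge> 0"
    and T: "\<And>q p. q > 0 \<Longrightarrow> prime p \<Longrightarrow> T q \<le> real (p + 1) * T (q * p)"
  shows "(\<Sum>q | 1 \<le> q \<and> real q < N. T q) \<le>
    (1 + 16 * L\<^sup>2) * (\<Sum>m | 1 \<le> m \<and> N / L\<^sup>2 \<le> real m \<and> real m < N. T m)"
proof -
  let ?A = "{q. 1 \<le> q \<and> real q < N / L\<^sup>2}"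
  let ?M = "{m. 1 \<le> m \<and> N / L\<^sup>2 \<le> real m \<and> real m < N}"
  let ?P = "\<lambda>q. {p. prime p \<and> N / real q / L\<^sup>2 \<le> real p \<and> real p < N / real q}"
  have fin_lt: "finite {q. 1 \<le> q \<and> real q < B}" for B
  proof (rule finite_subset)
    show "{q. 1 \<le> q \<and> real q < B} \<subseteq> {..nat \<lceil>B\<rceil>}" by auto linarith
  qed simp
  have finM: "finite ?M" by (rule finite_subset[OF _ fin_lt[of N]]) auto
  have finP: "finite (?P q)" for q
    by (rule finite_subset[OF _ fin_lt[of "N / real q"]]) (use prime_ge_1_nat in blast)
  have L2: "L\<^sup>2 \<ge> 900" using power_mono[of 30 L 2] L by simp
  \<comment> \<open>With \<open>P = N / q\<close> there are at least \<open>P / (4 L)\<close>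
    admissible primes, and each costs a factor \<open>p + 1 \<le> 2 P\<close>. In the average the
    two powers of \<open>P\<close> cancel and \<open>8 L\<close> remains.\<close>
  have step: "T q \<le> 8 * L * (\<Sum>p\<in>?P q. T (q * p))" if q: "q \<in> ?A" for q
  proof -
    define P where "P = N / real q"
    have q0: "q > 0" "real q \<ge> 1" using q by auto
    have N0: "N > 0"
    proof -
      have "0 < N / L\<^sup>2" using q by (intro le_less_trans[of 0 "real q"]) auto
      then show ?thesis using L2 by (simp add: zero_less_divide_iff)
    qed
    have "P > L\<^sup>2"
    proof -
      have "real q < N / L\<^sup>2" using q by simp
      moreover have "L\<^sup>2 > 0" using L2 by linarith
      ultimately show ?thesis using q0 unfolding P_def by (simp add: pos_less_divide_eq mult.commute)
    qed
    moreover have "P \<le> N / 1"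
      unfolding P_def using q0 N0 by (intro divide_left_mono) auto
    then have "P \<le> exp L" using N by simp
    ultimately have c: "real (card (?P q)) \<ge> P / (4 * L)"
      unfolding P_def by (rule prime_count_window[OF L])
    have P0: "P > 0" "P \<ge> 1" using \<open>P > L\<^sup>2\<close> L2 by auto
    have "real (card (?P q)) * T q = (\<Sum>p\<in>?P q. T q)" by simp
    also have "\<dots> \<le> (\<Sum>p\<in>?P q. 2 * P * T (q * p))"
    proof (rule sum_mono)
      fix p assume p: "p \<in> ?P q"
      then have "T q \<le> real (p + 1) * T (q * p)" using T q0 by auto
      also have "\<dots> \<le> 2 * P * T (q * p)"
      proof (intro mult_right_mono T0)
        have "real p < P" using p by (simp add: P_def)
        then show "real (p + 1) \<le> 2 * P" using P0 by simp
      qed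
      finally show "T q \<le> 2 * P * T (q * p)" .
    qed
    also have "\<dots> = 2 * P * (\<Sum>p\<in>?P q. T (q * p))" by (simp add: sum_distrib_left)
    finally have "real (card (?P q)) * T q \<le> 2 * P * (\<Sum>p\<in>?P q. T (q * p))" .
    moreover have "P / (4 * L) * T q \<le> real (card (?P q)) * T q"
      using c T0 by (intro mult_right_mono)
    ultimately have "P / (4 * L) * T q \<le> 2 * P * (\<Sum>p\<in>?P q. T (q * p))" by linarith
    then have "P * T q \<le> P * (8 * L * (\<Sum>p\<in>?P q. T (q * p)))"
      using L by (simp add: field_simps)
    then show ?thesis using P0(1) by (rule mult_left_le_imp_le)
  qed
  have "(\<Sum>q\<in>?A. T q) \<le> (\<Sum>q\<in>?A. 8 * L * (\<Sum>p\<in>?P q. T (q * p)))"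
    by (intro sum_mono step)
  also have "\<dots> = 8 * L * (\<Sum>x\<in>Sigma ?A ?P. T (fst x * snd x))"
    using fin_lt finP by (simp add: sum_distrib_left sum.Sigma case_prod_beta)
  \<comment> \<open>Collect by \<open>m = q p\<close>. A pair \<open>(q, p)\<close> is determined by
    \<open>m\<close> and the prime divisor \<open>p\<close>, so \<open>m\<close> occurs at most once
    per prime factor, that is at most \<open>2 L\<close> times since
    \<open>2 ^ k \<le> m \<le> exp L\<close>.\<close>
  also have "\<dots> \<le> 8 * L * (\<Sum>y\<in>Sigma ?M prime_factors. T (fst y))"
  proof (intro mult_left_mono sum_le_included[where i = "\<lambda>y. (fst y div snd y, snd y)"] ballI)
    fix x assume x: "x \<in> Sigma ?A ?P"
    obtain q p where qp: "x = (q, p)" by (cases x)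
    have q: "q \<ge> 1" "real q > 0" and p: "prime p" "N / real q / L\<^sup>2 \<le> real p" "real p < N / real q"
      using x qp by auto
    have "N / L\<^sup>2 / real q \<le> real p" using p(2) by (simp add: mult.commute)
    then have "N / L\<^sup>2 \<le> real p * real q" using q(2) by (simp only: pos_divide_le_eq)
    then have "N / L\<^sup>2 \<le> real (q * p)" by (simp only: of_nat_mult mult.commute)
    moreover have "real (q * p) < N"
      using p q by (simp add: pos_less_divide_eq mult.commute)
    moreover have "q * p \<ge> 1" using q p prime_gt_0_nat[of p] by (simp add: Suc_leI)
    moreover have "p \<in> prime_factors (q * p)"
      using p q by (auto simp: in_prime_factors_iff)
    ultimately have "(q * p, p) \<in> Sigma ?M prime_factors" by auto
    then show "\<exists>y\<in>Sigma ?M prime_factors. (fst y div snd y, snd y) = x \<and> T (fst x * snd x) \<le> T (fst y)"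
      using qp p(1) by (intro bexI[of _ "(q * p, p)"]) (auto simp: prime_gt_0_nat)
  qed (use fin_lt finP finM L T0 in auto)
  also have "\<dots> = 8 * L * (\<Sum>m\<in>?M. real (card (prime_factors m)) * T m)"
    by (subst sum.Sigma[OF finM, of prime_factors "\<lambda>m p. T m", unfolded case_prod_beta, symmetric]) auto
  also have "\<dots> \<le> 8 * L * (\<Sum>m\<in>?M. 2 * L * T m)"
  proof (intro mult_left_mono sum_mono mult_right_mono T0)
    fix m assume m: "m \<in> ?M"
    let ?k = "card (prime_factors m)"
    have "real (2 ^ ?k) \<le> real m"
      using two_power_card_prime_factors_le[of m] m by (intro of_nat_mono) auto
    also have "\<dots> \<le> exp L" using m N by simp
    finally have "(2::real) ^ ?k \<le> exp L" by simp
    then have "ln ((2::real) ^ ?k) \<le> ln (exp L)" by (rule ln_mono) simp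
    then have "ln ((2::real) ^ ?k) \<le> L" by simp
    then have "real ?k * ln 2 \<le> L" by (simp add: ln_realpow)
    moreover have "real ?k * (1 / 2) \<le> real ?k * ln 2"
      using ln2_ge_two_thirds by (intro mult_left_mono) auto
    ultimately show "real ?k \<le> 2 * L" by linarith
  qed (use L in auto)
  also have "\<dots> = 16 * L\<^sup>2 * (\<Sum>m\<in>?M. T m)"
    by (simp add: sum_distrib_left power2_eq_square mult_ac)
  finally have A: "(\<Sum>q\<in>?A. T q) \<le> 16 * L\<^sup>2 * (\<Sum>m\<in>?M. T m)" .
  have "(\<Sum>q | 1 \<le> q \<and> real q < N. T q) \<le> (\<Sum>q\<in>?A \<union> ?M. T q)"
    using fin_lt finM T0 by (intro sum_mono2) auto
  also have "\<dots> \<le> (\<Sum>q\<in>?A. T q) + (\<Sum>q\<in>?M. T q)"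
  proof -
    have "sum T (?A \<inter> ?M) \<ge> 0" by (intro sum_nonneg T0)
    then show ?thesis using sum.union_inter[OF fin_lt finM, of T "N / L\<^sup>2"] by linarith
  qed
  finally show ?thesis using A by (simp add: algebra_simps)
qed

section \<open>Counting lattice points\<close>

lemma card_int_interval_le:
  fixes a b :: real
  assumes "a \<le> b + 1"
  shows "real (card {n::int. a \<le> of_int n \<and> of_int n \<le> b}) \<le> b - a + 1"
    and "finite {n::int. a \<le> of_int n \<and> of_int n \<le> b}"
proof -
  have eq: "{n::int. a \<le> of_int n \<and> of_int n \<le> b} = {\<lceil>a\<rceil>..\<lfloor>b\<rfloor>}"
    by (auto simp: ceiling_le_iff le_floor_iff)
  show "finite {n::int. a \<le> of_int n \<and> of_int n \<le> b}"
    unfolding eq by simp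
  have "real (card {\<lceil>a\<rceil>..\<lfloor>b\<rfloor>}) = real (nat (\<lfloor>b\<rfloor> - \<lceil>a\<rceil> + 1))" by simp
  also have "\<dots> \<le> b - a + 1"
    using assms by linarith
  finally show "real (card {n::int. a \<le> of_int n \<and> of_int n \<le> b}) \<le> b - a + 1"
    unfolding eq .
qed

lemma card_near_multiples:
  fixes u :: int and x t :: real
  assumes "u \<noteq> 0" "t \<ge> 0"
  shows "real (card {b::int. \<bar>of_int u * of_int b - x\<bar> \<le> t}) \<le> 2 * t / \<bar>of_int u\<bar> + 1"
    and "finite {b::int. \<bar>of_int u * of_int b - x\<bar> \<le> t}"
proof -
  let ?u = "real_of_int u"
  have u0: "\<bar>?u\<bar> > 0" using assms by simp
  have eq: "{b::int. \<bar>?u * of_int b - x\<bar> \<le> t} =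
      {b::int. x / ?u - t / \<bar>?u\<bar> \<le> of_int b \<and> of_int b \<le> x / ?u + t / \<bar>?u\<bar>}"
  proof (intro Collect_cong)
    fix b :: int
    have "?u * of_int b - x = ?u * (of_int b - x / ?u)" using u0 by (simp add: algebra_simps)
    then have "\<bar>?u * of_int b - x\<bar> = \<bar>?u\<bar> * \<bar>of_int b - x / ?u\<bar>" by (simp add: abs_mult)
    then have "\<bar>?u * of_int b - x\<bar> \<le> t \<longleftrightarrow> \<bar>of_int b - x / ?u\<bar> \<le> t / \<bar>?u\<bar>"
      using u0 by (simp add: pos_le_divide_eq mult.commute)
    then show "\<bar>?u * of_int b - x\<bar> \<le> t \<longleftrightarrow>
        x / ?u - t / \<bar>?u\<bar> \<le> of_int b \<and> of_int b \<le> x / ?u + t / \<bar>?u\<bar>" by linarith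
  qed
  have "t / \<bar>?u\<bar> \<ge> 0" using assms by simp
  then have *: "x / ?u - t / \<bar>?u\<bar> \<le> (x / ?u + t / \<bar>?u\<bar>) + 1" by linarith
  have "real (card {b::int. \<bar>?u * of_int b - x\<bar> \<le> t}) \<le>
      (x / ?u + t / \<bar>?u\<bar>) - (x / ?u - t / \<bar>?u\<bar>) + 1"
    unfolding eq by (rule card_int_interval_le(1)[OF *])
  then show "real (card {b::int. \<bar>?u * of_int b - x\<bar> \<le> t}) \<le> 2 * t / \<bar>?u\<bar> + 1" by simp
  show "finite {b::int. \<bar>?u * of_int b - x\<bar> \<le> t}"
    unfolding eq by (rule card_int_interval_le(2)[OF *])
qed

lemma harm_le_one_plus_ln:
  assumes "n \<ge> 1"
  shows "harm n \<le> 1 + ln (real n)"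
  using euler_mascheroni_sequence_decreasing[of 1 n] assms by (simp add: harm_def)

lemma sum_inverse_abs_le:
  assumes "S \<ge> 1"
  shows "(\<Sum>u\<in>{- int S..int S} - {0}. 1 / \<bar>real_of_int u\<bar>) \<le> 2 * (1 + ln (real S))"
proof -
  have "{- int S..int S} - {0} = {- int S..-1} \<union> {1..int S}" by auto
  then have "(\<Sum>u\<in>{- int S..int S} - {0}. 1 / \<bar>real_of_int u\<bar>) =
      (\<Sum>u\<in>{- int S..-1}. 1 / \<bar>real_of_int u\<bar>) + (\<Sum>u\<in>{1..int S}. 1 / \<bar>real_of_int u\<bar>)"
    by (simp add: sum.union_disjoint)
  also have "(\<Sum>u\<in>{- int S..-1}. 1 / \<bar>real_of_int u\<bar>) = (\<Sum>u\<in>{1..int S}. 1 / \<bar>real_of_int u\<bar>)"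
    by (rule sum.reindex_bij_witness[of _ uminus uminus]) auto
  also have "(\<Sum>u\<in>{1..int S}. 1 / \<bar>real_of_int u\<bar>) = (\<Sum>k\<in>{1..S}. 1 / real k)"
    by (rule sum.reindex_bij_witness[of _ int nat]) auto
  also have "\<dots> = harm S" by (simp add: harm_def inverse_eq_divide)
  finally show ?thesis using harm_le_one_plus_ln[OF assms] by simp
qed

text \<open>Fix \<open>u = fst z\<close>, \<open>snd z\<close> and \<open>fst j\<close>. Then
  \<open>u * snd j\<close> lies in an interval of length \<open>2 t\<close>, which leaves at most
  \<open>2 t / |u| + 1\<close> values of \<open>snd j\<close>; the sum of \<open>1 / |u|\<close>
  over nonzero \<open>u\<close> produces the logarithm.\<close>

lemma card_strip_le:
  fixes V :: "(int \<times> int) set" and S T :: nat and x t :: real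
  assumes S: "S \<ge> 1" and t: "t \<ge> 0"
    and V: "\<And>z. z \<in> V \<Longrightarrow> fst z \<noteq> 0 \<and> \<bar>fst z\<bar> \<le> int S \<and> \<bar>snd z\<bar> \<le> int S"
  shows "real (card {(z, j). z \<in> V \<and> j \<in> {- int T..int T} \<times> {- int T..int T} \<and>
            \<bar>of_int (wedge z j) - x\<bar> \<le> t})
         \<le> (2 * real S + 1) * (2 * real T + 1) * (4 * t * (1 + ln (real S)) + 2 * real S)"
proof -
  let ?U = "{- int S..int S} - {0}"
  let ?I = "{- int S..int S} \<times> {- int T..int T}"
  define B where "B u k = {b::int. \<bar>of_int u * of_int b - (x + of_int (fst k * snd k))\<bar> \<le> t}"
    for u :: int and k :: "int \<times> int"
  let ?L = "{(z, j). z \<in> V \<and> j \<in> {- int T..int T} \<times> {- int T..int T} \<and> \<bar>of_int (wedge z j) - x\<bar> \<le> t}"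
  let ?R = "Sigma ?U (\<lambda>u. Sigma ?I (B u))"
  have finB: "finite (B u k)" and cardB: "real (card (B u k)) \<le> 2 * t * (1 / \<bar>of_int u\<bar>) + 1"
    if "u \<in> ?U" for u k
    using card_near_multiples[of u t] that t unfolding B_def by auto
  have finR: "finite ?R" using finB by (intro finite_SigmaI) auto
  have "inj_on (\<lambda>(z, j). (fst z, (snd z, fst j), snd j)) ?L"
    by (rule inj_onI) (auto simp: prod_eq_iff)
  moreover have "(\<lambda>(z, j). (fst z, (snd z, fst j), snd j)) ` ?L \<subseteq> ?R"
    using V by (fastforce simp: B_def wedge_def abs_le_iff algebra_simps)
  ultimately have "card ?L \<le> card ?R"
    using finR by (intro card_inj_on_le) auto
  then have "real (card ?L) \<le> real (card ?R)" by simp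
  also have "\<dots> = (\<Sum>u\<in>?U. \<Sum>k\<in>?I. real (card (B u k)))"
    using finB by (simp add: card_SigmaI)
  also have "\<dots> \<le> (\<Sum>u\<in>?U. \<Sum>k\<in>?I. 2 * t * (1 / \<bar>of_int u\<bar>) + 1)"
    by (intro sum_mono cardB)
  also have "\<dots> = real (card ?I) * (2 * t * (\<Sum>u\<in>?U. 1 / \<bar>real_of_int u\<bar>) + real (card ?U))"
    by (simp add: sum.distrib sum_distrib_left algebra_simps)
  also have "card ?I = (2 * S + 1) * (2 * T + 1)"
  proof -
    have "card {- int S..int S} = 2 * S + 1" "card {- int T..int T} = 2 * T + 1" by simp_all
    then show ?thesis unfolding card_cartesian_product by simp
  qed
  also have "card ?U = 2 * S"
    by (simp add: card_Diff_singleton)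
  also have "real ((2 * S + 1) * (2 * T + 1)) * (2 * t * (\<Sum>u\<in>?U. 1 / \<bar>real_of_int u\<bar>) + real (2 * S)) \<le>
      real ((2 * S + 1) * (2 * T + 1)) * (2 * t * (2 * (1 + ln (real S))) + real (2 * S))"
    using t by (intro mult_left_mono add_right_mono sum_inverse_abs_le S) auto
  finally show ?thesis by (simp add: algebra_simps)
qed

lemma card_div_image_le:
  fixes A :: int and l r :: nat
  assumes "r > 0"
  shows "real (card {A div int r..(A + int l) div int r}) \<le> real l / real r + 2"
proof -
  have "real_of_int ((A + int l) div int r) \<le> (of_int A + real l) / real r"
    using real_of_int_div4[of "A + int l" "int r"] by simp
  moreover have "of_int A / real r - 1 \<le> real_of_int (A div int r)"
    using real_of_int_div3[of A "int r"] by simp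
  ultimately have "real_of_int ((A + int l) div int r - A div int r + 1) \<le> real l / real r + 2"
    by (simp add: add_divide_distrib)
  moreover have "A div int r \<le> (A + int l) div int r"
    using assms by (intro zdiv_mono1) auto
  ultimately show ?thesis
    by (simp add: of_nat_nat)
qed

text \<open>Modulo \<open>r\<close> such a \<open>w\<close> is the multiple \<open>wedge w b\<close>
  of \<open>z\<close>, so at most \<open>r\<close> residue classes occur. Inside a class
  \<open>w\<close> is fixed by its two quotients by \<open>r\<close>, each with at most
  \<open>l / r + 2 \<le> 3 l / r\<close> values, where \<open>r \<le> l\<close> is used.\<close>

lemma card_line_in_box_le:
  fixes A B :: int and l r :: nat
  assumes z: "primitive z" and r: "r > 0" "r \<le> l"
  shows "real (card {w \<in> {A..<A + int l} \<times> {B..<B + int l}. int r dvd wedge z w}) \<le> 9 * (real l)\<^sup>2 / real r"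
proof -
  obtain b where b: "wedge z b = 1" using primitive_obtain_dual[OF z] .
  let ?W = "{w \<in> {A..<A + int l} \<times> {B..<B + int l}. int r dvd wedge z w}"
  let ?D = "\<lambda>A. {A div int r..(A + int l) div int r}"
  define h where "h w = (wedge w b mod int r, fst w div int r, snd w div int r)" for w
  have coord: "fst w = wedge w b * fst z + wedge z w * fst b"
      "snd w = wedge w b * snd z + wedge z w * snd b" for w
  proof -
    have "fst w = fst w * wedge z b" "snd w = snd w * wedge z b" using b by simp_all
    then show "fst w = wedge w b * fst z + wedge z w * fst b"
      "snd w = wedge w b * snd z + wedge z w * snd b"
      by (simp_all add: wedge_def algebra_simps)
  qed
  have "inj_on h ?W"
  proof (rule inj_onI)
    fix w w' assume w: "w \<in> ?W" and w': "w' \<in> ?W" and e: "h w = h w'"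
    have "int r dvd wedge w b - wedge w' b" using e by (simp add: h_def mod_eq_dvd_iff)
    moreover have "int r dvd wedge z w - wedge z w'" using w w' by (auto intro: dvd_diff)
    ultimately have "int r dvd (wedge w b - wedge w' b) * fst z + (wedge z w - wedge z w') * fst b"
       "int r dvd (wedge w b - wedge w' b) * snd z + (wedge z w - wedge z w') * snd b"
      by (auto intro: dvd_add dvd_mult2)
    then have "int r dvd fst w - fst w'" "int r dvd snd w - snd w'"
      using coord[of w] coord[of w'] by (simp_all add: algebra_simps)
    then have "fst w mod int r = fst w' mod int r" "snd w mod int r = snd w' mod int r"
      by (simp_all add: mod_eq_dvd_iff)
    moreover have "fst w div int r = fst w' div int r" "snd w div int r = snd w' div int r"
      using e by (simp_all add: h_def)
    ultimately show "w = w'"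
      by (metis div_mult_mod_eq prod_eq_iff)
  qed
  moreover have "h ` ?W \<subseteq> {0..<int r} \<times> ?D A \<times> ?D B"
    using r by (auto simp: h_def intro!: zdiv_mono1)
  ultimately have "card ?W \<le> card ({0..<int r} \<times> ?D A \<times> ?D B)"
    by (intro card_inj_on_le) auto
  then have "real (card ?W) \<le> real r * (real (card (?D A)) * real (card (?D B)))"
    by (simp add: card_cartesian_product flip: of_nat_mult)
  also have "\<dots> \<le> real r * ((3 * (real l / real r)) * (3 * (real l / real r)))"
  proof (intro mult_left_mono mult_mono)
    have "real l / real r \<ge> 1" using r by simp
    then show "real (card (?D A)) \<le> 3 * (real l / real r)" "real (card (?D B)) \<le> 3 * (real l / real r)"
      using card_div_image_le[OF r(1), of A l] card_div_image_le[OF r(1), of B l] by linarith+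
  qed auto
  also have "\<dots> = 9 * (real l)\<^sup>2 / real r" using r by (simp add: power2_eq_square)
  finally show ?thesis .
qed

text \<open>A vector parallel to a primitive \<open>z\<close> is \<open>wedge w b\<close> times
  \<open>z\<close>; if it is primitive as well, the multiplier is a unit, which leaves
  \<open>z\<close> and its negative.\<close>

lemma card_parallel_primitive_le:
  assumes "primitive z" "\<And>w. w \<in> V \<Longrightarrow> primitive w"
  shows "card {w \<in> V. wedge z w = 0} \<le> 2"
proof -
  have "{w \<in> V. wedge z w = 0} \<subseteq> {z, (- fst z, - snd z)}"
  proof
    fix w assume "w \<in> {w \<in> V. wedge z w = 0}"
    then have w: "primitive w" "wedge z w = 0" using assms(2) by auto
    obtain b where b: "wedge z b = 1" using primitive_obtain_dual[OF assms(1)] .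
    have "fst w = fst w * wedge z b" "snd w = snd w * wedge z b" using b by simp_all
    then have c: "fst w = wedge w b * fst z" "snd w = wedge w b * snd z"
      using w(2) by (auto simp: wedge_def algebra_simps)
    then have "wedge w b dvd fst w" "wedge w b dvd snd w" by simp_all
    then have "is_unit (wedge w b)" using w(1) unfolding primitive_def by (rule coprime_common_divisor[rotated])
    then have "wedge w b = 1 \<or> wedge w b = -1" by auto
    then show "w \<in> {z, (- fst z, - snd z)}" using c by (cases w, cases z) auto
  qed
  then have "card {w \<in> V. wedge z w = 0} \<le> card {z, (- fst z, - snd z)}" by (intro card_mono) auto
  also have "\<dots> \<le> 2" by (simp add: card_insert_if)
  finally show ?thesis .
qed

text \<open>The involution \<open>m \<mapsto> |D| / m\<close> of the divisors of \<open>D\<close>.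
  It carries the closed and the open end of the range over exactly, and the hypothesis on
  \<open>R\<close> keeps all images in \<open>{1..R}\<close>.\<close>

lemma card_complementary_divisors:
  fixes D :: int and N1 N2 :: real and R :: nat
  assumes D: "D \<noteq> 0" and N1: "N1 > 0" and R: "\<bar>of_int D\<bar> \<le> N1 * real R"
  shows "card {m::nat. 1 \<le> m \<and> N1 \<le> real m \<and> real m < N2 \<and> int m dvd D} =
         card {r\<in>{1..R}. int r dvd D \<and> real r * N1 \<le> \<bar>of_int D\<bar> \<and> \<bar>of_int D\<bar> < real r * N2}"
proof -
  define d where "d = nat \<bar>D\<bar>"
  have d0: "d > 0" using D by (simp add: d_def)
  have dvd: "int m dvd D \<longleftrightarrow> m dvd d" for m
  proof -
    have "int m dvd D \<longleftrightarrow> int m dvd int d" by (simp add: d_def)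
    then show ?thesis by (simp only: int_dvd_int_iff)
  qed
  have dr: "\<bar>of_int D\<bar> = real d" by (simp add: d_def)
  have "bij_betw (\<lambda>m. d div m) {m::nat. 1 \<le> m \<and> N1 \<le> real m \<and> real m < N2 \<and> int m dvd D}
      {r\<in>{1..R}. int r dvd D \<and> real r * N1 \<le> \<bar>of_int D\<bar> \<and> \<bar>of_int D\<bar> < real r * N2}"
  proof (rule bij_betw_byWitness[where f' = "\<lambda>m. d div m"])
    show "(\<lambda>m. d div m) ` {m::nat. 1 \<le> m \<and> N1 \<le> real m \<and> real m < N2 \<and> int m dvd D} \<subseteq>
      {r\<in>{1..R}. int r dvd D \<and> real r * N1 \<le> \<bar>of_int D\<bar> \<and> \<bar>of_int D\<bar> < real r * N2}"
    proof (rule image_subsetI)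
      fix m assume m: "m \<in> {m::nat. 1 \<le> m \<and> N1 \<le> real m \<and> real m < N2 \<and> int m dvd D}"
      then have "m dvd d" using dvd by auto
      then obtain r where r: "d = m * r" by (elim dvdE)
      have m0: "m > 0" and r0: "r > 0" using r d0 by auto
      have 1: "real r * N1 \<le> real d" "real d < real r * N2"
        using m m0 r0 unfolding r by (simp_all add: mult.commute[of "real m"])
      have "N1 * real r \<le> N1 * real R" using 1 R dr by (simp add: mult.commute)
      then have "r \<le> R" using N1 by simp
      then show "d div m \<in> {r\<in>{1..R}. int r dvd D \<and> real r * N1 \<le> \<bar>of_int D\<bar> \<and> \<bar>of_int D\<bar> < real r * N2}"
        using m0 r0 1 unfolding dr dvd by (auto simp: r)
    qed
    show "(\<lambda>m. d div m) ` {r\<in>{1..R}. int r dvd D \<and> real r * N1 \<le> \<bar>of_int D\<bar> \<and> \<bar>of_int D\<bar> < real r * N2} \<subseteq>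
      {m::nat. 1 \<le> m \<and> N1 \<le> real m \<and> real m < N2 \<and> int m dvd D}"
    proof (rule image_subsetI)
      fix r assume r: "r \<in> {r\<in>{1..R}. int r dvd D \<and> real r * N1 \<le> \<bar>of_int D\<bar> \<and> \<bar>of_int D\<bar> < real r * N2}"
      then have "r dvd d" using dvd by auto
      then obtain m where m: "d = r * m" by (elim dvdE)
      have "m > 0" "r > 0" using m d0 by auto
      then show "d div r \<in> {m::nat. 1 \<le> m \<and> N1 \<le> real m \<and> real m < N2 \<and> int m dvd D}"
        using r unfolding dr dvd by (simp add: m)
    qed
  qed (use d0 in \<open>auto simp: dvd elim!: dvdE\<close>)
  then show ?thesis by (rule bij_betw_same_card)
qed

section \<open>Divisor sums as sums over Farey fractions\<close>

definition unit_char :: "real \<Rightarrow> complex" where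
  "unit_char x = cis (2 * pi * x)"

lemma unit_char_add: "unit_char (x + y) = unit_char x * unit_char y"
  by (simp add: unit_char_def cis_mult distrib_left)

lemma norm_unit_char [simp]: "cmod (unit_char x) = 1"
  by (simp add: unit_char_def)

lemma cnj_unit_char: "cnj (unit_char x) = unit_char (- x)"
  by (simp add: unit_char_def cis_cnj)

lemma unit_char_power: "unit_char x ^ n = unit_char (real n * x)"
  by (simp only: unit_char_def Complex.DeMoivre mult_ac)

lemma unit_char_eq_1_iff: "unit_char x = 1 \<longleftrightarrow> x \<in> \<int>"
proof
  assume "unit_char x = 1"
  then have "cos (2 * pi * x) = 1" by (simp add: unit_char_def complex_eq_iff)
  then obtain n :: int where "2 * pi * x = of_int n * 2 * pi"
    using cos_one_2pi_int by auto
  then have "x = of_int n" by simp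
  then show "x \<in> \<int>" by simp
next
  assume "x \<in> \<int>"
  then show "unit_char x = 1" unfolding unit_char_def by (rule cis_multiple_2pi)
qed

lemma sum_unit_char_multiples:
  fixes D :: int
  assumes "r > 0"
  shows "(\<Sum>b<r. unit_char (real b / real r * of_int D)) = (if int r dvd D then of_nat r else 0)"
proof -
  let ?w = "unit_char (of_int D / real r)"
  have eq: "(\<Sum>b<r. unit_char (real b / real r * of_int D)) = (\<Sum>b<r. ?w ^ b)"
    by (simp add: unit_char_power)
  have w1: "?w = 1 \<longleftrightarrow> int r dvd D"
  proof -
    have "of_int D / real r \<in> \<int> \<longleftrightarrow> int r dvd D"
    proof
      assume "of_int D / real r \<in> \<int>"
      then obtain k where "of_int D / real r = of_int k" by (elim Ints_cases)
      then have "real_of_int D = of_int (int r * k)" using assms by (simp add: field_simps)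
      then have "D = int r * k" by (simp only: of_int_eq_iff)
      then show "int r dvd D" by simp
    qed (use assms in auto)
    then show ?thesis by (simp add: unit_char_eq_1_iff)
  qed
  show ?thesis
  proof (cases "int r dvd D")
    case True
    then show ?thesis unfolding eq using w1 by simp
  next
    case False
    have "?w ^ r = unit_char (of_int D)" using assms by (simp add: unit_char_power)
    also have "\<dots> = 1" by (simp add: unit_char_eq_1_iff)
    finally show ?thesis unfolding eq using False w1 by (simp add: sum_gp_strict)
  qed
qed

text \<open>Full periods of \<open>M\<close> consecutive terms sum to zero, so only
  \<open>H mod M\<close> terms survive. The bound does not grow with \<open>H\<close>, which is the
  gain over the trivial one.\<close>

lemma norm_sum_unit_char_interval_le:
  fixes \<xi> :: real and A :: int and H M :: nat
  assumes "\<xi> \<notin> \<int>" "real M * \<xi> \<in> \<int>" "M > 0"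
  shows "cmod (\<Sum>v\<in>{A..<A + int H}. unit_char (\<xi> * of_int v)) \<le> real M"
proof -
  let ?w = "unit_char \<xi>"
  have w: "?w \<noteq> 1" "?w ^ M = 1"
    using assms by (auto simp: unit_char_eq_1_iff unit_char_power)
  have "(\<Sum>v\<in>{A..<A + int H}. unit_char (\<xi> * of_int v)) =
      (\<Sum>k<H. unit_char (\<xi> * of_int A) * ?w ^ k)"
  proof (rule sum.reindex_bij_witness[of _ "\<lambda>k. A + int k" "\<lambda>v. nat (v - A)"])
    fix v assume v: "v \<in> {A..<A + int H}"
    then have "\<xi> * of_int v = \<xi> * of_int A + real (nat (v - A)) * \<xi>"
      by (simp add: of_nat_nat algebra_simps)
    then show "unit_char (\<xi> * of_int A) * ?w ^ nat (v - A) = unit_char (\<xi> * of_int v)"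
      by (simp only: unit_char_power unit_char_add)
  qed auto
  also have "\<dots> = unit_char (\<xi> * of_int A) * (\<Sum>k<H. ?w ^ k)"
    by (simp add: sum_distrib_left)
  also have "(\<Sum>k<H. ?w ^ k) = (\<Sum>k<H mod M. ?w ^ k)"
  proof -
    have "?w ^ H = ?w ^ (M * (H div M) + H mod M)" by simp
    also have "\<dots> = ?w ^ (H mod M)"
      unfolding power_add power_mult w by simp
    finally show ?thesis using w by (simp add: sum_gp_strict)
  qed
  also have "cmod (unit_char (\<xi> * of_int A) * (\<Sum>k<H mod M. ?w ^ k)) \<le> (\<Sum>k<H mod M. cmod (?w ^ k))"
    unfolding norm_mult norm_unit_char by (simp only: mult_1_left norm_sum)
  also have "\<dots> = real (H mod M)" by (simp add: norm_power)
  also have "\<dots> \<le> real M"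
    using assms(3) by (intro of_nat_mono less_imp_le mod_less_divisor)
  finally show ?thesis .
qed

text \<open>The Farey fractions of order \<open>R\<close> in [0, 1) as a set of values: an unreduced
  \<open>b / r\<close> is the same element as its reduced form, so characters of equal frequency are
  merged.\<close>

definition fractions :: "nat \<Rightarrow> real set" where
  "fractions R = (\<lambda>(r, b). real b / real r) ` (SIGMA r:{1..R}. {..<r})"

lemma finite_fractions [simp]: "finite (fractions R)"
  by (simp add: fractions_def)

lemma card_fractions_le: "card (fractions R) \<le> R\<^sup>2"
proof -
  have "card (fractions R) \<le> card (SIGMA r:{1..R}. {..<r})"
    unfolding fractions_def by (rule card_image_le) simp
  also have "\<dots> = (\<Sum>r\<in>{1..R}. r)" by simp
  also have "\<dots> \<le> (\<Sum>r\<in>{1..R}. R)" by (intro sum_mono) simp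
  finally show ?thesis by (simp add: power2_eq_square)
qed

lemma fractions_bounds: "\<beta> \<in> fractions R \<Longrightarrow> 0 \<le> \<beta> \<and> \<beta> < 1"
  by (auto simp: fractions_def)

lemma fractions_reduced:
  assumes "\<beta> \<in> fractions R"
  obtains d b where "1 \<le> d" "d \<le> R" "b < d" "coprime b d" "\<beta> = real b / real d"
proof -
  obtain r b where rb: "r \<ge> 1" "r \<le> R" "b < r" "\<beta> = real b / real r"
    using assms by (auto simp: fractions_def)
  define g where "g = gcd b r"
  have g0: "g > 0" using rb by (simp add: g_def)
  obtain b' r' where c: "b = b' * g" "r = r' * g" "coprime b' r'"
    using gcd_coprime_exists[of b r] g0 unfolding g_def by auto
  have "r' \<ge> 1" using rb c by (cases r') auto
  moreover have "r' \<le> R" using rb(2) c g0 by (metis dvd_imp_le dvd_triv_left le_trans less_le_trans rb(1) zero_less_one)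
  moreover have "b' < r'" using rb(3) c by simp
  moreover have "\<beta> = real b' / real r'" using rb(4) c g0 by simp
  ultimately show ?thesis using c(3) by (intro that)
qed

lemma multiple_of_reduced_fraction_Ints_iff:
  fixes D :: int
  assumes "coprime b d" "d > 0"
  shows "real b / real d * of_int D \<in> \<int> \<longleftrightarrow> int d dvd D"
proof
  assume "real b / real d * of_int D \<in> \<int>"
  then obtain k where "real b / real d * of_int D = of_int k" by (elim Ints_cases)
  then have "real_of_int (int b * D) = of_int (k * int d)" using assms by (simp add: field_simps)
  then have "int b * D = k * int d" by (simp only: of_int_eq_iff)
  then have "int d dvd int b * D" by simp
  then show "int d dvd D"
    using assms(1) by (simp add: coprime_dvd_mult_right_iff coprime_commute)
next
  assume "int d dvd D"
  then obtain k where "D = int d * k" by (elim dvdE)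
  then have "real b / real d * of_int D = of_int (int b * k)" using assms by simp
  then show "real b / real d * of_int D \<in> \<int>" by (simp only: Ints_of_int)
qed

text \<open>The coefficient of \<open>e(\<beta> D)\<close> once the characters of all moduli
  \<open>r\<close> are merged: for a reduced \<open>\<beta> = b / d\<close> the condition selects
  the multiples \<open>r\<close> of \<open>d\<close>.\<close>

definition fraction_coeff :: "nat \<Rightarrow> (nat \<Rightarrow> real) \<Rightarrow> real \<Rightarrow> real" where
  "fraction_coeff R a \<beta> = (\<Sum>r | r \<in> {1..R} \<and> real r * \<beta> \<in> \<int>. a r / real r)"

lemma divisor_sum_eq_char_sum:
  fixes D :: int
  shows "complex_of_real (\<Sum>r | r \<in> {1..R} \<and> int r dvd D. a r) =
    (\<Sum>\<beta>\<in>fractions R. of_real (fraction_coeff R a \<beta>) * unit_char (\<beta> * of_int D))"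
proof -
  have inner: "(\<Sum>\<beta> | \<beta> \<in> fractions R \<and> real r * \<beta> \<in> \<int>. unit_char (\<beta> * of_int D)) =
      (if int r dvd D then of_nat r else 0)" if r: "r \<in> {1..R}" for r
  proof -
    have "{\<beta> \<in> fractions R. real r * \<beta> \<in> \<int>} = (\<lambda>b. real b / real r) ` {..<r}"
    proof
      show "{\<beta> \<in> fractions R. real r * \<beta> \<in> \<int>} \<subseteq> (\<lambda>b. real b / real r) ` {..<r}"
      proof
        fix \<beta> assume \<beta>: "\<beta> \<in> {\<beta> \<in> fractions R. real r * \<beta> \<in> \<int>}"
        then obtain k where k: "real r * \<beta> = of_int k" by (auto elim: Ints_cases)
        have b: "0 \<le> \<beta>" "\<beta> < 1" using \<beta> fractions_bounds by auto
        have r0: "real r > 0" using r by simp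
        have "0 \<le> real r * \<beta>" "real r * \<beta> < real r" using b r0 by auto
        then have k': "0 \<le> k" "k < int r" unfolding k by linarith+
        have "\<beta> = of_int k / real r" using k r0 by (simp add: field_simps)
        then have "\<beta> = real (nat k) / real r" using k' by simp
        then show "\<beta> \<in> (\<lambda>b. real b / real r) ` {..<r}" using k' by (intro image_eqI[of _ _ "nat k"]) auto
      qed
      show "(\<lambda>b. real b / real r) ` {..<r} \<subseteq> {\<beta> \<in> fractions R. real r * \<beta> \<in> \<int>}"
        using r by (auto simp: fractions_def intro!: image_eqI[where x = "(r, _)"])
    qed
    moreover have "inj_on (\<lambda>b. real b / real r) {..<r}"
      using r by (auto intro!: inj_onI)
    ultimately have "(\<Sum>\<beta> | \<beta> \<in> fractions R \<and> real r * \<beta> \<in> \<int>. unit_char (\<beta> * of_int D)) =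
        (\<Sum>b<r. unit_char (real b / real r * of_int D))"
      by (simp add: sum.reindex)
    then show ?thesis using sum_unit_char_multiples[of r D] r by simp
  qed
  have "(\<Sum>\<beta>\<in>fractions R. of_real (fraction_coeff R a \<beta>) * unit_char (\<beta> * of_int D)) =
     (\<Sum>\<beta>\<in>fractions R. \<Sum>r\<in>{1..R}. (if real r * \<beta> \<in> \<int> then of_real (a r / real r) * unit_char (\<beta> * of_int D) else 0))"
    unfolding fraction_coeff_def
    by (intro sum.cong refl) (simp add: sum_distrib_right flip: sum.inter_filter)
  also have "\<dots> = (\<Sum>r\<in>{1..R}. \<Sum>\<beta>\<in>fractions R. (if real r * \<beta> \<in> \<int> then of_real (a r / real r) * unit_char (\<beta> * of_int D) else 0))"
    by (rule sum.swap)
  also have "\<dots> = (\<Sum>r\<in>{1..R}. of_real (a r / real r) * (\<Sum>\<beta> | \<beta> \<in> fractions R \<and> real r * \<beta> \<in> \<int>. unit_char (\<beta> * of_int D)))"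
    by (intro sum.cong refl) (simp add: sum_distrib_left flip: sum.inter_filter)
  also have "\<dots> = (\<Sum>r\<in>{1..R}. if int r dvd D then of_real (a r) else 0)"
    by (intro sum.cong refl) (simp add: inner)
  also have "\<dots> = complex_of_real (\<Sum>r | r \<in> {1..R} \<and> int r dvd D. a r)"
    by (simp add: of_real_sum sum.inter_filter[symmetric])
  finally show ?thesis by simp
qed

section \<open>Harmonic sums over logarithmic windows\<close>

lemma harm_floor_minus_ln_near_euler:
  fixes x :: real
  assumes "x > 0"
  shows "\<bar>harm (nat \<lfloor>x\<rfloor>) - ln x - euler_mascheroni\<bar> \<le> 2 / x"
\<comment> \<open>Endpoints below 1 do occur, because windows get divided by a denominator
  \<open>d\<close>. There the harmonic sum is empty, and \<open>1 / x\<close> dominates both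
  \<open>- ln x\<close> and Euler's constant.\<close>
proof (cases "x < 1")
  case True
  then have 0: "nat \<lfloor>x\<rfloor> = 0" using assms by simp
  have "- ln x = ln (1 / x)" using assms by (simp add: ln_div)
  also have "\<dots> \<le> 1 / x - 1" using assms by (intro ln_le_minus_one) simp
  finally have 1: "- ln x \<le> 1 / x" by simp
  have "ln x \<le> 0" using True assms by simp
  moreover have "0 \<le> (euler_mascheroni :: real)" "(euler_mascheroni :: real) \<le> 1"
    using euler_mascheroni_pos euler_mascheroni_upper[of 0] ln2_ge_two_thirds
    by (auto simp: harm_def)
  moreover have "1 \<le> 1 / x" using True assms by simp
  ultimately show ?thesis using 0 1 by (simp add: harm_def abs_le_iff)
next
  case False
  define m where "m = nat \<lfloor>x\<rfloor>"
  have m: "m \<ge> 1" "real m \<le> x" "x < real m + 1" using False unfolding m_def by linarith+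
  obtain n where n: "m = Suc n" using m by (cases m) auto
  have l: "harm m - ln (real m + 1) \<le> (euler_mascheroni::real)"
    using euler_mascheroni_lower[of n] n by (simp add: add_ac) (smt (verit) divide_nonneg_nonneg of_nat_0_le_iff)
  have u: "(euler_mascheroni::real) \<le> harm m - ln (real m + 1) + 1 / (2 * real m)"
    using euler_mascheroni_upper[of n] n by (simp add: add_ac)
  have "ln (real m + 1) - ln (real m) \<le> 1 / real m"
    using ln_diff_le[of "real m + 1" "real m"] m by simp
  moreover have "ln (real m) \<le> ln x" "ln x \<le> ln (real m + 1)" using m by auto
  moreover have "1 / (2 * real m) \<le> 1 / real m" using m by (simp add: field_simps)
  ultimately have "\<bar>harm m - ln x - euler_mascheroni\<bar> \<le> 1 / real m" using l u by linarith
  also have "\<dots> \<le> 2 / x" using m by (simp add: field_simps)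
  finally show ?thesis unfolding m_def .
qed

text \<open>Euler's constant and \<open>ln x\<close> cancel between the two endpoints, so the
  position \<open>x\<close> of the window survives only in the error.\<close>

lemma sum_inverse_window:
  fixes x lam :: real
  assumes "x > 0" "lam \<ge> 1"
  shows "\<bar>(\<Sum>s | x < real s \<and> real s \<le> lam * x. 1 / real s) - ln lam\<bar> \<le> 4 / x"
proof -
  define m n where "m = nat \<lfloor>x\<rfloor>" and "n = nat \<lfloor>lam * x\<rfloor>"
  have le: "x \<le> lam * x" using assms by simp
  then have mn: "m \<le> n" unfolding m_def n_def by (intro nat_mono floor_mono)
  have "x < real s \<longleftrightarrow> m < s" for s
    unfolding m_def using assms by linarith
  moreover have "real s \<le> lam * x \<longleftrightarrow> s \<le> n" for s
    unfolding n_def using assms le by linarith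
  ultimately have "{s. x < real s \<and> real s \<le> lam * x} = {1..n} - {1..m}" by auto
  then have "(\<Sum>s | x < real s \<and> real s \<le> lam * x. 1 / real s) = harm n - harm m"
    using mn by (simp add: sum_diff harm_def inverse_eq_divide)
  moreover have "\<bar>harm m - ln x - euler_mascheroni\<bar> \<le> 2 / x"
    unfolding m_def by (rule harm_floor_minus_ln_near_euler) fact
  moreover have "\<bar>harm n - ln (lam * x) - euler_mascheroni\<bar> \<le> 2 / (lam * x)"
    unfolding n_def by (rule harm_floor_minus_ln_near_euler) (use assms in simp)
  moreover have "2 / (lam * x) \<le> 2 / x" using assms le by (intro divide_left_mono) auto
  moreover have "ln (lam * x) = ln lam + ln x" using assms by (simp add: ln_mult)
  moreover have "4 / x = 2 / x + 2 / x" by simp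
  ultimately show ?thesis by linarith
qed

text \<open>Put \<open>r = d s\<close>. The window shrinks by \<open>d\<close>, which makes the
  error \<open>4 / (x / d)\<close>, but the weight \<open>1 / r\<close> supplies another
  \<open>1 / d\<close>. The error is thus uniform in \<open>d\<close>.\<close>

lemma sum_inverse_multiples_window:
  fixes x lam :: real
  assumes "x > 0" "lam \<ge> 1" "lam * x \<le> real R" "d > 0"
  shows "\<bar>(\<Sum>r | r \<in> {1..R} \<and> d dvd r. of_bool (x < real r \<and> real r \<le> lam * x) / real r)
            - ln lam / real d\<bar> \<le> 4 / x"
proof -
  have "(\<Sum>r | r \<in> {1..R} \<and> d dvd r. of_bool (x < real r \<and> real r \<le> lam * x) / real r) =
      (\<Sum>r | r \<in> {1..R} \<and> d dvd r. if x < real r \<and> real r \<le> lam * x then 1 / real r else 0)"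
    by (intro sum.cong) auto
  also have "\<dots> = (\<Sum>r | (r \<in> {1..R} \<and> d dvd r) \<and> x < real r \<and> real r \<le> lam * x. 1 / real r)"
    by (simp flip: sum.inter_filter)
  also have "\<dots> = (\<Sum>s | x / real d < real s \<and> real s \<le> lam * (x / real d). 1 / real s / real d)"
  proof (rule sum.reindex_bij_witness[of _ "\<lambda>s. d * s" "\<lambda>r. r div d"])
    fix s assume s: "s \<in> {s. x / real d < real s \<and> real s \<le> lam * (x / real d)}"
    have "0 < x / real d" using assms by simp
    then have "0 < real s" using s by simp
    moreover have "x < real (d * s)" "real (d * s) \<le> lam * x"
      using s assms by (auto simp: field_simps)
    moreover then have "real (d * s) \<le> real R" using assms(3) by linarith
    then have "d * s \<le> R" by (simp only: of_nat_le_iff)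
    ultimately show "d * s \<in> {r. (r \<in> {1..R} \<and> d dvd r) \<and> x < real r \<and> real r \<le> lam * x}"
      using assms(4) by auto
  next
    fix r assume "r \<in> {r. (r \<in> {1..R} \<and> d dvd r) \<and> x < real r \<and> real r \<le> lam * x}"
    then obtain s where s: "r = d * s" "x < real r" "real r \<le> lam * x" by (auto elim: dvdE)
    then show "r div d \<in> {s. x / real d < real s \<and> real s \<le> lam * (x / real d)}"
      using assms(4) by (auto simp: field_simps)
    show "1 / real (r div d) / real d = 1 / real r"
      using s assms(4) by simp
  qed (use assms in auto)
  also have "\<dots> = (\<Sum>s | x / real d < real s \<and> real s \<le> lam * (x / real d). 1 / real s) / real d"
    by (simp add: sum_divide_distrib)
  finally have eq: "(\<Sum>r | r \<in> {1..R} \<and> d dvd r. of_bool (x < real r \<and> real r \<le> lam * x) / real r) =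
      (\<Sum>s | x / real d < real s \<and> real s \<le> lam * (x / real d). 1 / real s) / real d" .
  have "\<bar>(\<Sum>s | x / real d < real s \<and> real s \<le> lam * (x / real d). 1 / real s) - ln lam\<bar> \<le> 4 / (x / real d)"
    using assms by (intro sum_inverse_window) auto
  then have "\<bar>(\<Sum>s | x / real d < real s \<and> real s \<le> lam * (x / real d). 1 / real s) - ln lam\<bar> / real d
      \<le> 4 / (x / real d) / real d"
    by (rule divide_right_mono) simp
  then show ?thesis
    unfolding eq using assms by (simp add: diff_divide_distrib[symmetric])
qed

text \<open>
  The two logarithmic windows have the same length, so the main terms \<open>ln lam / d\<close> of the
  coefficients cancel for every denominator \<open>d\<close>.
\<close>

lemma fraction_coeff_window_diff:
  fixes x y lam :: real
  assumes "x > 0" "y > 0" "lam \<ge> 1" "lam * x \<le> real R" "lam * y \<le> real R" "\<beta> \<in> fractions R"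
  shows "\<bar>fraction_coeff R (\<lambda>r. of_bool (x < real r \<and> real r \<le> lam * x)
            - of_bool (y < real r \<and> real r \<le> lam * y)) \<beta>\<bar> \<le> 4 / x + 4 / y"
proof -
  obtain d b where d: "1 \<le> d" "coprime b d" "\<beta> = real b / real d"
    using fractions_reduced[OF assms(6)] by metis
  have "real r * \<beta> \<in> \<int> \<longleftrightarrow> d dvd r" for r
    using multiple_of_reduced_fraction_Ints_iff[of b d "int r"] d by (simp add: mult.commute)
  then have "fraction_coeff R (\<lambda>r. of_bool (x < real r \<and> real r \<le> lam * x)
            - of_bool (y < real r \<and> real r \<le> lam * y)) \<beta> =
    (\<Sum>r | r \<in> {1..R} \<and> d dvd r. of_bool (x < real r \<and> real r \<le> lam * x) / real r) -
    (\<Sum>r | r \<in> {1..R} \<and> d dvd r. of_bool (y < real r \<and> real r \<le> lam * y) / real r)"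
    by (simp add: fraction_coeff_def diff_divide_distrib sum_subtractf)
  moreover have "\<bar>(\<Sum>r | r \<in> {1..R} \<and> d dvd r. of_bool (x < real r \<and> real r \<le> lam * x) / real r)
            - ln lam / real d\<bar> \<le> 4 / x"
    using assms d by (intro sum_inverse_multiples_window) auto
  moreover have "\<bar>(\<Sum>r | r \<in> {1..R} \<and> d dvd r. of_bool (y < real r \<and> real r \<le> lam * y) / real r)
            - ln lam / real d\<bar> \<le> 4 / y"
    using assms d by (intro sum_inverse_multiples_window) auto
  ultimately show ?thesis by linarith
qed

section \<open>Mean squares over boxes\<close>

text \<open>\<open>\<beta> D\<close> is an integer exactly when the reduced denominator of
  \<open>\<beta>\<close> divides \<open>D\<close>, and a denominator \<open>r\<close> admits at most
  \<open>r\<close> numerators.\<close>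

lemma card_fractions_annihilating_le:
  fixes D :: int
  shows "card {\<beta> \<in> fractions R. \<beta> * of_int D \<in> \<int>} \<le> (\<Sum>r | r \<in> {1..R} \<and> int r dvd D. r)"
proof -
  let ?I = "{r. r \<in> {1..R} \<and> int r dvd D}"
  have "{\<beta> \<in> fractions R. \<beta> * of_int D \<in> \<int>} \<subseteq> (\<Union>r\<in>?I. (\<lambda>b. real b / real r) ` {..<r})"
  proof
    fix \<beta> assume \<beta>: "\<beta> \<in> {\<beta> \<in> fractions R. \<beta> * of_int D \<in> \<int>}"
    then obtain d b where d: "1 \<le> d" "d \<le> R" "b < d" "coprime b d" "\<beta> = real b / real d"
      using fractions_reduced by blast
    then have "int d dvd D" using \<beta> multiple_of_reduced_fraction_Ints_iff[of b d D] by simp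
    then have "d \<in> ?I" using d by simp
    moreover have "\<beta> \<in> (\<lambda>b. real b / real d) ` {..<d}" using d by blast
    ultimately show "\<beta> \<in> (\<Union>r\<in>?I. (\<lambda>b. real b / real r) ` {..<r})" by (rule UN_I)
  qed
  then have "card {\<beta> \<in> fractions R. \<beta> * of_int D \<in> \<int>} \<le> card (\<Union>r\<in>?I. (\<lambda>b. real b / real r) ` {..<r})"
    by (intro card_mono) auto
  also have "\<dots> \<le> (\<Sum>r\<in>?I. card ((\<lambda>b. real b / real r) ` {..<r}))"
    by (intro card_UN_le) auto
  also have "\<dots> \<le> (\<Sum>r\<in>?I. r)"
    by (intro sum_mono order.trans[OF card_image_le]) auto
  finally show ?thesis .
qed

text \<open>Says that \<open>w \<mapsto> e(\<beta> * wedge z w)\<close> and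
  \<open>w \<mapsto> e(\<beta>' * wedge z' w)\<close> are the same character of the lattice of all
  integer vectors.\<close>

definition coincide :: "int \<times> int \<Rightarrow> real \<Rightarrow> int \<times> int \<Rightarrow> real \<Rightarrow> bool" where
  "coincide z \<beta> z' \<beta>' \<longleftrightarrow> \<beta> * of_int (fst z) - \<beta>' * of_int (fst z') \<in> \<int> \<and>
     \<beta> * of_int (snd z) - \<beta>' * of_int (snd z') \<in> \<int>"

text \<open>Pairing with a dual vector of the primitive \<open>z'\<close> recovers
  \<open>\<beta>'\<close> modulo 1 from \<open>\<beta>\<close>, so it suffices to count
  \<open>\<beta>\<close>. Eliminating \<open>\<beta>'\<close> from the two conditions leaves
  \<open>\<beta> * wedge z z' \<in> \<int>\<close>.\<close>

lemma card_coincide_le: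
  assumes "primitive z'"
  shows "card {(\<beta>, \<beta>') \<in> fractions R \<times> fractions R. coincide z \<beta> z' \<beta>'} \<le>
    (\<Sum>r | r \<in> {1..R} \<and> int r dvd wedge z z'. r)"
proof -
  let ?C = "{(\<beta>, \<beta>') \<in> fractions R \<times> fractions R. coincide z \<beta> z' \<beta>'}"
  have "inj_on fst ?C"
  proof (rule inj_onI)
    fix p p' assume p: "p \<in> ?C" "p' \<in> ?C" "fst p = fst p'"
    obtain \<beta> \<gamma> \<gamma>' where e: "p = (\<beta>, \<gamma>)" "p' = (\<beta>, \<gamma>')" using p(3) by (cases p, cases p') auto
    obtain b where b: "wedge z' b = 1" using primitive_obtain_dual[OF assms] .
    have g: "0 \<le> \<gamma>" "\<gamma> < 1" "0 \<le> \<gamma>'" "\<gamma>' < 1" using p e fractions_bounds by auto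
    have "(\<beta> * of_int (fst z) - \<gamma>' * of_int (fst z')) - (\<beta> * of_int (fst z) - \<gamma> * of_int (fst z')) \<in> \<int>"
       "(\<beta> * of_int (snd z) - \<gamma>' * of_int (snd z')) - (\<beta> * of_int (snd z) - \<gamma> * of_int (snd z')) \<in> \<int>"
      by (rule Ints_diff; use p e in \<open>simp add: coincide_def\<close>)+
    then have 1: "(\<gamma> - \<gamma>') * of_int (fst z') \<in> \<int>" "(\<gamma> - \<gamma>') * of_int (snd z') \<in> \<int>"
      by (simp_all add: algebra_simps)
    have "(\<gamma> - \<gamma>') * of_int (fst z') * of_int (snd b) - (\<gamma> - \<gamma>') * of_int (snd z') * of_int (fst b) \<in> \<int>"
      by (rule Ints_diff[OF Ints_mult[OF 1(1) Ints_of_int] Ints_mult[OF 1(2) Ints_of_int]])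
    moreover have "(\<gamma> - \<gamma>') * of_int (fst z') * of_int (snd b) - (\<gamma> - \<gamma>') * of_int (snd z') * of_int (fst b)
       = (\<gamma> - \<gamma>') * of_int (wedge z' b)"
      by (simp add: wedge_def algebra_simps)
    ultimately have "\<gamma> - \<gamma>' \<in> \<int>" using b by simp
    then obtain k where k: "\<gamma> - \<gamma>' = of_int k" by (elim Ints_cases)
    then have "k = 0" using g by linarith
    then show "p = p'" using k e by simp
  qed
  moreover have "fst ` ?C \<subseteq> {\<beta> \<in> fractions R. \<beta> * of_int (wedge z z') \<in> \<int>}"
  proof (clarsimp simp: coincide_def)
    fix \<beta> \<gamma> :: real assume 1: "\<beta> * of_int (fst z) - \<gamma> * of_int (fst z') \<in> \<int>" "\<beta> * of_int (snd z) - \<gamma> * of_int (snd z') \<in> \<int>"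
    have "(\<beta> * of_int (fst z) - \<gamma> * of_int (fst z')) * of_int (snd z') - (\<beta> * of_int (snd z) - \<gamma> * of_int (snd z')) * of_int (fst z') \<in> \<int>"
      by (rule Ints_diff[OF Ints_mult[OF 1(1) Ints_of_int] Ints_mult[OF 1(2) Ints_of_int]])
    then show "\<beta> * of_int (wedge z z') \<in> \<int>" by (simp add: wedge_def algebra_simps)
  qed
  ultimately have "card ?C \<le> card {\<beta> \<in> fractions R. \<beta> * of_int (wedge z z') \<in> \<int>}"
    by (intro card_inj_on_le) auto
  then show ?thesis using card_fractions_annihilating_le order.trans by blast
qed

definition grid_box :: "nat \<Rightarrow> int \<times> int \<Rightarrow> (int \<times> int) set" where
  "grid_box H j = {fst j * int H..<fst j * int H + int H} \<times> {snd j * int H..<snd j * int H + int H}"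

text \<open>The sum factors into two one-dimensional sums. If the characters differ, one of the
  frequencies is not an integer but has a denominator at most \<open>R^2\<close>; that factor is at
  most \<open>R^2\<close> and the other one at most \<open>H\<close>.\<close>

lemma norm_box_char_sum_le:
  assumes \<beta>: "\<beta> \<in> fractions R" "\<beta>' \<in> fractions R"
  shows "cmod (\<Sum>w\<in>grid_box H j. unit_char (\<beta> * of_int (wedge z w) - \<beta>' * of_int (wedge z' w)))
    \<le> of_bool (coincide z \<beta> z' \<beta>') * (real H)\<^sup>2 + real H * (real R)\<^sup>2"
proof -
  define x1 where "x1 = \<beta> * of_int (fst z) - \<beta>' * of_int (fst z')"
  define x2 where "x2 = - (\<beta> * of_int (snd z) - \<beta>' * of_int (snd z'))"
  define I where "I a = {a * int H..<a * int H + int H}" for a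
  define U where "U x a = (\<Sum>v\<in>I a. unit_char (x * of_int v))" for x a
  have "(\<Sum>w\<in>grid_box H j. unit_char (\<beta> * of_int (wedge z w) - \<beta>' * of_int (wedge z' w))) =
        (\<Sum>w\<in>I (fst j) \<times> I (snd j). unit_char (x2 * of_int (fst w)) * unit_char (x1 * of_int (snd w)))"
    unfolding unit_char_add[symmetric] grid_box_def I_def
    by (intro sum.cong refl arg_cong[of _ _ unit_char]) (simp add: wedge_def x1_def x2_def algebra_simps)
  also have "\<dots> = U x2 (fst j) * U x1 (snd j)"
    by (simp add: U_def sum_product sum.cartesian_product case_prod_beta)
  finally have eq: "cmod (\<Sum>w\<in>grid_box H j. unit_char (\<beta> * of_int (wedge z w) - \<beta>' * of_int (wedge z' w))) =
      cmod (U x2 (fst j)) * cmod (U x1 (snd j))" by (simp add: norm_mult)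
  have triv: "cmod (U x a) \<le> real H" for x a
  proof -
    have "cmod (U x a) \<le> (\<Sum>v\<in>I a. cmod (unit_char (x * of_int v)))"
      unfolding U_def by (rule norm_sum)
    then show ?thesis by (simp add: I_def)
  qed
  show ?thesis
  proof (cases "coincide z \<beta> z' \<beta>'")
    case True
    have "cmod (U x2 (fst j)) * cmod (U x1 (snd j)) \<le> real H * real H"
      by (intro mult_mono triv) auto
    then show ?thesis unfolding eq using True by (simp add: power2_eq_square add_increasing2)
  next
    case False
    obtain d b where d: "1 \<le> d" "d \<le> R" "\<beta> = real b / real d"
      using fractions_reduced[OF \<beta>(1)] by metis
    obtain d' b' where d': "1 \<le> d'" "d' \<le> R" "\<beta>' = real b' / real d'"
      using fractions_reduced[OF \<beta>(2)] by metis
    have i: "real (d * d') * \<beta> = real (d' * b)" "real (d * d') * \<beta>' = real (d * b')"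
      using d d' by auto
    have "real (d * d') * x1 = real (d * d') * \<beta> * of_int (fst z) - real (d * d') * \<beta>' * of_int (fst z')"
      "real (d * d') * x2 = - (real (d * d') * \<beta> * of_int (snd z) - real (d * d') * \<beta>' * of_int (snd z'))"
      by (simp_all add: x1_def x2_def algebra_simps)
    then have "real (d * d') * x1 \<in> \<int>" "real (d * d') * x2 \<in> \<int>"
      unfolding i by (auto intro!: Ints_diff Ints_mult Ints_minus)
    moreover have "d * d' > 0" using d d' by simp
    ultimately have B: "x \<notin> \<int> \<Longrightarrow> x = x1 \<or> x = x2 \<Longrightarrow> cmod (U x a) \<le> real (d * d')" for x a
      unfolding U_def I_def by (intro norm_sum_unit_char_interval_le) auto
    have "d * d' \<le> R * R" using d d' by (intro mult_mono) auto
    then have dd: "real (d * d') \<le> (real R)\<^sup>2" unfolding power2_eq_square of_nat_mult[symmetric] by (rule of_nat_mono)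
    have "x1 \<notin> \<int> \<or> x2 \<notin> \<int>" 
      using False unfolding coincide_def x1_def x2_def minus_in_Ints_iff by blast
    then have "cmod (U x2 (fst j)) * cmod (U x1 (snd j)) \<le> real H * (real R)\<^sup>2"
    proof
      assume "x1 \<notin> \<int>"
      then have "cmod (U x1 (snd j)) \<le> (real R)\<^sup>2" using B[of x1 "snd j"] dd by simp
      then show ?thesis by (intro mult_mono triv) auto
    next
      assume "x2 \<notin> \<int>"
      then have "cmod (U x2 (fst j)) \<le> (real R)\<^sup>2" using B[of x2 "fst j"] dd by simp
      then have "cmod (U x2 (fst j)) * cmod (U x1 (snd j)) \<le> (real R)\<^sup>2 * real H"
        by (intro mult_mono triv) auto
      then show ?thesis by (simp add: mult.commute)
    qed
    then show ?thesis unfolding eq using False by simp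
  qed
qed

text \<open>Open the square and sum over the box first. Coinciding characters contribute
  \<open>H^2\<close> and are counted by \<open>card_coincide_le\<close>; in addition each of the at
  most \<open>(card V * R^2)^2\<close> pairs contributes \<open>H R^2\<close>, which gives the term
  with \<open>R ^ 6\<close>.\<close>

lemma box_mean_square_le:
  fixes g :: "(int \<times> int) \<times> real \<Rightarrow> complex"
  assumes V: "finite V" "\<And>z. z \<in> V \<Longrightarrow> primitive z"
    and g: "\<And>x. x \<in> V \<times> fractions R \<Longrightarrow> cmod (g x) \<le> \<omega>" and \<omega>: "\<omega> \<ge> 0"
  shows "(\<Sum>w\<in>grid_box H j. (cmod (\<Sum>x\<in>V \<times> fractions R. g x * unit_char (snd x * of_int (wedge (fst x) w))))\<^sup>2)
    \<le> \<omega>\<^sup>2 * ((real H)\<^sup>2 * (\<Sum>z\<in>V. \<Sum>z'\<in>V. \<Sum>r | r \<in> {1..R} \<and> int r dvd wedge z z'. real r)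
         + (real (card V))\<^sup>2 * real R ^ 6 * real H)"
proof -
  let ?X = "V \<times> fractions R"
  define e where "e x w = unit_char (snd x * of_int (wedge (fst x) w))" for x :: "(int \<times> int) \<times> real" and w
  define K where "K x y = (\<Sum>w\<in>grid_box H j. e x w * cnj (e y w))" for x y
  define c where "c x y = real (of_bool (coincide (fst x) (snd x) (fst y) (snd y)))"
    for x y :: "(int \<times> int) \<times> real"
  have "complex_of_real (\<Sum>w\<in>grid_box H j. (cmod (\<Sum>x\<in>?X. g x * e x w))\<^sup>2) =
      (\<Sum>w\<in>grid_box H j. (\<Sum>x\<in>?X. g x * e x w) * cnj (\<Sum>y\<in>?X. g y * e y w))"
    by (simp only: of_real_sum complex_norm_square)
  also have "\<dots> = (\<Sum>w\<in>grid_box H j. \<Sum>x\<in>?X. \<Sum>y\<in>?X. g x * cnj (g y) * (e x w * cnj (e y w)))"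
    by (simp add: sum_product mult_ac)
  also have "\<dots> = (\<Sum>x\<in>?X. \<Sum>y\<in>?X. \<Sum>w\<in>grid_box H j. g x * cnj (g y) * (e x w * cnj (e y w)))"
    by (subst sum.swap, rule sum.cong[OF refl], rule sum.swap)
  also have "\<dots> = (\<Sum>x\<in>?X. \<Sum>y\<in>?X. g x * cnj (g y) * K x y)"
    by (simp add: K_def sum_distrib_left)
  finally have "complex_of_real (\<Sum>w\<in>grid_box H j. (cmod (\<Sum>x\<in>?X. g x * e x w))\<^sup>2) =
      (\<Sum>x\<in>?X. \<Sum>y\<in>?X. g x * cnj (g y) * K x y)" .
  from arg_cong[OF this, of cmod]
  have "(\<Sum>w\<in>grid_box H j. (cmod (\<Sum>x\<in>?X. g x * e x w))\<^sup>2) =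
      cmod (\<Sum>x\<in>?X. \<Sum>y\<in>?X. g x * cnj (g y) * K x y)"
    unfolding norm_of_real by (simp add: sum_nonneg)
  also have "\<dots> \<le> (\<Sum>x\<in>?X. \<Sum>y\<in>?X. cmod (g x * cnj (g y) * K x y))"
    by (intro order.trans[OF norm_sum] sum_mono norm_sum)
  also have "\<dots> \<le> (\<Sum>x\<in>?X. \<Sum>y\<in>?X. \<omega>\<^sup>2 * (c x y * (real H)\<^sup>2 + real H * (real R)\<^sup>2))"
  proof (intro sum_mono)
    fix x y assume xy: "x \<in> ?X" "y \<in> ?X"
    have "K x y = (\<Sum>w\<in>grid_box H j. unit_char (snd x * of_int (wedge (fst x) w) - snd y * of_int (wedge (fst y) w)))"
      unfolding K_def e_def cnj_unit_char unit_char_add[symmetric] by simp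
    then have "cmod (K x y) \<le> c x y * (real H)\<^sup>2 + real H * (real R)\<^sup>2"
      unfolding c_def using norm_box_char_sum_le[of "snd x" R "snd y" "fst x" "fst y" H j] xy by auto
    then have "cmod (g x) * cmod (g y) * cmod (K x y) \<le> \<omega> * \<omega> * (c x y * (real H)\<^sup>2 + real H * (real R)\<^sup>2)"
      using g xy \<omega> by (intro mult_mono) auto
    then show "cmod (g x * cnj (g y) * K x y) \<le> \<omega>\<^sup>2 * (c x y * (real H)\<^sup>2 + real H * (real R)\<^sup>2)"
      by (simp add: norm_mult power2_eq_square)
  qed
  also have "\<dots> = \<omega>\<^sup>2 * ((real H)\<^sup>2 * (\<Sum>x\<in>?X. \<Sum>y\<in>?X. c x y) + (real (card ?X))\<^sup>2 * (real H * (real R)\<^sup>2))"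
    by (simp add: sum.distrib power2_eq_square mult.assoc flip: sum_distrib_left sum_distrib_right)
  also have "\<dots> \<le> \<omega>\<^sup>2 * ((real H)\<^sup>2 * (\<Sum>z\<in>V. \<Sum>z'\<in>V. \<Sum>r | r \<in> {1..R} \<and> int r dvd wedge z z'. real r)
         + (real (card V))\<^sup>2 * real R ^ 6 * real H)"
  proof (intro mult_left_mono add_mono)
    have "(\<Sum>x\<in>?X. \<Sum>y\<in>?X. c x y) = (\<Sum>z\<in>V. \<Sum>\<beta>\<in>fractions R. \<Sum>z'\<in>V. \<Sum>\<beta>'\<in>fractions R. c (z, \<beta>) (z', \<beta>'))"
      by (simp add: sum.cartesian_product')
    also have "\<dots> = (\<Sum>z\<in>V. \<Sum>z'\<in>V. \<Sum>\<beta>\<in>fractions R. \<Sum>\<beta>'\<in>fractions R. c (z, \<beta>) (z', \<beta>'))"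
      by (intro sum.cong refl sum.swap)
    also have "\<dots> \<le> (\<Sum>z\<in>V. \<Sum>z'\<in>V. \<Sum>r | r \<in> {1..R} \<and> int r dvd wedge z z'. real r)"
    proof (intro sum_mono)
      fix z z' assume "z \<in> V" "z' \<in> V"
      have "(\<Sum>\<beta>\<in>fractions R. \<Sum>\<beta>'\<in>fractions R. c (z, \<beta>) (z', \<beta>')) =
        (\<Sum>p\<in>fractions R \<times> fractions R. if coincide z (fst p) z' (snd p) then 1 else 0)"
        by (simp add: sum.cartesian_product case_prod_beta c_def of_bool_def if_distrib cong: if_cong)
      also have "\<dots> = real (card {(\<beta>, \<beta>') \<in> fractions R \<times> fractions R. coincide z \<beta> z' \<beta>'})"
        by (simp flip: sum.inter_filter) (intro arg_cong[of _ _ card], auto)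
      also have "\<dots> \<le> real (\<Sum>r | r \<in> {1..R} \<and> int r dvd wedge z z'. r)"
        using card_coincide_le[of z' R z] V(2)[OF \<open>z' \<in> V\<close>] by (intro of_nat_mono)
      finally show "(\<Sum>\<beta>\<in>fractions R. \<Sum>\<beta>'\<in>fractions R. c (z, \<beta>) (z', \<beta>')) \<le>
         (\<Sum>r | r \<in> {1..R} \<and> int r dvd wedge z z'. real r)" by simp
    qed
    finally show "(\<Sum>x\<in>?X. \<Sum>y\<in>?X. c x y) \<le> (\<Sum>z\<in>V. \<Sum>z'\<in>V. \<Sum>r | r \<in> {1..R} \<and> int r dvd wedge z z'. real r)" .
    have "real (card ?X) \<le> real (card V) * (real R)\<^sup>2"
    proof -
      have "card ?X \<le> card V * R\<^sup>2" unfolding card_cartesian_product by (intro mult_left_mono card_fractions_le) simp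
      then have "real (card ?X) \<le> real (card V * R\<^sup>2)" by (rule of_nat_mono)
      then show ?thesis by simp
    qed
    then have "(real (card ?X))\<^sup>2 \<le> (real (card V) * (real R)\<^sup>2)\<^sup>2" by (intro power_mono) auto
    then have "(real (card ?X))\<^sup>2 * (real H * (real R)\<^sup>2) \<le> (real (card V) * (real R)\<^sup>2)\<^sup>2 * (real H * (real R)\<^sup>2)"
      by (intro mult_right_mono) auto
    also have "\<dots> = (real (card V))\<^sup>2 * real R ^ 6 * real H" by (simp add: power2_eq_square eval_nat_numeral mult_ac)
    finally show "(real (card ?X))\<^sup>2 * (real H * (real R)\<^sup>2) \<le> (real (card V))\<^sup>2 * real R ^ 6 * real H" .
  qed auto
  finally show ?thesis unfolding e_def .
qed

section \<open>Primitive vectors in a disc\<close>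

text \<open>\<open>fst_nonzero\<close> reflects the condition \<open>u v \<noteq> 0\<close>; it
  serves the strip count, where one solves for a coordinate by dividing by
  \<open>fst z\<close>.\<close>

locale primitive_disc =
  fixes V :: "(int \<times> int) set" and f :: "int \<times> int \<Rightarrow> complex" and X :: real
  assumes X1: "X \<ge> 1"
    and prim: "z \<in> V \<Longrightarrow> primitive z"
    and fst_nonzero: "z \<in> V \<Longrightarrow> fst z \<noteq> 0"
    and in_disc: "z \<in> V \<Longrightarrow> (of_int (fst z))\<^sup>2 + (of_int (snd z))\<^sup>2 \<le> X"
    and f_le: "z \<in> V \<Longrightarrow> cmod (f z) \<le> 1"
begin

definition S :: nat where "S = nat \<lfloor>sqrt X\<rfloor>"

lemma S_bounds: "1 \<le> S" "real S \<le> sqrt X"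
proof -
  have "sqrt X \<ge> 1" using X1 by simp
  then show "1 \<le> S" "real S \<le> sqrt X" unfolding S_def by linarith+
qed

lemma sqrt_X: "sqrt X \<ge> 1" "sqrt X * sqrt X = X" "sqrt X \<le> X"
proof -
  show 1: "sqrt X \<ge> 1" "sqrt X * sqrt X = X" using X1 by simp_all
  have "sqrt X * 1 \<le> sqrt X * sqrt X" using 1(1) by (intro mult_left_mono) auto
  then show "sqrt X \<le> X" using 1(2) by simp
qed

lemma coord_le: "z \<in> V \<Longrightarrow> \<bar>fst z\<bar> \<le> int S" "z \<in> V \<Longrightarrow> \<bar>snd z\<bar> \<le> int S"
proof -
  have *: "\<bar>a\<bar> \<le> int S" if "(real_of_int a)\<^sup>2 \<le> X" for a
  proof -
    have "(real_of_int \<bar>a\<bar>)\<^sup>2 \<le> X" using that by simp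
    then have "real_of_int \<bar>a\<bar> \<le> sqrt X" by (rule real_le_rsqrt)
    then show ?thesis unfolding S_def by linarith
  qed
  show "z \<in> V \<Longrightarrow> \<bar>fst z\<bar> \<le> int S" "z \<in> V \<Longrightarrow> \<bar>snd z\<bar> \<le> int S"
    by (rule *, smt (verit) in_disc zero_le_power2)+
qed

lemma V_subset: "V \<subseteq> {- int S..int S} \<times> {- int S..int S}"
proof
  fix z assume "z \<in> V"
  then show "z \<in> {- int S..int S} \<times> {- int S..int S}"
    using coord_le[of z] by (cases z) (simp add: abs_le_iff)
qed

lemma finite_V: "finite V"
  by (rule finite_subset[OF V_subset]) simp

lemma two_S_le: "real (2 * S + 1) \<le> 3 * sqrt X"
  using S_bounds sqrt_X by simp

lemma card_V_le: "real (card V) \<le> 9 * X"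
proof -
  have "card V \<le> card ({- int S..int S} \<times> {- int S..int S})"
    by (rule card_mono[OF _ V_subset]) simp
  also have "\<dots> = (2 * S + 1) * (2 * S + 1)"
  proof -
    have "card {- int S..int S} = 2 * S + 1" by simp
    then show ?thesis unfolding card_cartesian_product by simp
  qed
  finally have "real (card V) \<le> real ((2 * S + 1) * (2 * S + 1))" by (rule of_nat_mono)
  also have "\<dots> = real (2 * S + 1) * real (2 * S + 1)" by (rule of_nat_mult)
  also have "\<dots> \<le> (3 * sqrt X) * (3 * sqrt X)"
    by (intro mult_mono two_S_le) (use sqrt_X in auto)
  also have "\<dots> = 9 * X" using sqrt_X(2) by simp
  finally show ?thesis .
qed

lemma wedge_le: "z \<in> V \<Longrightarrow> w \<in> V \<Longrightarrow> \<bar>real_of_int (wedge z w)\<bar> \<le> X"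
proof -
  assume z: "z \<in> V" and w: "w \<in> V"
  define a b c d where "a = real_of_int (fst z)" "b = real_of_int (snd z)"
    "c = real_of_int (fst w)" "d = real_of_int (snd w)"
  have "a\<^sup>2 + b\<^sup>2 \<le> X" "c\<^sup>2 + d\<^sup>2 \<le> X" using in_disc[OF z] in_disc[OF w] by (auto simp: a_b_c_d_def)
  moreover define t where "t = a * d - c * b"
  have "(a - d)\<^sup>2 + (b + c)\<^sup>2 = (a\<^sup>2 + b\<^sup>2) + (c\<^sup>2 + d\<^sup>2) - 2 * t"
    "(a + d)\<^sup>2 + (b - c)\<^sup>2 = (a\<^sup>2 + b\<^sup>2) + (c\<^sup>2 + d\<^sup>2) + 2 * t"
    by (simp_all add: t_def power2_eq_square algebra_simps)
  moreover have "0 \<le> (a - d)\<^sup>2 + (b + c)\<^sup>2" "0 \<le> (a + d)\<^sup>2 + (b - c)\<^sup>2" by simp_all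
  ultimately have "\<bar>t\<bar> \<le> X" by linarith
  then show ?thesis by (simp add: t_def wedge_def a_b_c_d_def)
qed

section \<open>Boxes of side \<open>H\<close> and the determinant at their corners\<close>

definition cell :: "nat \<Rightarrow> int \<times> int \<Rightarrow> int \<times> int" where
  "cell H w = (fst w div int H, snd w div int H)"

text \<open>The extra 1 makes room for floor division of negative coordinates.\<close>

definition grid :: "nat \<Rightarrow> (int \<times> int) set" where
  "grid H = {- int (S div H + 1)..int (S div H + 1)} \<times> {- int (S div H + 1)..int (S div H + 1)}"

lemma finite_grid [simp]: "finite (grid H)"
  by (simp add: grid_def)

lemma finite_grid_box [simp]: "finite (grid_box H j)"
  by (simp add: grid_box_def)

lemma card_grid_box: "card (grid_box H j) = H\<^sup>2"
  by (simp add: grid_box_def card_cartesian_product power2_eq_square)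

lemma in_grid_box_cell: "H > 0 \<Longrightarrow> w \<in> grid_box H (cell H w)"
proof -
  assume "H > 0"
  have "a div int H * int H \<le> a \<and> a < a div int H * int H + int H" for a
    using div_mult_mod_eq[of a "int H"] pos_mod_bound[of "int H" a] pos_mod_sign[of "int H" a] \<open>H > 0\<close>
    by linarith
  then show ?thesis by (cases w) (simp add: grid_box_def cell_def)
qed

lemma cell_in_grid:
  assumes "H > 0" "w \<in> V"
  shows "cell H w \<in> grid H"
proof -
  have *: "a div int H \<in> {- int (S div H + 1)..int (S div H + 1)}" if "\<bar>a\<bar> \<le> int S" for a
  proof -
    have "a div int H \<le> int S div int H" using that assms by (intro zdiv_mono1) auto
    moreover have "(- int S) div int H \<le> a div int H" using that assms by (intro zdiv_mono1) auto
    moreover have "(- int S) div int H \<ge> - (int S div int H) - 1"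
      using assms by (simp add: zdiv_zminus1_eq_if)
    ultimately show ?thesis by (simp add: zdiv_int)
  qed
  show ?thesis using *[OF coord_le(1)[OF assms(2)]] *[OF coord_le(2)[OF assms(2)]]
    by (simp add: cell_def grid_def)
qed

text \<open>The determinant of \<open>z\<close> with the corner \<open>H j\<close> of the box. It
  stands in for \<open>wedge z w\<close> inside the windows, so that coefficients depend on
  \<open>w\<close> only through its cell.\<close>

definition corner_wedge :: "nat \<Rightarrow> int \<times> int \<Rightarrow> int \<times> int \<Rightarrow> real" where
  "corner_wedge H z j = real H * of_int (wedge z j)"

lemma corner_wedge_diff:
  assumes "H > 0" "z \<in> V"
  shows "\<bar>real_of_int (wedge z w) - corner_wedge H z (cell H w)\<bar> \<le> 2 * sqrt X * real H"
proof -
  let ?h = "int H"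
  have "wedge z w - ?h * wedge z (cell H w) = fst z * (snd w mod ?h) - (fst w mod ?h) * snd z"
    by (simp add: wedge_def cell_def minus_div_mult_eq_mod[symmetric] algebra_simps)
  moreover have "\<bar>fst z * (snd w mod ?h) - (fst w mod ?h) * snd z\<bar> \<le> int S * ?h + ?h * int S"
  proof -
    have "\<bar>fst z * (snd w mod ?h)\<bar> \<le> int S * ?h" "\<bar>(fst w mod ?h) * snd z\<bar> \<le> ?h * int S"
      unfolding abs_mult using assms coord_le[OF assms(2)]
      by (intro mult_mono; simp add: less_imp_le)+
    then show ?thesis by linarith
  qed
  ultimately have "\<bar>wedge z w - ?h * wedge z (cell H w)\<bar> \<le> 2 * int S * ?h"
    by (simp only: mult.commute[of ?h "int S"] mult.assoc)
  then have "real_of_int \<bar>wedge z w - ?h * wedge z (cell H w)\<bar> \<le> real_of_int (2 * int S * ?h)"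
    by (simp only: of_int_le_iff)
  then have "\<bar>real_of_int (wedge z w) - corner_wedge H z (cell H w)\<bar> \<le> 2 * real S * real H"
    by (simp add: corner_wedge_def)
  also have "\<dots> \<le> 2 * sqrt X * real H"
    using S_bounds by (intro mult_right_mono) auto
  finally show ?thesis .
qed

lemma real_S_div_le:
  assumes "H > 0"
  shows "real (S div H) \<le> sqrt X / real H"
proof -
  have "real (S div H) \<le> real S / real H" by (rule of_nat_div_le_of_nat)
  also have "\<dots> \<le> sqrt X / real H" using S_bounds by (intro divide_right_mono) auto
  finally show ?thesis .
qed

lemma grid_size_le:
  assumes "H > 0" "real H \<le> sqrt X"
  shows "real (2 * (S div H + 1) + 1) \<le> 5 * (sqrt X / real H)"
proof -
  have "1 \<le> sqrt X / real H" using assms by simp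
  then show ?thesis using real_S_div_le[OF assms(1)] by simp
qed

lemma card_grid_le:
  assumes "H > 0" "real H \<le> sqrt X"
  shows "real (card (grid H)) \<le> 25 * X / (real H)\<^sup>2"
proof -
  let ?T = "2 * (S div H + 1) + 1"
  have "card {- int (S div H + 1)..int (S div H + 1)} = ?T" by simp
  then have "real (card (grid H)) = real ?T * real ?T"
    unfolding grid_def card_cartesian_product by (simp only: of_nat_mult)
  also have "\<dots> \<le> (5 * (sqrt X / real H)) * (5 * (sqrt X / real H))"
    using grid_size_le[OF assms] by (intro mult_mono) (use sqrt_X in auto)
  also have "\<dots> = 25 * X / (real H)\<^sup>2" using sqrt_X(2) by (simp add: power2_eq_square)
  finally show ?thesis .
qed

text \<open>Corners of the padded grid may lie outside the disc, hence \<open>4 * X\<close> where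
  genuine determinants satisfy the bound \<open>X\<close>. This is the origin of
  \<open>4 * X * lam \<le> N * real R\<close> further on.\<close>

lemma corner_wedge_le:
  assumes "H > 0" "real H \<le> sqrt X" "z \<in> V" "j \<in> grid H"
  shows "\<bar>corner_wedge H z j\<bar> \<le> 4 * X"
proof -
  let ?T = "S div H + 1"
  have j: "\<bar>fst j\<bar> \<le> int ?T" "\<bar>snd j\<bar> \<le> int ?T" using assms(4) by (auto simp: grid_def)
  have "\<bar>wedge z j\<bar> \<le> \<bar>fst z * snd j\<bar> + \<bar>fst j * snd z\<bar>" unfolding wedge_def by linarith
  also have "\<dots> \<le> int S * int ?T + int ?T * int S"
    unfolding abs_mult using j coord_le[OF assms(3)] by (intro add_mono mult_mono) auto
  also have "\<dots> = int (2 * S * ?T)" by (simp add: algebra_simps)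
  finally have "\<bar>wedge z j\<bar> \<le> int (2 * S * ?T)" .
  then have "real_of_int \<bar>wedge z j\<bar> \<le> real_of_int (int (2 * S * ?T))" by (simp only: of_int_le_iff)
  then have "\<bar>real_of_int (wedge z j)\<bar> \<le> 2 * real S * (real (S div H) + 1)"
    by (simp add: algebra_simps)
  also have "\<dots> \<le> 2 * sqrt X * (2 * (sqrt X / real H))"
  proof -
    have "1 \<le> sqrt X / real H" using assms by simp
    then have "real (S div H) + 1 \<le> 2 * (sqrt X / real H)"
      using real_S_div_le[OF assms(1)] by simp
    then show ?thesis using S_bounds sqrt_X by (intro mult_mono) auto
  qed
  also have "\<dots> = 4 * X / real H" using sqrt_X(2) by simp
  finally have "real H * \<bar>real_of_int (wedge z j)\<bar> \<le> real H * (4 * X / real H)"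
    by (rule mult_left_mono) simp
  then show ?thesis using assms(1) by (simp add: corner_wedge_def abs_mult)
qed

lemma card_grid_strip_le:
  assumes "H > 0" "real H \<le> sqrt X" "y \<ge> 0"
  shows "real (card {(z, j). z \<in> V \<and> j \<in> grid H \<and> \<bar>corner_wedge H z j - x\<bar> \<le> y})
    \<le> 15 * X / real H * (4 * (y / real H) * (1 + ln X) + 2 * sqrt X)"
proof -
  let ?T = "S div H + 1"
  have H0: "real H > 0" using assms by simp
  have "\<bar>corner_wedge H z j - x\<bar> \<le> y \<longleftrightarrow> \<bar>of_int (wedge z j) - x / real H\<bar> \<le> y / real H" for z j
  proof -
    have "corner_wedge H z j - x = real H * (of_int (wedge z j) - x / real H)"
      using H0 by (simp add: corner_wedge_def algebra_simps)
    then have "\<bar>corner_wedge H z j - x\<bar> = \<bar>of_int (wedge z j) - x / real H\<bar> * real H"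
      by (simp add: abs_mult)
    then show ?thesis using H0 by (simp only: pos_le_divide_eq)
  qed
  then have "real (card {(z, j). z \<in> V \<and> j \<in> grid H \<and> \<bar>corner_wedge H z j - x\<bar> \<le> y}) =
     real (card {(z, j). z \<in> V \<and> j \<in> {- int ?T..int ?T} \<times> {- int ?T..int ?T} \<and>
            \<bar>of_int (wedge z j) - x / real H\<bar> \<le> y / real H})"
    unfolding grid_def by simp
  also have "\<dots> \<le> (2 * real S + 1) * (2 * real ?T + 1) * (4 * (y / real H) * (1 + ln (real S)) + 2 * real S)"
    using S_bounds(1) assms(3) fst_nonzero coord_le by (intro card_strip_le) auto
  also have "\<dots> \<le> (3 * sqrt X) * (5 * (sqrt X / real H)) * (4 * (y / real H) * (1 + ln X) + 2 * sqrt X)"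
  proof (intro mult_mono add_mono)
    show "2 * real S + 1 \<le> 3 * sqrt X" using two_S_le by simp
    show "2 * real ?T + 1 \<le> 5 * (sqrt X / real H)" using grid_size_le[OF assms(1,2)] by simp
    show "ln (real S) \<le> ln X" using S_bounds sqrt_X by (intro ln_mono) linarith+
    show "0 \<le> 4 * (y / real H) * (1 + ln (real S)) + 2 * real S"
      using assms(3) S_bounds(1) by (intro add_nonneg_nonneg mult_nonneg_nonneg) auto
    show "0 \<le> 1 + ln (real S)" using S_bounds(1) by simp
  qed (use S_bounds sqrt_X assms in auto)
  also have "(3 * sqrt X) * (5 * (sqrt X / real H)) = 15 * X / real H" using sqrt_X(2) by simp
  finally show ?thesis .
qed

text \<open>Separates two constraints: \<open>Q\<close> restricts only the cell and \<open>P\<close>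
  restricts \<open>w\<close> inside it. Strip counts over cells and counts inside one box can then
  be multiplied.\<close>

lemma card_pairs_le_cells:
  assumes H: "H > 0" and B: "\<And>z j. z \<in> V \<Longrightarrow> real (card {w \<in> grid_box H j. P z w}) \<le> B"
  shows "real (card {(z, w). z \<in> V \<and> w \<in> V \<and> Q z (cell H w) \<and> P z w})
    \<le> B * real (card {(z, j). z \<in> V \<and> j \<in> grid H \<and> Q z j})"
proof -
  let ?A = "{(z, j). z \<in> V \<and> j \<in> grid H \<and> Q z j}"
  let ?B = "\<lambda>p. {w \<in> grid_box H (snd p). P (fst p) w}"
  let ?C = "{(z, w). z \<in> V \<and> w \<in> V \<and> Q z (cell H w) \<and> P z w}"
  have finA: "finite ?A"
    by (rule finite_subset[of _ "V \<times> grid H"]) (use finite_V in auto)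
  have "inj_on (\<lambda>(z, w). ((z, cell H w), w)) ?C" by (auto simp: inj_on_def)
  moreover have "(\<lambda>(z, w). ((z, cell H w), w)) ` ?C \<subseteq> Sigma ?A ?B"
    using cell_in_grid[OF H] in_grid_box_cell[OF H] by auto
  ultimately have "card ?C \<le> card (Sigma ?A ?B)"
    using finA by (intro card_inj_on_le) auto
  also have "\<dots> = (\<Sum>p\<in>?A. card (?B p))" using finA by (intro card_SigmaI) auto
  finally have "real (card ?C) \<le> real (\<Sum>p\<in>?A. card (?B p))" by (rule of_nat_mono)
  also have "\<dots> = (\<Sum>p\<in>?A. real (card (?B p)))" by simp
  also have "\<dots> \<le> (\<Sum>p\<in>?A. B)" using B by (intro sum_mono) auto
  finally show ?thesis by (simp add: mult.commute)
qed

text \<open>For these pairs the window starts at or below \<open>Y / N\<close>, too low for a useful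
  bound on the coefficients, so they are estimated by counting. Divisibility by \<open>r\<close> is
  exploited inside each box and saves a factor \<open>r\<close>; the sum over \<open>r\<close>
  therefore costs only a logarithm.\<close>

lemma bad_cells_le:
  assumes H: "H > 0" "real H \<le> sqrt X" and R: "1 \<le> R" "R \<le> H" and Y: "Y \<ge> 0"
  shows "(\<Sum>r\<in>{1..R}. real (card {(z, w). z \<in> V \<and> w \<in> V \<and> \<bar>corner_wedge H z (cell H w)\<bar> \<le> Y
            \<and> int r dvd wedge z w}))
    \<le> 135 * X * (1 + ln (real R)) * (4 * Y * (1 + ln X) + 2 * sqrt X * real H)"
proof -
  define P where "P = 15 * X / real H * (4 * (Y / real H) * (1 + ln X) + 2 * sqrt X)"
  have lnX: "ln X \<ge> 0" using X1 by simp
  have P0: "P \<ge> 0"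
    unfolding P_def using X1 H Y lnX by (intro mult_nonneg_nonneg add_nonneg_nonneg divide_nonneg_nonneg) auto
  have "(\<Sum>r\<in>{1..R}. real (card {(z, w). z \<in> V \<and> w \<in> V \<and> \<bar>corner_wedge H z (cell H w)\<bar> \<le> Y
            \<and> int r dvd wedge z w})) \<le> (\<Sum>r\<in>{1..R}. 9 * (real H)\<^sup>2 / real r * P)"
  proof (rule sum_mono)
    fix r assume r: "r \<in> {1..R}"
    have "real (card {(z, w). z \<in> V \<and> w \<in> V \<and> \<bar>corner_wedge H z (cell H w)\<bar> \<le> Y \<and> int r dvd wedge z w})
      \<le> 9 * (real H)\<^sup>2 / real r * real (card {(z, j). z \<in> V \<and> j \<in> grid H \<and> \<bar>corner_wedge H z j\<bar> \<le> Y})"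
      using r R unfolding grid_box_def
      by (intro card_pairs_le_cells[OF H(1), unfolded grid_box_def] card_line_in_box_le prim) auto
    also have "\<dots> \<le> 9 * (real H)\<^sup>2 / real r * P"
      using card_grid_strip_le[OF H Y, of 0] unfolding P_def by (intro mult_left_mono) auto
    finally show "real (card {(z, w). z \<in> V \<and> w \<in> V \<and> \<bar>corner_wedge H z (cell H w)\<bar> \<le> Y \<and> int r dvd wedge z w})
      \<le> 9 * (real H)\<^sup>2 / real r * P" .
  qed
  also have "\<dots> = 9 * (real H)\<^sup>2 * P * harm R"
    by (simp add: harm_def sum_distrib_left inverse_eq_divide mult_ac)
  also have "\<dots> \<le> 9 * (real H)\<^sup>2 * P * (1 + ln (real R))"
    using P0 R by (intro mult_left_mono harm_le_one_plus_ln mult_nonneg_nonneg) auto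
  also have "9 * (real H)\<^sup>2 * P = 135 * X * (4 * Y * (1 + ln X) + 2 * sqrt X * real H)"
    using H by (simp add: P_def power2_eq_square field_simps)
  also have "135 * X * (4 * Y * (1 + ln X) + 2 * sqrt X * real H) * (1 + ln (real R)) =
      135 * X * (1 + ln (real R)) * (4 * Y * (1 + ln X) + 2 * sqrt X * real H)"
    by (simp only: mult_ac)
  finally show ?thesis .
qed

text \<open>\<open>r\<close> lies in the window of \<open>y\<close> exactly when
  \<open>r N / lam \<le> y < r N\<close>. The tolerance is the oscillation of the determinant over a
  cell, so these are the cells where the corner may misjudge that membership.\<close>

definition near_edge :: "nat \<Rightarrow> real \<Rightarrow> real \<Rightarrow> nat \<Rightarrow> int \<times> int \<Rightarrow> int \<times> int \<Rightarrow> bool" where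
  "near_edge H N lam r z j \<longleftrightarrow>
     \<bar>\<bar>corner_wedge H z j\<bar> - real r * N\<bar> \<le> 2 * sqrt X * real H \<or>
     \<bar>\<bar>corner_wedge H z j\<bar> - real r * N / lam\<bar> \<le> 2 * sqrt X * real H"

text \<open>The strips are so thin that divisibility by \<open>r\<close> can be ignored: all
  \<open>H^2\<close> points of each box are counted, and the resulting factor \<open>R\<close> is
  compensated by a small \<open>H\<close>.\<close>

lemma edge_cells_le:
  assumes H: "H > 0" "real H \<le> sqrt X"
  shows "(\<Sum>r\<in>{1..R}. real (card {(z, w). z \<in> V \<and> w \<in> V \<and> near_edge H N lam r z (cell H w)}))
    \<le> 600 * real R * X * sqrt X * real H * (1 + ln X)"
proof -
  define d where "d = 2 * sqrt X * real H"
  have d0: "d \<ge> 0" using sqrt_X by (simp add: d_def)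
  have lnX: "ln X \<ge> 0" using X1 by simp
  define P where "P = 15 * X / real H * (4 * (d / real H) * (1 + ln X) + 2 * sqrt X)"
  let ?E = "\<lambda>x. {(z, j). z \<in> V \<and> j \<in> grid H \<and> \<bar>corner_wedge H z j - x\<bar> \<le> d}"
  have finE: "finite (?E x)" for x
    by (rule finite_subset[of _ "V \<times> grid H"]) (use finite_V in auto)
  have one: "real (card {(z, w). z \<in> V \<and> w \<in> V \<and> near_edge H N lam r z (cell H w)})
      \<le> (real H)\<^sup>2 * (4 * P)" for r
  proof -
    let ?x = "real r * N" and ?y = "real r * N / lam"
    have "real (card {(z, w). z \<in> V \<and> w \<in> V \<and> near_edge H N lam r z (cell H w) \<and> True})
      \<le> (real H)\<^sup>2 * real (card {(z, j). z \<in> V \<and> j \<in> grid H \<and> near_edge H N lam r z j})"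
      by (rule card_pairs_le_cells[OF H(1)]) (simp add: card_grid_box)
    moreover have "real (card {(z, j). z \<in> V \<and> j \<in> grid H \<and> near_edge H N lam r z j}) \<le> 4 * P"
    proof -
      \<comment> \<open>Two endpoints and two signs of the corner value make four strips.\<close>
      have "{(z, j). z \<in> V \<and> j \<in> grid H \<and> near_edge H N lam r z j} \<subseteq>
          (?E ?x \<union> ?E (- ?x)) \<union> (?E ?y \<union> ?E (- ?y))"
      proof -
        have "\<bar>a - x\<bar> \<le> d \<or> \<bar>a - (- x)\<bar> \<le> d" if "\<bar>\<bar>a\<bar> - x\<bar> \<le> d" for a x
          using that by linarith
        then show ?thesis unfolding near_edge_def d_def[symmetric] by blast
      qed
      then have "card {(z, j). z \<in> V \<and> j \<in> grid H \<and> near_edge H N lam r z j} \<le>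
          card ((?E ?x \<union> ?E (- ?x)) \<union> (?E ?y \<union> ?E (- ?y)))"
        by (intro card_mono finite_UnI finE)
      also have "\<dots> \<le> (card (?E ?x) + card (?E (- ?x))) + (card (?E ?y) + card (?E (- ?y)))"
        by (intro order.trans[OF card_Un_le] add_mono card_Un_le)
      finally have "real (card {(z, j). z \<in> V \<and> j \<in> grid H \<and> near_edge H N lam r z j}) \<le>
         real ((card (?E ?x) + card (?E (- ?x))) + (card (?E ?y) + card (?E (- ?y))))" by (rule of_nat_mono)
      also have "\<dots> = (real (card (?E ?x)) + real (card (?E (- ?x)))) + (real (card (?E ?y)) + real (card (?E (- ?y))))"
        by (simp only: of_nat_add)
      also have "\<dots> \<le> (P + P) + (P + P)"
        unfolding P_def by (intro add_mono card_grid_strip_le H d0)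
      finally show ?thesis by simp
    qed
    then have "(real H)\<^sup>2 * real (card {(z, j). z \<in> V \<and> j \<in> grid H \<and> near_edge H N lam r z j})
        \<le> (real H)\<^sup>2 * (4 * P)" by (rule mult_left_mono) simp
    ultimately show ?thesis by simp
  qed
  have "(\<Sum>r\<in>{1..R}. real (card {(z, w). z \<in> V \<and> w \<in> V \<and> near_edge H N lam r z (cell H w)}))
     \<le> (\<Sum>r\<in>{1..R}. (real H)\<^sup>2 * (4 * P))" by (intro sum_mono one)
  also have "\<dots> = real R * ((real H)\<^sup>2 * (4 * P))" by simp
  also have "(real H)\<^sup>2 * (4 * P) = 60 * X * sqrt X * real H * (8 * (1 + ln X) + 2)"
    using H by (simp add: P_def d_def power2_eq_square field_simps)
  also have "real R * (60 * X * sqrt X * real H * (8 * (1 + ln X) + 2)) \<le>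
      real R * (60 * X * sqrt X * real H * (10 * (1 + ln X)))"
    using lnX X1 by (intro mult_left_mono) auto
  also have "\<dots> = 600 * real R * X * sqrt X * real H * (1 + ln X)" by simp
  finally show ?thesis .
qed

text \<open>The weight \<open>r\<close> cancels the density \<open>1 / r\<close> of vectors on a
  line modulo \<open>r\<close>, so each \<open>r\<close> contributes the order of \<open>X^2\<close>
  and the total grows only linearly in \<open>R\<close>.\<close>

lemma sum_common_divisors_le:
  assumes "real R \<le> real (2 * S + 1)"
  shows "(\<Sum>z\<in>V. \<Sum>z'\<in>V. \<Sum>r | r \<in> {1..R} \<and> int r dvd wedge z z'. real r) \<le> 729 * X\<^sup>2 * real R"
proof -
  let ?l = "2 * S + 1"
  have "(\<Sum>z'\<in>V. \<Sum>r | r \<in> {1..R} \<and> int r dvd wedge z z'. real r) \<le> real R * (81 * X)" if z: "z \<in> V" for z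
  proof -
    have "(\<Sum>z'\<in>V. \<Sum>r | r \<in> {1..R} \<and> int r dvd wedge z z'. real r) =
       (\<Sum>z'\<in>V. \<Sum>r\<in>{1..R}. if int r dvd wedge z z' then real r else 0)"
      by (simp flip: sum.inter_filter)
    also have "\<dots> = (\<Sum>r\<in>{1..R}. \<Sum>z'\<in>V. if int r dvd wedge z z' then real r else 0)"
      by (rule sum.swap)
    also have "\<dots> = (\<Sum>r\<in>{1..R}. real r * real (card {z' \<in> V. int r dvd wedge z z'}))"
      using finite_V by (simp add: mult.commute flip: sum.inter_filter)
    also have "\<dots> \<le> (\<Sum>r\<in>{1..R}. 81 * X)"
    proof (rule sum_mono)
      fix r assume r: "r \<in> {1..R}"
      let ?B = "{w \<in> {- int S..<- int S + int ?l} \<times> {- int S..<- int S + int ?l}. int r dvd wedge z w}"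
      have "{z' \<in> V. int r dvd wedge z z'} \<subseteq> ?B" using V_subset by auto
      then have "card {z' \<in> V. int r dvd wedge z z'} \<le> card ?B" by (intro card_mono) auto
      then have "real (card {z' \<in> V. int r dvd wedge z z'}) \<le> real (card ?B)" by simp
      also have "\<dots> \<le> 9 * (real ?l)\<^sup>2 / real r"
        using r assms by (intro card_line_in_box_le prim z) auto
      finally have "real r * real (card {z' \<in> V. int r dvd wedge z z'}) \<le> real r * (9 * (real ?l)\<^sup>2 / real r)"
        by (rule mult_left_mono) simp
      also have "\<dots> = 9 * (real ?l)\<^sup>2" using r by simp
      also have "\<dots> \<le> 9 * (3 * sqrt X)\<^sup>2"
        by (intro mult_left_mono power_mono two_S_le) auto
      also have "\<dots> = 81 * X" using sqrt_X(2) by (simp add: power2_eq_square)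
      finally show "real r * real (card {z' \<in> V. int r dvd wedge z z'}) \<le> 81 * X" .
    qed
    also have "\<dots> = real R * (81 * X)" by simp
    finally show ?thesis .
  qed
  then have "(\<Sum>z\<in>V. \<Sum>z'\<in>V. \<Sum>r | r \<in> {1..R} \<and> int r dvd wedge z z'. real r) \<le> (\<Sum>z\<in>V. real R * (81 * X))"
    by (intro sum_mono)
  also have "\<dots> = real (card V) * (real R * (81 * X))" by simp
  also have "\<dots> \<le> (9 * X) * (real R * (81 * X))"
    using X1 by (intro mult_right_mono card_V_le) auto
  finally show ?thesis by (simp add: power2_eq_square mult_ac)
qed

end

section \<open>Switching to the complementary divisor\<close>

lemma sum_swap3:
  "(\<Sum>x\<in>A. \<Sum>y\<in>B. \<Sum>r\<in>C. g x y r) = (\<Sum>r\<in>C. \<Sum>x\<in>A. \<Sum>y\<in>B. g x y r)"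
proof -
  have "(\<Sum>x\<in>A. \<Sum>y\<in>B. \<Sum>r\<in>C. g x y r) = (\<Sum>x\<in>A. \<Sum>r\<in>C. \<Sum>y\<in>B. g x y r)"
    by (intro sum.cong refl sum.swap)
  also have "\<dots> = (\<Sum>r\<in>C. \<Sum>x\<in>A. \<Sum>y\<in>B. g x y r)" by (rule sum.swap)
  finally show ?thesis .
qed

context primitive_disc
begin

text \<open>
  \<open>in_window N lam y\<close> describes the complementary divisors \<open>r = y / m\<close> of the divisors
  \<open>m \<in> [N / lam, N)\<close> of \<open>y\<close>.
\<close>

definition in_window :: "real \<Rightarrow> real \<Rightarrow> real \<Rightarrow> nat \<Rightarrow> bool" where
  "in_window N lam y r \<longleftrightarrow> y / N < real r \<and> real r \<le> lam * (y / N)"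

text \<open>A difference of two windows with the same ratio \<open>lam\<close>, which is what
  \<open>fraction_coeff_window_diff\<close> requires.\<close>

definition local_coeff :: "nat \<Rightarrow> real \<Rightarrow> real \<Rightarrow> real \<Rightarrow> int \<times> int \<Rightarrow> int \<times> int \<Rightarrow> nat \<Rightarrow> real" where
  "local_coeff H N lam R1 z j r =
     of_bool (in_window N lam \<bar>corner_wedge H z j\<bar> r) - of_bool (R1 < real r \<and> real r \<le> lam * R1)"

text \<open>Cauchy-Schwarz is applied to the sum over \<open>w\<close> only. The
  \<open>z\<close>-sum becomes a combination of characters whose coefficients are uniformly at most
  \<open>4 N / Y + 4 / R1\<close>, so its mean square over boxes is governed by coinciding
  characters, and the loss is \<open>sqrt R\<close>.\<close>

lemma main_term_le:
  assumes H: "H > 0" "real H \<le> sqrt X" and R: "R \<ge> 1" "R \<le> H" "R ^ 5 \<le> H"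
    and N: "N > 0" and lam: "lam \<ge> 1" and Y: "Y > 0" and R1: "R1 > 0"
    and RN: "4 * X * lam \<le> N * real R" and RR: "lam * R1 \<le> real R"
  shows "cmod (\<Sum>z\<in>V. \<Sum>w\<in>V. f z * cnj (f w) *
      of_real (of_bool (Y < \<bar>corner_wedge H z (cell H w)\<bar>) *
        (\<Sum>r | r \<in> {1..R} \<and> int r dvd wedge z w. local_coeff H N lam R1 z (cell H w) r)))
    \<le> 427 * X\<^sup>2 * (4 * N / Y + 4 / R1) * sqrt (real R)"
proof -
  define \<omega> where "\<omega> = 4 * N / Y + 4 / R1"
  have \<omega>0: "\<omega> \<ge> 0" using N Y R1 by (simp add: \<omega>_def)
  define good where "good z j \<longleftrightarrow> Y < \<bar>corner_wedge H z j\<bar>" for z j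
  let ?F = "fractions R"
  define g where "g j x = f (fst x) * of_real (of_bool (good (fst x) j) *
      fraction_coeff R (local_coeff H N lam R1 (fst x) j) (snd x))" for j x
  define h where "h j w = (\<Sum>x\<in>V \<times> ?F. g j x * unit_char (snd x * of_int (wedge (fst x) w)))" for j w
  have g_le: "cmod (g j x) \<le> \<omega>" if j: "j \<in> grid H" and x: "x \<in> V \<times> ?F" for j x
  proof (cases "good (fst x) j")
    case True
    define D where "D = \<bar>corner_wedge H (fst x) j\<bar>"
    have D: "D > Y" using True by (simp add: good_def D_def)
    have "D \<le> 4 * X" unfolding D_def using H j x by (intro corner_wedge_le) auto
    \<comment> \<open>The whole window has to lie inside \<open>{1..R}\<close>; truncating it would
      destroy the cancellation of the two main terms.\<close>
    then have "lam * (D / N) \<le> lam * (4 * X / N)"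
      using N lam by (intro mult_left_mono divide_right_mono) auto
    also have "\<dots> = (4 * X * lam) / N" by simp
    also have "\<dots> \<le> real R" using RN N by (simp add: pos_divide_le_eq mult.commute)
    finally have "lam * (D / N) \<le> real R" .
    then have "\<bar>fraction_coeff R (local_coeff H N lam R1 (fst x) j) (snd x)\<bar> \<le> 4 / (D / N) + 4 / R1"
      unfolding local_coeff_def in_window_def D_def[symmetric]
      using D Y N R1 lam RR x by (intro fraction_coeff_window_diff) auto
    also have "4 / (D / N) \<le> 4 * N / Y"
      using D Y N by (simp add: divide_left_mono)
    finally have "\<bar>fraction_coeff R (local_coeff H N lam R1 (fst x) j) (snd x)\<bar> \<le> \<omega>"
      by (simp add: \<omega>_def)
    then have "cmod (f (fst x)) * \<bar>fraction_coeff R (local_coeff H N lam R1 (fst x) j) (snd x)\<bar> \<le> 1 * \<omega>"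
      using x f_le by (intro mult_mono) auto
    then show ?thesis using True by (simp add: g_def norm_mult)
  qed (use \<omega>0 in \<open>simp add: g_def\<close>)
  have expand: "(\<Sum>z\<in>V. f z * of_real (of_bool (good z j) *
        (\<Sum>r | r \<in> {1..R} \<and> int r dvd wedge z w. local_coeff H N lam R1 z j r))) = h j w" for j w
  proof -
    have "f z * of_real (of_bool (good z j) * (\<Sum>r | r \<in> {1..R} \<and> int r dvd wedge z w. local_coeff H N lam R1 z j r))
        = (\<Sum>\<beta>\<in>?F. g j (z, \<beta>) * unit_char (\<beta> * of_int (wedge z w)))" for z
      unfolding g_def of_real_mult divisor_sum_eq_char_sum
      by (simp add: sum_distrib_left mult_ac)
    then show ?thesis by (simp add: h_def sum.cartesian_product case_prod_beta)
  qed
  have "(\<Sum>z\<in>V. \<Sum>w\<in>V. f z * cnj (f w) *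
      of_real (of_bool (good z (cell H w)) *
        (\<Sum>r | r \<in> {1..R} \<and> int r dvd wedge z w. local_coeff H N lam R1 z (cell H w) r))) =
     (\<Sum>w\<in>V. cnj (f w) * h (cell H w) w)"
    unfolding expand[symmetric] by (subst sum.swap) (simp add: sum_distrib_left mult_ac)
  also have "cmod \<dots> \<le> (\<Sum>w\<in>V. cmod (cnj (f w) * h (cell H w) w))" by (rule norm_sum)
  also have "\<dots> \<le> (\<Sum>w\<in>V. 1 * cmod (h (cell H w) w))"
  proof (rule sum_mono)
    fix w assume "w \<in> V"
    then have "cmod (f w) * cmod (h (cell H w) w) \<le> 1 * cmod (h (cell H w) w)"
      by (intro mult_right_mono f_le) auto
    then show "cmod (cnj (f w) * h (cell H w) w) \<le> 1 * cmod (h (cell H w) w)"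
      by (simp add: norm_mult)
  qed
  finally have le: "cmod (\<Sum>z\<in>V. \<Sum>w\<in>V. f z * cnj (f w) *
      of_real (of_bool (good z (cell H w)) *
        (\<Sum>r | r \<in> {1..R} \<and> int r dvd wedge z w. local_coeff H N lam R1 z (cell H w) r)))
      \<le> (\<Sum>w\<in>V. 1 * cmod (h (cell H w) w))" (is "?lhs \<le> ?sum") .
  define Q where "Q = (\<Sum>z\<in>V. \<Sum>z'\<in>V. \<Sum>r | r \<in> {1..R} \<and> int r dvd wedge z z'. real r)"
  have "?sum\<^sup>2 \<le> (\<Sum>w\<in>V. 1\<^sup>2) * (\<Sum>w\<in>V. (cmod (h (cell H w) w))\<^sup>2)"
    by (rule Cauchy_Schwarz_ineq_sum)
  also have "\<dots> = real (card V) * (\<Sum>w\<in>V. (cmod (h (cell H w) w))\<^sup>2)" by simp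
  \<comment> \<open>By positivity the sum over \<open>w\<close> is enlarged from \<open>V\<close> to
    full boxes, on which complete character sums are available.\<close>
  also have "\<dots> \<le> real (card V) * (\<Sum>p\<in>Sigma (grid H) (grid_box H). (cmod (h (fst p) (snd p)))\<^sup>2)"
  proof (intro mult_left_mono sum_le_included[where i = snd] ballI)
    fix w assume "w \<in> V"
    then have "(cell H w, w) \<in> Sigma (grid H) (grid_box H)"
      using cell_in_grid[OF H(1)] in_grid_box_cell[OF H(1)] by auto
    then show "\<exists>p\<in>Sigma (grid H) (grid_box H). snd p = w \<and>
        (cmod (h (cell H w) w))\<^sup>2 \<le> (cmod (h (fst p) (snd p)))\<^sup>2"
      by (intro bexI[of _ "(cell H w, w)"]) auto
  qed (use finite_V in auto)
  also have "(\<Sum>p\<in>Sigma (grid H) (grid_box H). (cmod (h (fst p) (snd p)))\<^sup>2) =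
      (\<Sum>j\<in>grid H. \<Sum>w\<in>grid_box H j. (cmod (h j w))\<^sup>2)"
    by (simp add: sum.Sigma case_prod_beta)
  also have "real (card V) * \<dots> \<le> (9 * X) * (\<Sum>j\<in>grid H. \<omega>\<^sup>2 * ((real H)\<^sup>2 * Q + (real (card V))\<^sup>2 * real R ^ 6 * real H))"
    unfolding h_def Q_def using X1
    by (intro mult_mono card_V_le sum_mono box_mean_square_le finite_V prim g_le \<omega>0 sum_nonneg) auto
  also have "\<dots> = (9 * X) * (real (card (grid H)) * (\<omega>\<^sup>2 * ((real H)\<^sup>2 * Q + (real (card V))\<^sup>2 * real R ^ 6 * real H)))"
    by simp
  also have "\<dots> \<le> (9 * X) * ((25 * X / (real H)\<^sup>2) * (\<omega>\<^sup>2 * ((real H)\<^sup>2 * (810 * X\<^sup>2 * real R))))"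
  proof (intro mult_left_mono mult_mono card_grid_le H)
    have "R \<le> 2 * S + 1"
    proof -
      have "real R \<le> sqrt X" using R H by linarith
      then show ?thesis unfolding S_def by linarith
    qed
    then have "Q \<le> 729 * X\<^sup>2 * real R" unfolding Q_def by (intro sum_common_divisors_le) simp
    then have 1: "(real H)\<^sup>2 * Q \<le> (real H)\<^sup>2 * (729 * X\<^sup>2 * real R)" by (rule mult_left_mono) simp
    \<comment> \<open>The assumption \<open>R ^ 5 \<le> H\<close> makes the non-coinciding pairs no
      larger than the coinciding ones.\<close>
    have "(real (card V))\<^sup>2 * real R ^ 6 * real H \<le> (9 * X)\<^sup>2 * (real R * real H) * real H"
    proof (intro mult_mono power_mono card_V_le)
      have "real (R ^ 5) \<le> real H" using R(3) by (rule of_nat_mono)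
      then have "real R * real R ^ 5 \<le> real R * real H" by (intro mult_left_mono) auto
      then show "real R ^ 6 \<le> real R * real H" by (simp add: eval_nat_numeral)
    qed auto
    also have "\<dots> = (real H)\<^sup>2 * (81 * X\<^sup>2 * real R)" by (simp add: power2_eq_square)
    finally show "(real H)\<^sup>2 * Q + (real (card V))\<^sup>2 * real R ^ 6 * real H \<le> (real H)\<^sup>2 * (810 * X\<^sup>2 * real R)"
      using 1 by (simp add: algebra_simps)
    have "Q \<ge> 0" unfolding Q_def by (intro sum_nonneg) simp
    then show "0 \<le> \<omega>\<^sup>2 * ((real H)\<^sup>2 * Q + (real (card V))\<^sup>2 * real R ^ 6 * real H)"
      by (intro add_nonneg_nonneg mult_nonneg_nonneg) auto
  qed (use X1 in auto)
  also have "\<dots> = 182250 * X ^ 4 * \<omega>\<^sup>2 * real R"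
    using H by (simp add: power2_eq_square eval_nat_numeral field_simps)
  \<comment> \<open>Rounded up to \<open>182329 = 427^2\<close>, a perfect square.\<close>
  also have "\<dots> \<le> 182329 * X ^ 4 * \<omega>\<^sup>2 * real R" by (intro mult_right_mono) auto
  also have "\<dots> = (427 * X\<^sup>2 * \<omega> * sqrt (real R))\<^sup>2"
    by (simp add: power_mult_distrib flip: power_mult)
  finally have "?sum \<le> 427 * X\<^sup>2 * \<omega> * sqrt (real R)"
    using \<omega>0 by (intro power2_le_imp_le[of ?sum]) auto
  then show ?thesis using le unfolding good_def \<omega>_def by linarith
qed

definition divisor_count :: "real \<Rightarrow> real \<Rightarrow> int \<times> int \<Rightarrow> int \<times> int \<Rightarrow> nat" where
  "divisor_count N lam z w = card {m::nat. 1 \<le> m \<and> N / lam \<le> real m \<and> real m < N \<and> int m dvd wedge z w}"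

lemma finite_below: "finite {m::nat. 1 \<le> m \<and> real m < N}" "N > 0 \<Longrightarrow> real (card {m::nat. 1 \<le> m \<and> real m < N}) \<le> N"
proof -
  have sub: "{m::nat. 1 \<le> m \<and> real m < N} \<subseteq> {1..nat \<lfloor>N\<rfloor>}" by auto linarith
  then show "finite {m::nat. 1 \<le> m \<and> real m < N}" by (rule finite_subset) simp
  assume "N > 0"
  then have "card {m::nat. 1 \<le> m \<and> real m < N} \<le> nat \<lfloor>N\<rfloor>" using card_mono[OF _ sub] by simp
  then show "real (card {m::nat. 1 \<le> m \<and> real m < N}) \<le> N" using \<open>N > 0\<close> by linarith
qed

lemma sum_line_norm_eq_divisor_count:
  "complex_of_real (\<Sum>m | 1 \<le> m \<and> N / lam \<le> real m \<and> real m < N. line_norm V f m) =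
   (\<Sum>z\<in>V. \<Sum>w\<in>V. f z * cnj (f w) * of_nat (divisor_count N lam z w))"
proof -
  let ?M = "{m::nat. 1 \<le> m \<and> N / lam \<le> real m \<and> real m < N}"
  have fin: "finite ?M" by (rule finite_subset[OF _ finite_below(1)[of N]]) auto
  have "complex_of_real (\<Sum>m\<in>?M. line_norm V f m) =
      (\<Sum>m\<in>?M. \<Sum>z\<in>V. \<Sum>w\<in>V. if int m dvd wedge z w then f z * cnj (f w) else 0)"
    using line_norm_eq[OF prim finite_V] finite_V by (simp flip: sum.inter_filter)
  also have "\<dots> = (\<Sum>z\<in>V. \<Sum>w\<in>V. \<Sum>m\<in>?M. if int m dvd wedge z w then f z * cnj (f w) else 0)"
    by (subst sum.swap, rule sum.cong[OF refl], rule sum.swap)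
  also have "\<dots> = (\<Sum>z\<in>V. \<Sum>w\<in>V. f z * cnj (f w) * of_nat (divisor_count N lam z w))"
    using fin by (intro sum.cong refl) (simp add: divisor_count_def conj_ac mult.commute flip: sum.inter_filter)
  finally show ?thesis .
qed

lemma divisor_count_eq_windows:
  assumes z: "z \<in> V" "w \<in> V" "wedge z w \<noteq> 0" and N: "N > 0" and lam: "lam \<ge> 1"
    and RN: "4 * X * lam \<le> N * real R"
  shows "divisor_count N lam z w =
    card {r. r \<in> {1..R} \<and> int r dvd wedge z w \<and> in_window N lam \<bar>of_int (wedge z w)\<bar> r}"
proof -
  have "\<bar>real_of_int (wedge z w)\<bar> \<le> X" using z by (intro wedge_le)
  also have "X \<le> N / lam * real R"
  proof -
    have "X * lam \<le> N * real R" using RN X1 lam mult_nonneg_nonneg[of X lam] by linarith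
    then show ?thesis using lam by (simp add: pos_le_divide_eq)
  qed
  finally have "divisor_count N lam z w = card {r \<in> {1..R}. int r dvd wedge z w \<and>
      real r * (N / lam) \<le> \<bar>of_int (wedge z w)\<bar> \<and> \<bar>of_int (wedge z w)\<bar> < real r * N}"
    unfolding divisor_count_def using z N lam by (intro card_complementary_divisors) auto
  moreover have "in_window N lam y r \<longleftrightarrow> real r * (N / lam) \<le> y \<and> y < real r * N" for y r
    using N lam by (auto simp: in_window_def field_simps)
  ultimately show ?thesis by simp
qed

lemma card_parallel_pairs_le:
  "real (card {(z, w). z \<in> V \<and> w \<in> V \<and> wedge z w = 0}) \<le> 18 * X"
proof -
  have "{(z, w). z \<in> V \<and> w \<in> V \<and> wedge z w = 0} = Sigma V (\<lambda>z. {w \<in> V. wedge z w = 0})" by auto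
  then have "card {(z, w). z \<in> V \<and> w \<in> V \<and> wedge z w = 0} = (\<Sum>z\<in>V. card {w \<in> V. wedge z w = 0})"
    using finite_V by (simp add: card_SigmaI)
  also have "\<dots> \<le> (\<Sum>z\<in>V. 2)" using prim by (intro sum_mono card_parallel_primitive_le) auto
  finally have "real (card {(z, w). z \<in> V \<and> w \<in> V \<and> wedge z w = 0}) \<le> real (card V * 2)"
    by (simp add: of_nat_mono)
  then show ?thesis using card_V_le by simp
qed

text \<open>Pointwise comparison of the true divisor count with the fixed window plus the localised
  difference. If the corner value exceeds \<open>Y\<close>, the fixed windows cancel and only
  misjudged edges remain; otherwise the localised part is switched off and every \<open>r\<close>
  dividing \<open>D\<close> is charged once.\<close>

lemma window_discrepancy:
  assumes z: "z \<in> V" "w \<in> V" and H: "H > 0" and N: "N > 0" and lam: "lam \<ge> 1"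
    and RN: "4 * X * lam \<le> N * real R"
  defines "D \<equiv> wedge z w"
  shows "\<bar>real (if D = 0 then 0 else divisor_count N lam z w)
      - (\<Sum>r | r \<in> {1..R} \<and> int r dvd D. of_bool (R1 < real r \<and> real r \<le> lam * R1))
      - of_bool (Y < \<bar>corner_wedge H z (cell H w)\<bar>) *
         (\<Sum>r | r \<in> {1..R} \<and> int r dvd D. local_coeff H N lam R1 z (cell H w) r)\<bar>
    \<le> (\<Sum>r\<in>{1..R}. of_bool (\<bar>corner_wedge H z (cell H w)\<bar> \<le> Y \<and> int r dvd D))
      + (\<Sum>r\<in>{1..R}. of_bool (near_edge H N lam r z (cell H w)))"
proof -
  let ?I = "{r. r \<in> {1..R} \<and> int r dvd D}"
  let ?c = "\<bar>corner_wedge H z (cell H w)\<bar>"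
  let ?y = "\<bar>real_of_int D\<bar>"
  define a where "a r = (of_bool (in_window N lam ?y r) :: real)" for r
  define b where "b r = (of_bool (in_window N lam ?c r) :: real)" for r
  define k where "k r = (of_bool (R1 < real r \<and> real r \<le> lam * R1) :: real)" for r
  define e where "e r = (of_bool (near_edge H N lam r z (cell H w)) :: real)" for r
  have count: "real (if D = 0 then 0 else divisor_count N lam z w) = sum a ?I"
  proof (cases "D = 0")
    case True
    \<comment> \<open>The window attached to the value 0 is empty, in agreement with the omitted
      count for \<open>D = 0\<close>.\<close>
    then show ?thesis by (simp add: a_def in_window_def)
  next
    case False
    have "sum a ?I = real (card (?I \<inter> {r. in_window N lam ?y r}))"
      by (simp add: a_def)
    also have "?I \<inter> {r. in_window N lam ?y r} = {r. r \<in> {1..R} \<and> int r dvd D \<and> in_window N lam ?y r}"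
      by auto
    finally have "sum a ?I = real (card {r. r \<in> {1..R} \<and> int r dvd D \<and> in_window N lam ?y r})" .
    then show ?thesis
      using divisor_count_eq_windows[OF z _ N lam RN] False unfolding D_def by simp
  qed
  have loc: "(\<Sum>r\<in>?I. local_coeff H N lam R1 z (cell H w) r) = sum b ?I - sum k ?I"
    by (simp add: local_coeff_def b_def k_def sum_subtractf)
  have ab: "\<bar>a r - b r\<bar> \<le> e r" for r
  proof (cases "in_window N lam ?y r = in_window N lam ?c r")
    case True
    then show ?thesis by (simp add: a_def b_def e_def)
  next
    case False
    have iw: "in_window N lam y r \<longleftrightarrow> real r * N / lam \<le> y \<and> y < real r * N" for y
      using N lam by (auto simp: in_window_def field_simps)
    \<comment> \<open>If membership of \<open>r\<close> changes between \<open>?c\<close> and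
      \<open>?y\<close>, an endpoint lies between them and hence within this distance of
      \<open>?c\<close>.\<close>
    have "\<bar>?y - ?c\<bar> \<le> 2 * sqrt X * real H"
      using corner_wedge_diff[OF H z(1), of w] unfolding D_def by linarith
    then have "near_edge H N lam r z (cell H w)"
      using False unfolding iw near_edge_def by linarith
    then show ?thesis by (simp add: a_def b_def e_def)
  qed
  have e0: "e r \<ge> 0" for r by (simp add: e_def)
  have e_sum: "sum e ?I \<le> sum e {1..R}" "0 \<le> sum e {1..R}"
    by (rule sum_mono2, simp, blast, rule e0) (rule sum_nonneg, rule e0)
  show ?thesis
  proof (cases "Y < ?c")
    case True
    have "\<bar>sum a ?I - sum b ?I\<bar> \<le> (\<Sum>r\<in>?I. \<bar>a r - b r\<bar>)"
      unfolding sum_subtractf[symmetric] by (rule sum_abs)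
    also have "\<dots> \<le> sum e ?I" by (intro sum_mono ab)
    finally show ?thesis
      unfolding count loc using True e_sum by (simp add: k_def e_def)
  next
    case False
    have "\<bar>sum a ?I - sum k ?I\<bar> \<le> (\<Sum>r\<in>?I. \<bar>a r - k r\<bar>)"
      unfolding sum_subtractf[symmetric] by (rule sum_abs)
    also have "\<dots> \<le> (\<Sum>r\<in>?I. 1)" by (intro sum_mono) (simp add: a_def k_def)
    also have "\<dots> = (\<Sum>r\<in>{1..R}. of_bool (?c \<le> Y \<and> int r dvd D))"
      using False by (simp add: of_bool_def flip: sum.inter_filter)
    finally show ?thesis
      unfolding count loc using False e_sum by (simp add: k_def e_def)
  qed
qed

text \<open>The divisor count splits as \<open>k + l + d + M0\<close>: fixed window, localised
  difference, discrepancy, and parallel pairs. Only \<open>k\<close> keeps a sum over small moduli,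
  to be treated with Siegel-Walfisz; \<open>l\<close> is bounded by Cauchy-Schwarz and the rest by
  counting.\<close>

lemma top_range_le:
  assumes H: "H > 0" "real H \<le> sqrt X" and R: "R \<ge> 1" "R \<le> H" "R ^ 5 \<le> H"
    and N: "N > 0" and lam: "lam \<ge> 1" and Y: "Y > 0" and R1: "R1 > 0"
    and RN: "4 * X * lam \<le> N * real R" and RR: "lam * R1 \<le> real R"
  shows "(\<Sum>m | 1 \<le> m \<and> N / lam \<le> real m \<and> real m < N. line_norm V f m) \<le>
     (\<Sum>r\<in>{1..R}. line_norm V f r) + 18 * N * X
     + 135 * X * (1 + ln (real R)) * (4 * Y * (1 + ln X) + 2 * sqrt X * real H)
     + 600 * real R * X * sqrt X * real H * (1 + ln X)
     + 427 * X\<^sup>2 * (4 * N / Y + 4 / R1) * sqrt (real R)"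
proof -
  define \<phi> where "\<phi> z w = f z * cnj (f w)" for z w
  have \<phi>_le: "cmod (\<phi> z w) \<le> 1" if "z \<in> V" "w \<in> V" for z w
    using mult_mono[OF f_le[OF that(1)] f_le[OF that(2)]] by (simp add: \<phi>_def norm_mult)
  have \<phi>r: "cmod (\<phi> z w * of_real x) \<le> \<bar>x\<bar>" if "z \<in> V" "w \<in> V" for z w x
    using mult_right_mono[OF \<phi>_le[OF that], of "\<bar>x\<bar>"] by (simp add: norm_mult)
  define k where "k z w = (\<Sum>r | r \<in> {1..R} \<and> int r dvd wedge z w. real (of_bool (R1 < real r \<and> real r \<le> lam * R1)))"
    for z w
  define l where "l z w = of_bool (Y < \<bar>corner_wedge H z (cell H w)\<bar>) *
         (\<Sum>r | r \<in> {1..R} \<and> int r dvd wedge z w. local_coeff H N lam R1 z (cell H w) r)" for z w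
  define M where "M z w = real (divisor_count N lam z w)" for z w
  define M0 where "M0 z w = real (if wedge z w = 0 then divisor_count N lam z w else 0)" for z w
  define d where "d z w = M z w - M0 z w - k z w - l z w" for z w
  have split: "M z w = k z w + l z w + d z w + M0 z w" for z w by (simp add: d_def)
  have "complex_of_real (\<Sum>m | 1 \<le> m \<and> N / lam \<le> real m \<and> real m < N. line_norm V f m) =
      (\<Sum>z\<in>V. \<Sum>w\<in>V. \<phi> z w * of_real (M z w))"
    unfolding sum_line_norm_eq_divisor_count \<phi>_def M_def of_real_of_nat_eq ..
  also have "\<dots> = (\<Sum>z\<in>V. \<Sum>w\<in>V. \<phi> z w * of_real (k z w)) + (\<Sum>z\<in>V. \<Sum>w\<in>V. \<phi> z w * of_real (l z w))
      + (\<Sum>z\<in>V. \<Sum>w\<in>V. \<phi> z w * of_real (d z w)) + (\<Sum>z\<in>V. \<Sum>w\<in>V. \<phi> z w * of_real (M0 z w))"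
    unfolding split by (simp add: sum.distrib distrib_left)
  finally have "complex_of_real (\<Sum>m | 1 \<le> m \<and> N / lam \<le> real m \<and> real m < N. line_norm V f m) =
      (\<Sum>z\<in>V. \<Sum>w\<in>V. \<phi> z w * of_real (k z w)) + (\<Sum>z\<in>V. \<Sum>w\<in>V. \<phi> z w * of_real (l z w))
      + (\<Sum>z\<in>V. \<Sum>w\<in>V. \<phi> z w * of_real (d z w)) + (\<Sum>z\<in>V. \<Sum>w\<in>V. \<phi> z w * of_real (M0 z w))" .
  from arg_cong[OF this, of cmod]
  have "(\<Sum>m | 1 \<le> m \<and> N / lam \<le> real m \<and> real m < N. line_norm V f m) \<le>
      cmod (\<Sum>z\<in>V. \<Sum>w\<in>V. \<phi> z w * of_real (k z w)) + cmod (\<Sum>z\<in>V. \<Sum>w\<in>V. \<phi> z w * of_real (l z w))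
      + cmod (\<Sum>z\<in>V. \<Sum>w\<in>V. \<phi> z w * of_real (d z w)) + cmod (\<Sum>z\<in>V. \<Sum>w\<in>V. \<phi> z w * of_real (M0 z w))"
    unfolding norm_of_real using norm_triangle_le by (smt (verit) norm_triangle_ineq)
  moreover have "cmod (\<Sum>z\<in>V. \<Sum>w\<in>V. \<phi> z w * of_real (k z w)) \<le> (\<Sum>r\<in>{1..R}. line_norm V f r)"
  proof -
    define t where "t r = real (of_bool (R1 < real r \<and> real r \<le> lam * R1))" for r
    have "(\<Sum>z\<in>V. \<Sum>w\<in>V. \<phi> z w * of_real (k z w)) =
        (\<Sum>z\<in>V. \<Sum>w\<in>V. \<Sum>r\<in>{1..R}. if int r dvd wedge z w then of_real (t r) * \<phi> z w else 0)"
      unfolding k_def t_def[symmetric]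
      by (intro sum.cong refl) (simp add: sum_distrib_left mult.commute flip: sum.inter_filter)
    also have "\<dots> = (\<Sum>r\<in>{1..R}. \<Sum>z\<in>V. \<Sum>w\<in>V. if int r dvd wedge z w then of_real (t r) * \<phi> z w else 0)"
      by (rule sum_swap3)
    also have "\<dots> = (\<Sum>r\<in>{1..R}. of_real (t r) * of_real (line_norm V f r))"
    proof -
      have "complex_of_real (line_norm V f r) = (\<Sum>z\<in>V. \<Sum>w\<in>V. if int r dvd wedge z w then \<phi> z w else 0)" for r
        using line_norm_eq[OF prim finite_V] finite_V by (simp add: \<phi>_def flip: sum.inter_filter)
      then show ?thesis by (simp add: sum_distrib_left if_distrib cong: if_cong)
    qed
    finally have eq: "(\<Sum>z\<in>V. \<Sum>w\<in>V. \<phi> z w * of_real (k z w)) = of_real (\<Sum>r\<in>{1..R}. t r * line_norm V f r)"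
      by simp
    moreover have "\<bar>\<Sum>r\<in>{1..R}. t r * line_norm V f r\<bar> = (\<Sum>r\<in>{1..R}. t r * line_norm V f r)"
      by (intro abs_of_nonneg sum_nonneg mult_nonneg_nonneg line_norm_nonneg) (simp add: t_def)
    \<comment> \<open>The fixed window may be dropped because every \<open>line_norm\<close> is
      nonnegative.\<close>
    moreover have "\<dots> \<le> (\<Sum>r\<in>{1..R}. 1 * line_norm V f r)"
      by (intro sum_mono mult_right_mono line_norm_nonneg) (simp add: t_def)
    ultimately show ?thesis unfolding eq norm_of_real by simp
  qed
  moreover have "cmod (\<Sum>z\<in>V. \<Sum>w\<in>V. \<phi> z w * of_real (l z w)) \<le> 427 * X\<^sup>2 * (4 * N / Y + 4 / R1) * sqrt (real R)"
    unfolding \<phi>_def l_def by (rule main_term_le[OF assms])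
  moreover have "cmod (\<Sum>z\<in>V. \<Sum>w\<in>V. \<phi> z w * of_real (d z w)) \<le>
      135 * X * (1 + ln (real R)) * (4 * Y * (1 + ln X) + 2 * sqrt X * real H)
     + 600 * real R * X * sqrt X * real H * (1 + ln X)"
  proof -
    define A where "A r z w \<longleftrightarrow> \<bar>corner_wedge H z (cell H w)\<bar> \<le> Y \<and> int r dvd wedge z w" for r z w
    define B where "B r z w \<longleftrightarrow> near_edge H N lam r z (cell H w)" for r z w
    have swap: "(\<Sum>z\<in>V. \<Sum>w\<in>V. \<Sum>r\<in>{1..R}. real (of_bool (P r z w))) =
        (\<Sum>r\<in>{1..R}. real (card {(z, w). z \<in> V \<and> w \<in> V \<and> P r z w}))" for P
    proof -
      have "(\<Sum>z\<in>V. \<Sum>w\<in>V. \<Sum>r\<in>{1..R}. real (of_bool (P r z w))) =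
        (\<Sum>r\<in>{1..R}. \<Sum>z\<in>V. \<Sum>w\<in>V. real (of_bool (P r z w)))"
        by (rule sum_swap3)
      also have "\<dots> = (\<Sum>r\<in>{1..R}. \<Sum>p\<in>V \<times> V. if P r (fst p) (snd p) then 1 else 0)"
        by (simp add: sum.cartesian_product case_prod_beta of_bool_def if_distrib cong: if_cong)
      also have "\<dots> = (\<Sum>r\<in>{1..R}. real (card {(z, w). z \<in> V \<and> w \<in> V \<and> P r z w}))"
        using finite_V by (intro sum.cong refl)
          (simp flip: sum.inter_filter, intro arg_cong[of _ _ card], auto)
      finally show ?thesis .
    qed
    have dle: "\<bar>d z w\<bar> \<le> (\<Sum>r\<in>{1..R}. real (of_bool (A r z w))) + (\<Sum>r\<in>{1..R}. real (of_bool (B r z w)))"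
      if zw: "z \<in> V" "w \<in> V" for z w
    proof -
      have "M z w - M0 z w = real (if wedge z w = 0 then 0 else divisor_count N lam z w)"
        by (simp add: M_def M0_def)
      then show ?thesis
        using window_discrepancy[OF zw H(1) N lam RN, of R1 Y]
        unfolding d_def k_def l_def A_def B_def by simp
    qed
    have "cmod (\<Sum>z\<in>V. \<Sum>w\<in>V. \<phi> z w * of_real (d z w)) \<le> (\<Sum>z\<in>V. \<Sum>w\<in>V. cmod (\<phi> z w * of_real (d z w)))"
      by (intro order.trans[OF norm_sum] sum_mono norm_sum)
    also have "\<dots> \<le> (\<Sum>z\<in>V. \<Sum>w\<in>V. (\<Sum>r\<in>{1..R}. real (of_bool (A r z w))) + (\<Sum>r\<in>{1..R}. real (of_bool (B r z w))))"
      by (intro sum_mono order.trans[OF \<phi>r] dle)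
    also have "\<dots> = (\<Sum>r\<in>{1..R}. real (card {(z, w). z \<in> V \<and> w \<in> V \<and> A r z w}))
        + (\<Sum>r\<in>{1..R}. real (card {(z, w). z \<in> V \<and> w \<in> V \<and> B r z w}))"
      unfolding sum.distrib swap ..
    also have "\<dots> \<le> 135 * X * (1 + ln (real R)) * (4 * Y * (1 + ln X) + 2 * sqrt X * real H)
     + 600 * real R * X * sqrt X * real H * (1 + ln X)"
      unfolding A_def B_def using Y by (intro add_mono bad_cells_le edge_cells_le H R) auto
    finally show ?thesis .
  qed
  \<comment> \<open>A zero determinant is divisible by every \<open>m < N\<close>, but each
    \<open>z\<close> has at most two parallel partners.\<close>
  moreover have "cmod (\<Sum>z\<in>V. \<Sum>w\<in>V. \<phi> z w * of_real (M0 z w)) \<le> 18 * N * X"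
  proof -
    have "cmod (\<Sum>z\<in>V. \<Sum>w\<in>V. \<phi> z w * of_real (M0 z w)) \<le> (\<Sum>z\<in>V. \<Sum>w\<in>V. cmod (\<phi> z w * of_real (M0 z w)))"
      by (intro order.trans[OF norm_sum] sum_mono norm_sum)
    also have "\<dots> \<le> (\<Sum>z\<in>V. \<Sum>w\<in>V. if wedge z w = 0 then N else 0)"
    proof (intro sum_mono order.trans[OF \<phi>r])
      fix z w
      have "divisor_count N lam z w \<le> card {m::nat. 1 \<le> m \<and> real m < N}"
        unfolding divisor_count_def by (intro card_mono finite_below) auto
      then have "real (divisor_count N lam z w) \<le> N" using finite_below(2)[OF N] by linarith
      then show "\<bar>M0 z w\<bar> \<le> (if wedge z w = 0 then N else 0)" by (simp add: M0_def)
    qed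
    also have "\<dots> = (\<Sum>p\<in>V \<times> V. if wedge (fst p) (snd p) = 0 then N else 0)"
      by (simp add: sum.cartesian_product case_prod_beta)
    also have "\<dots> = N * real (card {p \<in> V \<times> V. wedge (fst p) (snd p) = 0})"
      using finite_V by (simp flip: sum.inter_filter)
    also have "{p \<in> V \<times> V. wedge (fst p) (snd p) = 0} = {(z, w). z \<in> V \<and> w \<in> V \<and> wedge z w = 0}" by auto
    also have "N * real (card \<dots>) \<le> N * (18 * X)"
      using N by (intro mult_left_mono card_parallel_pairs_le) auto
    finally show ?thesis by simp
  qed
  ultimately show ?thesis by linarith
qed

end

section \<open>Large moduli and residue classes\<close>

context primitive_disc
begin

lemma of_real_line_norm:
  "complex_of_real (line_norm V f q) =
    (\<Sum>z\<in>V. \<Sum>w\<in>{w\<in>V. int q dvd wedge z w}. f z * cnj (f w))"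
  by (rule line_norm_eq) (auto intro: prim finite_V)

lemma line_norm_le_trivial: "line_norm V f q \<le> 81 * X\<^sup>2"
proof -
  have "line_norm V f q = cmod (complex_of_real (line_norm V f q))"
    by (simp add: line_norm_nonneg)
  also have "\<dots> \<le> (\<Sum>z\<in>V. \<Sum>w\<in>{w\<in>V. int q dvd wedge z w}. 1)"
    unfolding of_real_line_norm
  proof (intro order.trans[OF norm_sum] sum_mono)
    fix z w assume "z \<in> V" "w \<in> {w \<in> V. int q dvd wedge z w}"
    then show "cmod (f z * cnj (f w)) \<le> 1"
      using mult_mono[OF f_le[of z] f_le[of w]] by (simp add: norm_mult)
  qed
  also have "\<dots> \<le> (\<Sum>z\<in>V. \<Sum>w\<in>V. 1)"
    using finite_V by (intro sum_mono sum_mono2) auto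
  also have "\<dots> = real (card V) * real (card V)" by simp
  also have "\<dots> \<le> (9 * X) * (9 * X)" using X1 by (intro mult_mono card_V_le) auto
  finally show ?thesis by (simp add: power2_eq_square)
qed

text \<open>A modulus \<open>q \<ge> N\<close> of a nonzero determinant has a complementary divisor
  at most \<open>X / N\<close>, so absolute values suffice. Parallel pairs account for the term
  linear in \<open>Q\<close>.\<close>

lemma sum_line_norm_large_moduli:
  assumes N: "N > 0" "N \<le> Q"
  shows "(\<Sum>q | 1 \<le> q \<and> N \<le> real q \<and> real q \<le> Q. line_norm V f q)
     \<le> 18 * Q * X + 81 * X\<^sup>2 * (X / N + 1)"
proof -
  let ?I = "{q::nat. 1 \<le> q \<and> N \<le> real q \<and> real q \<le> Q}"
  have sub: "?I \<subseteq> {1..nat \<lfloor>Q\<rfloor>}" by auto linarith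
  have fin: "finite ?I" by (rule finite_subset[OF sub]) simp
  have "card ?I \<le> nat \<lfloor>Q\<rfloor>" using card_mono[OF _ sub] by simp
  then have cI: "real (card ?I) \<le> Q" using N by linarith
  define m where "m z w = card {q \<in> ?I. int q dvd wedge z w}" for z w
  have "(\<Sum>q\<in>?I. line_norm V f q) = cmod (complex_of_real (\<Sum>q\<in>?I. line_norm V f q))"
    by (subst norm_of_real) (simp add: sum_nonneg line_norm_nonneg)
  also have "complex_of_real (\<Sum>q\<in>?I. line_norm V f q) =
      (\<Sum>q\<in>?I. \<Sum>z\<in>V. \<Sum>w\<in>V. if int q dvd wedge z w then f z * cnj (f w) else 0)"
    using of_real_line_norm finite_V by (simp flip: sum.inter_filter)
  also have "cmod \<dots> \<le> (\<Sum>q\<in>?I. \<Sum>z\<in>V. \<Sum>w\<in>V. if int q dvd wedge z w then 1 else 0)"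
  proof (intro order.trans[OF norm_sum] sum_mono)
    fix z w q assume "z \<in> V" "w \<in> V"
    then show "cmod (if int q dvd wedge z w then f z * cnj (f w) else 0) \<le> (if int q dvd wedge z w then 1 else 0)"
      using mult_mono[OF f_le[of z] f_le[of w]] by (simp add: norm_mult)
  qed
  also have "\<dots> = (\<Sum>z\<in>V. \<Sum>w\<in>V. real (m z w))"
    by (subst sum_swap3[symmetric]) (use fin in \<open>simp add: m_def flip: sum.inter_filter\<close>)
  also have "\<dots> \<le> (\<Sum>z\<in>V. \<Sum>w\<in>V. (if wedge z w = 0 then Q else 0) + (X / N + 1))"
  proof (intro sum_mono)
    fix z w assume z: "z \<in> V" "w \<in> V"
    show "real (m z w) \<le> (if wedge z w = 0 then Q else 0) + (X / N + 1)"
    proof (cases "wedge z w = 0")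
      case True
      then have "real (m z w) \<le> Q" unfolding m_def using cI by simp
      moreover have "X / N \<ge> 0" using X1 N by simp
      ultimately show ?thesis using True by simp
    next
      case False
      define R where "R = nat \<lceil>X / N\<rceil>"
      have XN: "X / N > 0" using X1 N by simp
      have R: "X / N \<le> real R" "real R \<le> X / N + 1" unfolding R_def using XN by linarith+
      have "\<bar>real_of_int (wedge z w)\<bar> \<le> X" using z by (intro wedge_le)
      also have "X \<le> N * real R" using R(1) N by (simp add: pos_divide_le_eq mult.commute)
      \<comment> \<open>The bound \<open>Q + 1\<close> turns the closed range
        \<open>q \<le> Q\<close> into part of a half-open one, as the divisor involution
        expects.\<close>
      finally have "card {q::nat. 1 \<le> q \<and> N \<le> real q \<and> real q < Q + 1 \<and> int q dvd wedge z w} =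
         card {r\<in>{1..R}. int r dvd wedge z w \<and> real r * N \<le> \<bar>of_int (wedge z w)\<bar> \<and> \<bar>of_int (wedge z w)\<bar> < real r * (Q + 1)}"
        using False N by (intro card_complementary_divisors) auto
      also have "\<dots> \<le> card {1..R}" by (intro card_mono) auto
      finally have "card {q::nat. 1 \<le> q \<and> N \<le> real q \<and> real q < Q + 1 \<and> int q dvd wedge z w} \<le> R" by simp
      moreover have "m z w \<le> card {q::nat. 1 \<le> q \<and> N \<le> real q \<and> real q < Q + 1 \<and> int q dvd wedge z w}"
        unfolding m_def
      proof (rule card_mono)
        have "{q::nat. 1 \<le> q \<and> N \<le> real q \<and> real q < Q + 1 \<and> int q dvd wedge z w} \<subseteq> {q::nat. 1 \<le> q \<and> real q < Q + 1}" by auto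
        then show "finite {q::nat. 1 \<le> q \<and> N \<le> real q \<and> real q < Q + 1 \<and> int q dvd wedge z w}"
          using finite_below(1) by (rule finite_subset)
      qed auto
      ultimately have "m z w \<le> R" by linarith
      then show ?thesis using False R(2) by simp
    qed
  qed
  also have "\<dots> = (\<Sum>z\<in>V. \<Sum>w\<in>V. if wedge z w = 0 then Q else 0) + real (card V) * real (card V) * (X / N + 1)"
    by (simp add: sum.distrib)
  also have "(\<Sum>z\<in>V. \<Sum>w\<in>V. if wedge z w = 0 then Q else 0) =
      Q * real (card {p \<in> V \<times> V. wedge (fst p) (snd p) = 0})"
    by (subst sum.cartesian_product)
      (use finite_V in \<open>simp add: case_prod_beta mult.commute flip: sum.inter_filter\<close>)
  also have "{p \<in> V \<times> V. wedge (fst p) (snd p) = 0} = {(z, w). z \<in> V \<and> w \<in> V \<and> wedge z w = 0}" by auto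
  also have "Q * real (card \<dots>) + real (card V) * real (card V) * (X / N + 1)
     \<le> Q * (18 * X) + (9 * X) * (9 * X) * (X / N + 1)"
    using N X1 by (intro add_mono mult_left_mono mult_right_mono mult_mono card_parallel_pairs_le card_V_le) auto
  finally show ?thesis by (simp add: power2_eq_square)
qed

definition residue :: "nat \<Rightarrow> int \<times> int \<Rightarrow> int \<times> int" where
  "residue r z = (fst z mod int r, snd z mod int r)"

text \<open>Divisibility of the determinant by \<open>r\<close> depends only on the residues of the
  two vectors, so the form is a sum over pairs of the \<open>r^2\<close> residue classes. The crude
  factor \<open>r ^ 4\<close> is affordable since \<open>r\<close> will be at most a power of
  \<open>L\<close>.\<close>

lemma line_norm_le_residue_sums:
  assumes r: "r > 0"
    and F: "\<And>\<alpha>. cmod (\<Sum>z | z \<in> V \<and> residue r z = \<alpha>. f z) \<le> F"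
  shows "line_norm V f r \<le> real r ^ 4 * F\<^sup>2"
proof -
  let ?R = "{0..<int r} \<times> {0..<int r}"
  have F0: "F \<ge> 0" using F[of undefined] norm_ge_zero order.trans by blast
  have cR: "card ?R = r * r" by (simp add: card_cartesian_product)
  have img: "residue r ` V \<subseteq> ?R" using r by (auto simp: residue_def)
  define u where "u \<alpha> = (\<Sum>z | z \<in> V \<and> residue r z = \<alpha>. f z)" for \<alpha>
  define \<theta> where "\<theta> \<alpha> \<gamma> = (if int r dvd wedge \<alpha> \<gamma> then 1 else 0 :: complex)" for \<alpha> \<gamma>
  have wmod: "int r dvd wedge z w \<longleftrightarrow> int r dvd wedge (residue r z) (residue r w)" for z w
  proof -
    have "[wedge z w = wedge (residue r z) (residue r w)] (mod int r)"
      unfolding wedge_def residue_def by (intro cong_diff cong_mult) (simp_all add: cong_def)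
    then show ?thesis by (simp add: cong_def dvd_eq_mod_eq_0)
  qed
  have group: "(\<Sum>z\<in>V. g z) = (\<Sum>\<alpha>\<in>?R. \<Sum>z | z \<in> V \<and> residue r z = \<alpha>. g z)" for g :: "_ \<Rightarrow> complex"
    using sum.group[OF finite_V _ img, of g] by simp
  have "complex_of_real (line_norm V f r) = (\<Sum>z\<in>V. \<Sum>w\<in>V. \<theta> (residue r z) (residue r w) * (f z * cnj (f w)))"
    unfolding of_real_line_norm
  proof (rule sum.cong[OF refl])
    fix z
    show "(\<Sum>w\<in>{w \<in> V. int r dvd wedge z w}. f z * cnj (f w)) =
        (\<Sum>w\<in>V. \<theta> (residue r z) (residue r w) * (f z * cnj (f w)))"
      unfolding sum.inter_filter[OF finite_V] by (intro sum.cong refl) (simp add: \<theta>_def wmod[symmetric])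
  qed
  also have "\<dots> = (\<Sum>\<alpha>\<in>?R. \<Sum>z | z \<in> V \<and> residue r z = \<alpha>. \<Sum>\<gamma>\<in>?R. \<Sum>w | w \<in> V \<and> residue r w = \<gamma>.
      \<theta> \<alpha> \<gamma> * (f z * cnj (f w)))"
  proof -
    have "(\<Sum>z\<in>V. \<Sum>w\<in>V. \<theta> (residue r z) (residue r w) * (f z * cnj (f w))) =
      (\<Sum>\<alpha>\<in>?R. \<Sum>z | z \<in> V \<and> residue r z = \<alpha>. \<Sum>w\<in>V. \<theta> (residue r z) (residue r w) * (f z * cnj (f w)))"
      by (rule group)
    also have "\<dots> = (\<Sum>\<alpha>\<in>?R. \<Sum>z | z \<in> V \<and> residue r z = \<alpha>. \<Sum>\<gamma>\<in>?R. \<Sum>w | w \<in> V \<and> residue r w = \<gamma>.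
      \<theta> (residue r z) (residue r w) * (f z * cnj (f w)))"
      by (intro sum.cong refl group)
    finally show ?thesis by simp
  qed
  also have "\<dots> = (\<Sum>\<alpha>\<in>?R. \<Sum>\<gamma>\<in>?R. \<theta> \<alpha> \<gamma> * (u \<alpha> * cnj (u \<gamma>)))"
  proof (rule sum.cong[OF refl])
    fix \<alpha>
    have "(\<Sum>z | z \<in> V \<and> residue r z = \<alpha>. \<Sum>\<gamma>\<in>?R. \<Sum>w | w \<in> V \<and> residue r w = \<gamma>. \<theta> \<alpha> \<gamma> * (f z * cnj (f w))) =
      (\<Sum>\<gamma>\<in>?R. \<Sum>z | z \<in> V \<and> residue r z = \<alpha>. \<Sum>w | w \<in> V \<and> residue r w = \<gamma>. \<theta> \<alpha> \<gamma> * (f z * cnj (f w)))"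
      by (rule sum.swap)
    also have "\<dots> = (\<Sum>\<gamma>\<in>?R. \<theta> \<alpha> \<gamma> * (u \<alpha> * cnj (u \<gamma>)))"
      unfolding u_def cnj_sum sum_product by (simp only: sum_distrib_left)
    finally show "(\<Sum>z | z \<in> V \<and> residue r z = \<alpha>. \<Sum>\<gamma>\<in>?R. \<Sum>w | w \<in> V \<and> residue r w = \<gamma>. \<theta> \<alpha> \<gamma> * (f z * cnj (f w))) =
      (\<Sum>\<gamma>\<in>?R. \<theta> \<alpha> \<gamma> * (u \<alpha> * cnj (u \<gamma>)))" .
  qed
  finally have "complex_of_real (line_norm V f r) = (\<Sum>\<alpha>\<in>?R. \<Sum>\<gamma>\<in>?R. \<theta> \<alpha> \<gamma> * (u \<alpha> * cnj (u \<gamma>)))" .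
  from arg_cong[OF this, of cmod]
  have "line_norm V f r = cmod (\<Sum>\<alpha>\<in>?R. \<Sum>\<gamma>\<in>?R. \<theta> \<alpha> \<gamma> * (u \<alpha> * cnj (u \<gamma>)))"
    unfolding norm_of_real by (simp add: line_norm_nonneg)
  also have "\<dots> \<le> (\<Sum>\<alpha>\<in>?R. \<Sum>\<gamma>\<in>?R. F * F)"
  proof (intro order.trans[OF norm_sum] sum_mono)
    fix \<alpha> \<gamma>
    have "cmod (u \<alpha>) * cmod (u \<gamma>) \<le> F * F"
      unfolding u_def by (intro mult_mono F F0) auto
    then show "cmod (\<theta> \<alpha> \<gamma> * (u \<alpha> * cnj (u \<gamma>))) \<le> F * F"
      using F0 by (simp add: \<theta>_def norm_mult)
  qed
  also have "\<dots> = real r ^ 4 * F\<^sup>2"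
    unfolding sum_constant cR by (simp add: power2_eq_square eval_nat_numeral)
  finally show ?thesis .
qed

end

section \<open>From Gaussian integers to integer vectors\<close>

lemma gauss_int_eq_iff: "gauss_int u v = gauss_int u' v' \<longleftrightarrow> u = u' \<and> v = v'"
  by (auto simp: gauss_int_def complex_eq_iff)

lemma norm_gauss_int_sq: "(cmod (gauss_int u v))\<^sup>2 = (of_int u)\<^sup>2 + (of_int v)\<^sup>2"
  by (simp add: gauss_int_def cmod_power2)

lemma gauss_cong_iff:
  "gauss_cong (gauss_int u v) (gauss_int a b) l \<longleftrightarrow> int l dvd u - a \<and> int l dvd v - b"
proof -
  have "gauss_int u v - gauss_int a b = of_nat l * gauss_int s t \<longleftrightarrow> u - a = int l * s \<and> v - b = int l * t" for s t
  proof -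
    have "gauss_int u v - gauss_int a b = gauss_int (u - a) (v - b)"
      "of_nat l * gauss_int s t = gauss_int (int l * s) (int l * t)"
      by (simp_all add: gauss_int_def algebra_simps)
    then show ?thesis by (simp add: gauss_int_eq_iff)
  qed
  then show ?thesis unfolding gauss_cong_def gauss_ints_def dvd_def by blast
qed

definition support_coords :: "(complex \<Rightarrow> complex) \<Rightarrow> (int \<times> int) set" where
  "support_coords c = {(u, v). c (gauss_int u v) \<noteq> 0}"

definition coord_fun :: "(complex \<Rightarrow> complex) \<Rightarrow> int \<times> int \<Rightarrow> complex" where
  "coord_fun c z = c (gauss_int (fst z) (snd z))"

lemma primitive_disc_support:
  assumes X: "X \<ge> 1" and c: "\<And>z. z \<in> gauss_ints \<Longrightarrow> cmod (c z) \<le> 1"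
    and supp: "\<And>z. z \<in> gauss_support c \<Longrightarrow> odd_primitive z \<and> 1 < (cmod z)\<^sup>2 \<and> (cmod z)\<^sup>2 \<le> X"
  shows "primitive_disc (support_coords c) (coord_fun c) X"
proof
  fix z assume z: "z \<in> support_coords c"
  obtain u v where uv: "z = (u, v)" by (cases z)
  have "gauss_int u v \<in> gauss_support c"
    using z uv by (auto simp: support_coords_def gauss_support_def gauss_ints_def)
  from supp[OF this] obtain u' v' where p: "gauss_int u v = gauss_int u' v'" "gcd u' v' = 1" "u' * v' \<noteq> 0"
    and le: "(cmod (gauss_int u v))\<^sup>2 \<le> X"
    unfolding odd_primitive_def by auto
  then have "gcd u v = 1" "u \<noteq> 0" by (auto simp: gauss_int_eq_iff)
  then show "primitive z" "fst z \<noteq> 0"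
    by (auto simp: uv primitive_def coprime_iff_gcd_eq_1)
  show "(of_int (fst z))\<^sup>2 + (of_int (snd z))\<^sup>2 \<le> X"
    using le by (simp add: uv norm_gauss_int_sq)
  show "cmod (coord_fun c z) \<le> 1"
    unfolding coord_fun_def by (rule c) (auto simp: gauss_ints_def)
qed (fact X)

lemma det_sum_eq:
  assumes fin: "finite (support_coords c)" and prim: "\<And>z. z \<in> support_coords c \<Longrightarrow> primitive z"
  shows "det_sum c Q = of_real (\<Sum>q | 1 \<le> q \<and> real q \<le> Q. line_norm (support_coords c) (coord_fun c) q)"
proof -
  let ?V = "support_coords c" and ?f = "coord_fun c"
  have "(\<Sum>\<^sub>\<infinity>(u1, v1, u2, v2) \<in> {(u1, v1, u2, v2). [u1 * v2 = u2 * v1] (mod int q)}.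
          c (gauss_int u1 v1) * cnj (c (gauss_int u2 v2))) = of_real (line_norm ?V ?f q)" for q
  proof -
    let ?g = "\<lambda>(u1, v1, u2, v2). c (gauss_int u1 v1) * cnj (c (gauss_int u2 v2))"
    let ?P = "Sigma ?V (\<lambda>z. {w \<in> ?V. int q dvd wedge z w})"
    let ?h = "\<lambda>(z, w). (fst z, snd z, fst w, snd w)"
    have "infsum ?g {(u1, v1, u2, v2). [u1 * v2 = u2 * v1] (mod int q)} = infsum ?g (?h ` ?P)"
    proof (rule infsum_cong_neutral)
      fix x assume x: "x \<in> {(u1, v1, u2, v2). [u1 * v2 = u2 * v1] (mod int q)} - ?h ` ?P"
      obtain u1 v1 u2 v2 where e: "x = (u1, v1, u2, v2)" by (cases x)
      have "\<not> ((u1, v1) \<in> ?V \<and> (u2, v2) \<in> ?V)"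
      proof
        assume "(u1, v1) \<in> ?V \<and> (u2, v2) \<in> ?V"
        then have "((u1, v1), (u2, v2)) \<in> ?P" using x e by (simp add: wedge_def cong_iff_dvd_diff)
        then have "?h ((u1, v1), (u2, v2)) \<in> ?h ` ?P" by (rule imageI)
        then show False using x e by simp
      qed
      then show "?g x = 0" by (auto simp: e support_coords_def)
    next
      fix x assume "x \<in> ?h ` ?P - {(u1, v1, u2, v2). [u1 * v2 = u2 * v1] (mod int q)}"
      then show "?g x = 0"
        by (auto simp: support_coords_def wedge_def cong_iff_dvd_diff)
    qed auto
    also have "\<dots> = sum ?g (?h ` ?P)"
      using fin by (intro infsum_finite finite_imageI finite_SigmaI) auto
    also have "\<dots> = (\<Sum>(z, w)\<in>?P. ?f z * cnj (?f w))"
      by (subst sum.reindex) (auto simp: inj_on_def coord_fun_def case_prod_beta intro!: sum.cong)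
    also have "\<dots> = (\<Sum>z\<in>?V. \<Sum>w\<in>{w \<in> ?V. int q dvd wedge z w}. ?f z * cnj (?f w))"
      using fin by (subst sum.Sigma) auto
    also have "\<dots> = of_real (line_norm ?V ?f q)"
      by (rule line_norm_eq[OF prim fin, symmetric])
    finally show ?thesis .
  qed
  then show ?thesis by (simp add: det_sum_def)
qed

lemma residue_sum_le:
  assumes sw: "siegel_walfisz K X c" and B: "B > 0" and r: "r > 0"
    and supp: "\<And>z. z \<in> gauss_support c \<Longrightarrow> 1 < (cmod z)\<^sup>2"
  shows "cmod (\<Sum>z | z \<in> support_coords c \<and> (fst z mod int r, snd z mod int r) = \<alpha>. coord_fun c z)
      \<le> K B * (real r)\<^sup>2 * X * (ln X) powr (- B)"
proof -
  obtain a b where ab: "\<alpha> = (a, b)" by (cases \<alpha>)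
  let ?A = "{z. z \<in> support_coords c \<and> (fst z mod int r, snd z mod int r) = (a mod int r, b mod int r)}"
  let ?B = "{z. z \<in> gauss_support c \<and> gauss_cong z (gauss_int a b) r}"
  have bound: "cmod (\<Sum>z\<in>?B. c z) \<le> K B * (real r)\<^sup>2 * X * (ln X) powr (- B)"
  proof -
    have "cmod (\<Sum>z\<in>?B. c z * (cnj z / z) ^ 0 * complex_of_real (cmod z) powr (\<i> * complex_of_real 0))
       \<le> K B * (real r)\<^sup>2 * ((real 0)\<^sup>2 + 1) * (0\<^sup>2 + 1) * X * (ln X) powr (- B)"
    proof -
      have "gauss_int a b \<in> gauss_ints" by (auto simp: gauss_ints_def)
      moreover have "r \<ge> 1" using r by simp
      ultimately show ?thesis
        using sw[unfolded siegel_walfisz_def, rule_format, where B = B and k = 0 and l = r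
            and \<alpha> = "gauss_int a b" and t = 0] B by blast
    qed
    moreover have "(\<Sum>z\<in>?B. c z * (cnj z / z) ^ 0 * complex_of_real (cmod z) powr (\<i> * complex_of_real 0)) = (\<Sum>z\<in>?B. c z)"
    proof (rule sum.cong[OF refl])
      fix z assume "z \<in> ?B"
      \<comment> \<open>The value of \<open>0 powr 0\<close> is 0, so the twist is trivial only at
        nonzero \<open>z\<close>.\<close>
      then have "z \<noteq> 0" using supp[of z] by auto
      then show "c z * (cnj z / z) ^ 0 * complex_of_real (cmod z) powr (\<i> * complex_of_real 0) = c z" by simp
    qed
    ultimately show ?thesis by simp
  qed
  have "(\<Sum>z\<in>?A. coord_fun c z) = (\<Sum>z\<in>?B. c z)"
  proof (rule sum.reindex_bij_betw[of "\<lambda>z. gauss_int (fst z) (snd z)" ?A ?B c, unfolded coord_fun_def[symmetric]])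
    show "bij_betw (\<lambda>z. gauss_int (fst z) (snd z)) ?A ?B"
      unfolding bij_betw_def
    proof
      show "inj_on (\<lambda>z. gauss_int (fst z) (snd z)) ?A"
        by (auto simp: inj_on_def gauss_int_eq_iff prod_eq_iff)
      show "(\<lambda>z. gauss_int (fst z) (snd z)) ` ?A = ?B"
      proof
        show "(\<lambda>z. gauss_int (fst z) (snd z)) ` ?A \<subseteq> ?B"
          by (auto simp: support_coords_def gauss_support_def gauss_ints_def gauss_cong_iff mod_eq_dvd_iff)
        show "?B \<subseteq> (\<lambda>z. gauss_int (fst z) (snd z)) ` ?A"
        proof
          fix z assume z: "z \<in> ?B"
          then obtain u v where "z = gauss_int u v" by (auto simp: gauss_support_def gauss_ints_def)
          then show "z \<in> (\<lambda>z. gauss_int (fst z) (snd z)) ` ?A"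
            using z by (intro image_eqI[of _ _ "(u, v)"])
              (auto simp: support_coords_def gauss_support_def gauss_cong_iff mod_eq_dvd_iff)
        qed
      qed
    qed
  qed
  then have le: "cmod (\<Sum>z\<in>?A. coord_fun c z) \<le> K B * (real r)\<^sup>2 * X * (ln X) powr (- B)"
    using bound by simp
  show ?thesis
  proof (cases "(a mod int r, b mod int r) = (a, b)")
    case True
    then show ?thesis using le unfolding ab by simp
  next
    case False
    then have empty: "{z. z \<in> support_coords c \<and> (fst z mod int r, snd z mod int r) = \<alpha>} = {}"
      unfolding ab by auto
    \<comment> \<open>The empty class needs a nonnegative right-hand side, which is read off from
      the bound for the reduced residue.\<close>
    have "0 \<le> K B * (real r)\<^sup>2 * X * (ln X) powr (- B)"
      using le by (rule order.trans[OF norm_ge_zero])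
    then show ?thesis unfolding empty by simp
  qed
qed

section \<open>Choice of parameters\<close>

lemma power_eventually_le_exp_half:
  fixes C :: real
  assumes "C > 0"
  shows "\<exists>L0. \<forall>L\<ge>L0. C * L ^ k \<le> exp (L / 2)"
proof -
  have "filterlim (\<lambda>L::real. L / 2) at_top at_top"
    by (intro filterlim_at_top_mult_tendsto_pos[of "\<lambda>_. 1 / 2" "1 / 2", simplified]) (auto simp: filterlim_ident)
  then have "((\<lambda>L::real. (L / 2) ^ k / exp (L / 2)) \<longlongrightarrow> 0) at_top"
    by (rule filterlim_compose[OF tendsto_power_div_exp_0])
  then have "eventually (\<lambda>L::real. (L / 2) ^ k / exp (L / 2) < 1 / (C * 2 ^ k)) at_top"
    using assms by (intro order_tendstoD(2)[where y = 0]) auto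
  then obtain L0 where L0: "\<And>L::real. L \<ge> L0 \<Longrightarrow> (L / 2) ^ k / exp (L / 2) < 1 / (C * 2 ^ k)"
    by (auto simp: eventually_at_top_linorder)
  have "C * L ^ k \<le> exp (L / 2)" if "L \<ge> L0" for L
  proof -
    have "L ^ k / 2 ^ k < exp (L / 2) / (C * 2 ^ k)"
      using L0[OF that] by (simp add: power_divide pos_divide_less_eq)
    then have "L ^ k < exp (L / 2) / C" by (simp add: pos_divide_less_eq)
    then show ?thesis using assms by (simp add: pos_less_divide_eq mult.commute)
  qed
  then show ?thesis by blast
qed

context primitive_disc
begin

text \<open>With the parameters chosen as powers of \<open>L\<close>, each error has the shape
  \<open>X^2 * (L ^ i / L ^ j)\<close>, and \<open>frac\<close> checks
  \<open>i + (n + 2) \<le> j\<close>. The hypothesis \<open>large\<close> encodes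
  \<open>R ^ 5 \<le> H\<close>, with \<open>25 n + 99 = 5 (4 n + 16) + (5 n + 19)\<close>.\<close>

lemma top_range_log_saving:
  fixes n :: nat and L G :: real
  assumes L: "L \<ge> 30" "X = exp L"
    and large: "3200 * L ^ (25 * n + 99) \<le> exp (L / 2)"
    and E: "\<And>R. real R \<le> 5 * L ^ (4 * n + 16) \<Longrightarrow> (\<Sum>r\<in>{1..R}. line_norm V f r) \<le> G * X\<^sup>2 / L ^ (n + 2)"
  shows "(\<Sum>m | 1 \<le> m \<and> X / L ^ (4 * n + 14) / L\<^sup>2 \<le> real m \<and> real m < X / L ^ (4 * n + 14). line_norm V f m)
    \<le> (G + 20000) * X\<^sup>2 / L ^ (n + 2)"
proof -
  define s where "s = sqrt X"
  have s: "s = exp (L / 2)" "s * s = X" "s > 0"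
  proof -
    have "exp L = exp (L / 2) * exp (L / 2)" by (simp flip: exp_add)
    then show "s = exp (L / 2)" unfolding s_def L(2) by (simp add: real_sqrt_mult)
    show "s * s = X" "s > 0" unfolding s_def L(2) by simp_all
  qed
  have L1: "L \<ge> 1" "L > 0" using L by auto
  have lnX: "ln X = L" using L by simp
  have pow: "L ^ i \<le> L ^ j" if "i \<le> j" for i j using L1 that by (intro power_increasing) auto
  have pow1: "1 \<le> L ^ i" for i using pow[of 0 i] by simp
  have pow0: "L ^ i > 0" for i using L1 by simp
  define N where "N = X / L ^ (4 * n + 14)"
  define Y where "Y = X / L ^ (n + 4)"
  \<comment> \<open>This is \<open>Y / N\<close>, so the two coefficient errors
    \<open>4 N / Y\<close> and \<open>4 / R1\<close> agree.\<close>
  define R1 where "R1 = L ^ (3 * n + 10)"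
  \<comment> \<open>The least integer for which \<open>N R \<ge> 4 X L^2\<close>, so that windows of
    corner values up to \<open>4 X\<close> end by \<open>R\<close>.\<close>
  define R where "R = nat \<lceil>4 * L ^ (4 * n + 16)\<rceil>"
  \<comment> \<open>Edge cells lose about \<open>R H L / s\<close>, and
    \<open>5 n + 19 = (4 n + 17) + (n + 2)\<close>.\<close>
  define H where "H = nat \<lfloor>s / L ^ (5 * n + 19)\<rfloor>"
  have R_lower: "4 * L ^ (4 * n + 16) \<le> real R" unfolding R_def by linarith
  have R_upper: "real R \<le> 5 * L ^ (4 * n + 16)"
    unfolding R_def using pow1[of "4 * n + 16"] by linarith
  have R1': "R \<ge> 1" using R_lower pow1[of "4 * n + 16"] by linarith
  have H_upper: "real H \<le> s / L ^ (5 * n + 19)"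
    unfolding H_def using s(3) L1 by (intro of_nat_floor) simp
  have RH: "R ^ 5 \<le> H"
  proof -
    have "real (R ^ 5) \<le> (5 * L ^ (4 * n + 16)) ^ 5"
      unfolding of_nat_power using R_upper by (intro power_mono) auto
    also have "\<dots> = 3125 * L ^ (20 * n + 80)"
      by (simp add: power_mult_distrib flip: power_mult)
    finally have 1: "real (R ^ 5) \<le> 3125 * L ^ (20 * n + 80)" .
    have "(3125 * L ^ (20 * n + 80) + 1) * L ^ (5 * n + 19) \<le> (3200 * L ^ (20 * n + 80)) * L ^ (5 * n + 19)"
    proof (rule mult_right_mono)
      show "3125 * L ^ (20 * n + 80) + 1 \<le> 3200 * L ^ (20 * n + 80)"
        using pow1[of "20 * n + 80"] by linarith
    qed (rule less_imp_le[OF pow0])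
    also have "\<dots> = 3200 * L ^ (25 * n + 99)" by (simp flip: power_add)
    also have "\<dots> \<le> s" using large s by simp
    finally have "3125 * L ^ (20 * n + 80) + 1 \<le> s / L ^ (5 * n + 19)"
      using pow0 by (simp add: pos_le_divide_eq)
    then have "real (R ^ 5) \<le> real H" using 1 unfolding H_def by linarith
    then show ?thesis by (simp only: of_nat_le_iff)
  qed
  have R_le: "R \<le> H"
  proof -
    have "R ^ 1 \<le> R ^ 5" using R1' by (intro power_increasing) auto
    then show ?thesis using RH by simp
  qed
  have H0: "H > 0" using R_le R1' by simp
  have "s / L ^ (5 * n + 19) \<le> s / 1" using s(3) pow1 pow0 by (intro divide_left_mono) auto
  then have Hs: "real H \<le> sqrt X" using H_upper unfolding s_def by simp
  have X0: "X > 0" using L by simp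
  have pos: "N > 0" "Y > 0" "R1 > 0" using X0 pow0 by (auto simp: N_def Y_def R1_def)
  have lam: "L\<^sup>2 \<ge> 1" using pow1[of 2] by simp
  have RN: "4 * X * L\<^sup>2 \<le> N * real R"
  proof -
    have "4 * X * L\<^sup>2 = N * (4 * L ^ (4 * n + 16))"
    proof -
      have "4 * n + 16 = (4 * n + 14) + 2" by simp
      then have "L ^ (4 * n + 16) = L ^ (4 * n + 14) * L\<^sup>2" by (simp only: power_add)
      then show ?thesis using pow0[of "4 * n + 14"] by (simp add: N_def)
    qed
    also have "\<dots> \<le> N * real R" using R_lower pos by (intro mult_left_mono) auto
    finally show ?thesis .
  qed
  have RR: "L\<^sup>2 * R1 \<le> real R"
  proof -
    have "3 * n + 12 = 2 + (3 * n + 10)" by simp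
    then have "L\<^sup>2 * R1 = L ^ (3 * n + 12)" unfolding R1_def by (simp only: power_add)
    also have "\<dots> \<le> L ^ (4 * n + 16)" by (rule pow) simp
    also have "\<dots> \<le> 4 * L ^ (4 * n + 16)" using pow0[of "4 * n + 16"] by simp
    finally show ?thesis using R_lower by linarith
  qed
  have base: "(\<Sum>m | 1 \<le> m \<and> N / L\<^sup>2 \<le> real m \<and> real m < N. line_norm V f m) \<le>
     (\<Sum>r\<in>{1..R}. line_norm V f r) + 18 * N * X
     + 135 * X * (1 + ln (real R)) * (4 * Y * (1 + L) + 2 * s * real H)
     + 600 * real R * X * s * real H * (1 + L)
     + 427 * X\<^sup>2 * (4 * N / Y + 4 / R1) * sqrt (real R)"
    using top_range_le[OF H0 Hs R1' R_le RH pos(1) lam pos(2,3) RN RR] unfolding s_def lnX .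
  define Z where "Z = X\<^sup>2 / L ^ (n + 2)"
  have Z0: "Z \<ge> 0" unfolding Z_def by (rule divide_nonneg_pos[OF _ pow0]) simp
  have frac: "X\<^sup>2 * (L ^ i / L ^ j) \<le> Z" if "i + (n + 2) \<le> j" for i j
  proof -
    have "L ^ i * L ^ (n + 2) \<le> L ^ j" unfolding power_add[symmetric] by (rule pow[OF that])
    then have "L ^ i \<le> L ^ j / L ^ (n + 2)"
      by (simp only: pos_le_divide_eq[OF pow0])
    then have "L ^ i / L ^ j \<le> 1 / L ^ (n + 2)"
      by (simp only: pos_divide_le_eq[OF pow0] times_divide_eq_left mult_1_left)
    then have "X\<^sup>2 * (L ^ i / L ^ j) \<le> X\<^sup>2 * (1 / L ^ (n + 2))" by (rule mult_left_mono) simp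
    then show ?thesis by (simp add: Z_def)
  qed
  have sH: "s * real H \<le> X / L ^ (5 * n + 19)"
  proof -
    have "s * real H \<le> s * (s / L ^ (5 * n + 19))" using H_upper s by (intro mult_left_mono) auto
    then show ?thesis using s(2) by simp
  qed
  have t1: "18 * N * X \<le> 18 * Z"
    using frac[of 0 "4 * n + 14"] by (simp add: N_def power2_eq_square)
  have lnR: "1 + ln (real R) \<le> 2 * L"
  proof -
    have "real R \<le> X"
      using R_le Hs sqrt_X by linarith
    then have "ln (real R) \<le> ln X" using R1' by (intro ln_mono) auto
    then show ?thesis using lnX L1 by simp
  qed
  have t2: "135 * X * (1 + ln (real R)) * (4 * Y * (1 + L) + 2 * s * real H) \<le> 2700 * Z"
  proof -
    have "135 * X * (1 + ln (real R)) * (4 * Y * (1 + L) + 2 * s * real H) \<le>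
       135 * X * (2 * L) * (4 * Y * (2 * L) + 2 * (X / L ^ (5 * n + 19)))"
    proof (rule mult_mono)
      show "135 * X * (1 + ln (real R)) \<le> 135 * X * (2 * L)"
        using X0 lnR by (intro mult_left_mono) auto
      have "4 * Y * (1 + L) \<le> 4 * Y * (2 * L)" using pos L1 by (intro mult_left_mono) auto
      then show "4 * Y * (1 + L) + 2 * s * real H \<le> 4 * Y * (2 * L) + 2 * (X / L ^ (5 * n + 19))"
        using sH by linarith
      show "0 \<le> 4 * Y * (1 + L) + 2 * s * real H" using pos s L1 by simp
      show "0 \<le> 135 * X * (2 * L)" using X0 L1 by simp
    qed
    also have "\<dots> = 2160 * (X\<^sup>2 * (L ^ 2 / L ^ (n + 4))) + 540 * (X\<^sup>2 * (L ^ 1 / L ^ (5 * n + 19)))"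
    proof -
      have "135 * X * (2 * L) * (4 * (X / a) * (2 * L) + 2 * (X / b)) =
          2160 * (X\<^sup>2 * (L ^ 2 / a)) + 540 * (X\<^sup>2 * (L ^ 1 / b))" for a b
        by (simp add: power2_eq_square algebra_simps)
      then show ?thesis unfolding Y_def .
    qed
    also have "\<dots> \<le> 2160 * Z + 540 * Z"
      by (rule add_mono[OF mult_left_mono[OF frac] mult_left_mono[OF frac]]) simp_all
    finally show ?thesis by simp
  qed
  have t3: "600 * real R * X * s * real H * (1 + L) \<le> 6000 * Z"
  proof -
    have "600 * real R * X * s * real H * (1 + L) = 600 * X * (real R * ((s * real H) * (1 + L)))" by simp
    also have "\<dots> \<le> 600 * X * (5 * L ^ (4 * n + 16) * ((X / L ^ (5 * n + 19)) * (2 * L)))"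
      using R_upper sH L1 X0 s pow0 by (intro mult_left_mono mult_mono) auto
    also have "\<dots> = 6000 * (X\<^sup>2 * (L ^ (4 * n + 17) / L ^ (5 * n + 19)))"
      by (simp add: power2_eq_square power_add eval_nat_numeral)
    also have "\<dots> \<le> 6000 * Z" by (intro mult_left_mono frac) auto
    finally show ?thesis .
  qed
  have t4: "427 * X\<^sup>2 * (4 * N / Y + 4 / R1) * sqrt (real R) \<le> 10248 * Z"
  proof -
    have NY: "N / Y = 1 / R1"
    proof -
      have "L ^ (4 * n + 14) = L ^ (n + 4) * R1" unfolding R1_def power_add[symmetric] by (simp add: algebra_simps)
      then show ?thesis using X0 pow0[of "n + 4"] pos L1 by (simp add: N_def Y_def)
    qed
    have "sqrt (real R) \<le> 3 * L ^ (2 * n + 8)"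
    proof (rule real_le_lsqrt)
      have "real R \<le> 9 * L ^ (4 * n + 16)" using R_upper pow0[of "4 * n + 16"] by linarith
      also have "\<dots> = (3 * L ^ (2 * n + 8))\<^sup>2"
        by (simp add: power_mult_distrib flip: power_mult)
      finally show "real R \<le> (3 * L ^ (2 * n + 8))\<^sup>2" .
    qed (use L1 in auto)
    then have "427 * X\<^sup>2 * (4 * (N / Y) + 4 / R1) * sqrt (real R) \<le> 427 * X\<^sup>2 * (4 * (N / Y) + 4 / R1) * (3 * L ^ (2 * n + 8))"
      using pos by (intro mult_left_mono) auto
    also have "\<dots> = 10248 * (X\<^sup>2 * (L ^ (2 * n + 8) / L ^ (3 * n + 10)))"
      unfolding NY by (simp add: R1_def)
    also have "\<dots> \<le> 10248 * Z" by (intro mult_left_mono frac) auto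
    finally show ?thesis by simp
  qed
  have "(\<Sum>r\<in>{1..R}. line_norm V f r) \<le> G * Z"
    using E[OF R_upper] by (simp add: Z_def)
  then have "(\<Sum>m | 1 \<le> m \<and> N / L\<^sup>2 \<le> real m \<and> real m < N. line_norm V f m)
      \<le> G * Z + 18 * Z + 2700 * Z + 6000 * Z + 10248 * Z"
    using base t1 t2 t3 t4 by linarith
  \<comment> \<open>The four constants add up to 18966.\<close>
  also have "\<dots> \<le> (G + 20000) * Z" using Z0 by (simp add: algebra_simps)
  finally show ?thesis by (simp add: Z_def N_def)
qed

lemma sum_line_norm_le:
  fixes n :: nat and L G :: real
  assumes L: "L \<ge> 30" "X = exp L"
    and large: "3200 * L ^ (25 * n + 99) \<le> exp (L / 2)" and G: "G \<ge> 0"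
    and E: "\<And>R. real R \<le> 5 * L ^ (4 * n + 16) \<Longrightarrow> (\<Sum>r\<in>{1..R}. line_norm V f r) \<le> G * X\<^sup>2 / L ^ (n + 2)"
    and Q: "Q \<ge> 1"
  shows "(\<Sum>q | 1 \<le> q \<and> real q \<le> Q. line_norm V f q)
    \<le> (17 * G + 340180) * (Q * L ^ (8 * n + 28) + X / L ^ n) * X"
proof -
  define N where "N = X / L ^ (4 * n + 14)"
  let ?T = "line_norm V f"
  have L1: "L \<ge> 1" "L > 0" using L by auto
  have pow1: "1 \<le> L ^ i" and pow0: "L ^ i > 0" for i using L1 by auto
  have X0: "X > 0" using L by simp
  have N0: "N > 0" using X0 pow0 by (simp add: N_def)
  have NX: "N \<le> X" 
  proof -
    have "N \<le> X / 1" unfolding N_def using X0 pow1 pow0 by (intro divide_left_mono) auto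
    then show ?thesis by simp
  qed
  let ?lo = "{q::nat. 1 \<le> q \<and> real q < N}" and ?hi = "{q::nat. 1 \<le> q \<and> N \<le> real q \<and> real q \<le> Q}"
  have finhi: "finite ?hi" by (rule finite_subset[OF _ finite_below(1)[of "Q + 1"]]) auto
  have "(\<Sum>q\<in>?lo. ?T q) \<le> (1 + 16 * L\<^sup>2) * (\<Sum>m | 1 \<le> m \<and> N / L\<^sup>2 \<le> real m \<and> real m < N. ?T m)"
    using NX L by (intro sum_le_sum_large_multiples line_norm_nonneg line_norm_le_prime_multiple prim finite_V) auto
  \<comment> \<open>The transfer factor is at most \<open>17 L^2\<close>; the two extra logarithms
    saved at the top of the range repay it.\<close>
  also have "\<dots> \<le> (17 * L\<^sup>2) * ((G + 20000) * X\<^sup>2 / L ^ (n + 2))"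
    unfolding N_def using L1 pow1[of 2] G
    by (intro mult_mono top_range_log_saving[OF L large E] sum_nonneg line_norm_nonneg) auto
  also have "\<dots> = (17 * G + 340000) * (X / L ^ n) * X"
    using L1 by (simp add: power_add power2_eq_square)
  finally have lo: "(\<Sum>q\<in>?lo. ?T q) \<le> (17 * G + 340000) * (X / L ^ n) * X" .
  have hi: "(\<Sum>q\<in>?hi. ?T q) \<le> 180 * (Q * L ^ (8 * n + 28)) * X"
  proof (cases "N \<le> Q")
    case True
    \<comment> \<open>Since \<open>X = N P \<le> Q P\<close>, the trivial term
      \<open>X^2 * (X / N)\<close> is at most \<open>(Q P) * P * X\<close>. The square of
      \<open>P\<close> is the source of the exponent \<open>8 n + 28\<close>.\<close>
    define P where "P = L ^ (4 * n + 14)"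
    have P: "P \<ge> 1" using pow1 by (simp add: P_def)
    have PP: "L ^ (8 * n + 28) = P * P" unfolding P_def power_add[symmetric] by (simp add: algebra_simps)
    have XN: "X = N * P" using L1 by (simp add: N_def P_def)
    have XQ: "X \<le> Q * P" unfolding XN using True P by (intro mult_right_mono) auto
    have "(\<Sum>q\<in>?hi. ?T q) \<le> 18 * Q * X + 81 * X\<^sup>2 * (X / N + 1)"
      by (rule sum_line_norm_large_moduli[OF N0 True])
    also have "X / N = P" using XN N0 by simp
    also have "81 * X\<^sup>2 * (P + 1) \<le> 162 * (X * P) * X"
      using P X0 by (simp add: power2_eq_square algebra_simps)
    also have "162 * (X * P) * X \<le> 162 * ((Q * P) * P) * X"
      using XQ P X0 by (intro mult_right_mono mult_left_mono) auto
    also have "18 * Q * X \<le> 18 * ((Q * P) * P) * X"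
    proof -
      have "1 * 1 \<le> P * P" using P by (intro mult_mono) auto
      then have "Q * 1 \<le> Q * (P * P)" using Q by (intro mult_left_mono) auto
      then have "(Q * 1) * X \<le> (Q * (P * P)) * X" using X0 by (intro mult_right_mono) auto
      then show ?thesis by (simp add: mult.assoc)
    qed
    finally show ?thesis unfolding PP by (simp add: mult_ac)
  next
    case False
    then have empty: "?hi = {}" by auto
    show ?thesis unfolding empty using Q X0 L1 by simp
  qed
  have "(\<Sum>q | 1 \<le> q \<and> real q \<le> Q. ?T q) \<le> (\<Sum>q\<in>?lo \<union> ?hi. ?T q)"
    using finhi finite_below(1)[of N] line_norm_nonneg by (intro sum_mono2) auto
  also have "\<dots> \<le> (\<Sum>q\<in>?lo. ?T q) + (\<Sum>q\<in>?hi. ?T q)"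
  proof -
    have "?lo \<inter> ?hi = {}" by auto
    then show ?thesis using finhi finite_below(1)[of N] by (simp add: sum.union_disjoint)
  qed
  also have "\<dots> \<le> (17 * G + 340000) * (X / L ^ n) * X + 180 * (Q * L ^ (8 * n + 28)) * X"
    using lo hi by linarith
  also have "\<dots> \<le> (17 * G + 340180) * (X / L ^ n) * X + (17 * G + 340180) * (Q * L ^ (8 * n + 28)) * X"
    using G X0 L1 Q by (intro add_mono mult_right_mono) auto
  finally show ?thesis by (simp add: algebra_simps)
qed

end

theorem mainTheorem1:
  fixes A :: real and K :: "real \<Rightarrow> real"
  assumes "A > 0" and "\<And>B. B > 0 \<Longrightarrow> K B > 0"
  shows "\<exists>M>0. \<forall>(Q::real) (X::real) (c :: complex \<Rightarrow> complex).
           Q \<ge> 1 \<longrightarrow> X \<ge> 2 \<longrightarrow>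
           (\<forall>z\<in>gauss_ints. cmod (c z) \<le> 1) \<longrightarrow>
           (\<forall>z\<in>gauss_support c. odd_primitive z \<and> 1 < (cmod z)\<^sup>2 \<and> (cmod z)\<^sup>2 \<le> X) \<longrightarrow>
           siegel_walfisz K X c \<longrightarrow>
           cmod (det_sum c Q)
             \<le> M * (Q * (ln X) powr (28 * A + 148) + X * (ln X) powr (- A)) * X"
proof -
  define n where "n = nat \<lceil>A\<rceil>"
  have n: "A \<le> real n" "real n \<le> A + 1" unfolding n_def using assms(1) by linarith+
  \<comment> \<open>The only exponent at which Siegel-Walfisz is invoked. It must satisfy
    \<open>9 (4 n + 16) + (n + 2) \<le> 2 b\<close>, that is
    \<open>37 n + 146 \<le> 38 n + 160\<close>.\<close>
  define b where "b = 19 * n + 80"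
  define G where "G = (K (real b))\<^sup>2 * 5 ^ 9"
  have G0: "G \<ge> 0" by (simp add: G_def)
  obtain L0 :: real where L0: "\<And>L. L \<ge> L0 \<Longrightarrow> 3200 * L ^ (25 * n + 99) \<le> exp (L / 2)"
    using power_eventually_le_exp_half[of 3200 "25 * n + 99"] by force
  define L1 :: real where "L1 = max L0 30"
  define E :: real where "E = 28 * A + 148"
  \<comment> \<open>The first summand serves large \<open>L\<close>. The second absorbs the trivial
    bound \<open>81 Q X^2\<close> when \<open>X < exp L1\<close>, where \<open>L \<ge> ln 2\<close>
    bounds the power of \<open>L\<close> from below.\<close>
  define M :: real where "M = (17 * G + 340180) + 81 * exp L1 / (ln 2) powr E"
  have l2: "ln 2 > (0::real)" by simp
  have M_pos: "M > 0"
  proof -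
    have "17 * G + 340180 > 0" using G0 by linarith
    moreover have "81 * exp L1 / (ln 2) powr E \<ge> 0" by simp
    ultimately show ?thesis unfolding M_def by linarith
  qed
  show ?thesis
  proof (intro exI[of _ M] conjI allI impI M_pos)
    fix Q X :: real and c :: "complex \<Rightarrow> complex"
    assume Q: "Q \<ge> 1" and X: "X \<ge> 2"
      and c: "\<forall>z\<in>gauss_ints. cmod (c z) \<le> 1"
      and supp: "\<forall>z\<in>gauss_support c. odd_primitive z \<and> 1 < (cmod z)\<^sup>2 \<and> (cmod z)\<^sup>2 \<le> X"
      and sw: "siegel_walfisz K X c"
    define V where "V = support_coords c"
    define f where "f = coord_fun c"
    interpret primitive_disc V f X
      unfolding V_def f_def using X c supp by (intro primitive_disc_support) auto
    define L where "L = ln X"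
    have XL: "X = exp L" using X by (simp add: L_def)
    have L2: "L \<ge> ln 2" unfolding L_def using X by (intro ln_mono) auto
    have L_pos: "L > 0" using L2 l2 by linarith
    let ?S = "\<Sum>q | 1 \<le> q \<and> real q \<le> Q. line_norm V f q"
    have S0: "?S \<ge> 0" by (intro sum_nonneg line_norm_nonneg)
    have "det_sum c Q = of_real ?S"
      unfolding V_def f_def using finite_V prim by (intro det_sum_eq) (auto simp: V_def)
    then have det: "cmod (det_sum c Q) = ?S" using S0 by (simp only: norm_of_real abs_of_nonneg)
    have nonneg: "0 \<le> Q * L powr E" "0 \<le> X * L powr (- A)" using Q X by auto
    show "cmod (det_sum c Q) \<le> M * (Q * (ln X) powr (28 * A + 148) + X * (ln X) powr (- A)) * X"
      unfolding det L_def[symmetric] E_def[symmetric]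
    proof (cases "L \<ge> L1")
      case True
      then have L: "L \<ge> 30" "L \<ge> L0" by (auto simp: L1_def)
      have Lge1: "L \<ge> 1" using L by simp
      have small: "(\<Sum>r\<in>{1..R}. line_norm V f r) \<le> G * X\<^sup>2 / L ^ (n + 2)"
        if R: "real R \<le> 5 * L ^ (4 * n + 16)" for R
      proof -
        define W where "W = L powr (- real b)"
        have W: "W = 1 / L ^ b" unfolding W_def using L_pos by (simp add: powr_minus powr_realpow inverse_eq_divide)
        have "line_norm V f r \<le> (K (real b))\<^sup>2 * real R ^ 8 * X\<^sup>2 * W\<^sup>2" if r: "r \<in> {1..R}" for r
        proof -
          have "line_norm V f r \<le> real r ^ 4 * (K (real b) * (real r)\<^sup>2 * X * W)\<^sup>2"
          proof (rule line_norm_le_residue_sums)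
            show "cmod (\<Sum>z | z \<in> V \<and> residue r z = \<alpha>. f z) \<le> K (real b) * (real r)\<^sup>2 * X * W" for \<alpha>
              unfolding residue_def V_def f_def W_def L_def using r supp
              by (intro residue_sum_le[OF sw]) (auto simp: b_def)
          qed (use r in auto)
          \<comment> \<open>Pairs of residue classes give \<open>r ^ 4\<close>, and the squared
            factor \<open>l^2\<close> of the Siegel-Walfisz bound gives another
            \<open>r ^ 4\<close>. Summation over \<open>r\<close> raises this to the ninth power,
            hence \<open>5 ^ 9\<close> in \<open>G\<close>.\<close>
          also have "\<dots> = (K (real b))\<^sup>2 * real r ^ 8 * X\<^sup>2 * W\<^sup>2"
            by (simp add: power_mult_distrib flip: power_mult power_add)
          also have "\<dots> \<le> (K (real b))\<^sup>2 * real R ^ 8 * X\<^sup>2 * W\<^sup>2"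
            using r by (intro mult_right_mono mult_left_mono power_mono) auto
          finally show ?thesis .
        qed
        then have "(\<Sum>r\<in>{1..R}. line_norm V f r) \<le> (\<Sum>r\<in>{1..R}. (K (real b))\<^sup>2 * real R ^ 8 * X\<^sup>2 * W\<^sup>2)"
          by (intro sum_mono)
        also have "\<dots> = (K (real b))\<^sup>2 * real R ^ 9 * X\<^sup>2 * W\<^sup>2" by (simp add: eval_nat_numeral)
        also have "\<dots> \<le> (K (real b))\<^sup>2 * (5 * L ^ (4 * n + 16)) ^ 9 * X\<^sup>2 * W\<^sup>2"
          using R by (intro mult_right_mono mult_left_mono power_mono) auto
        also have "\<dots> = G * X\<^sup>2 * (L ^ (36 * n + 144) * W\<^sup>2)"
          by (simp add: G_def power_mult_distrib algebra_simps flip: power_mult)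
        also have "L ^ (36 * n + 144) * W\<^sup>2 \<le> 1 / L ^ (n + 2)"
        proof -
          have "L ^ (36 * n + 144) * L ^ (n + 2) \<le> L ^ (2 * b)"
            unfolding power_add[symmetric] using Lge1 by (intro power_increasing) (auto simp: b_def)
          moreover have "W\<^sup>2 = 1 / L ^ (2 * b)" unfolding W by (simp add: power_divide power_mult[symmetric] mult.commute)
          ultimately show ?thesis using L_pos by (simp add: divide_le_eq pos_le_divide_eq)
        qed
        then have "G * X\<^sup>2 * (L ^ (36 * n + 144) * W\<^sup>2) \<le> G * X\<^sup>2 * (1 / L ^ (n + 2))"
          using G0 by (intro mult_left_mono) auto
        finally show ?thesis by simp
      qed
      have "?S \<le> (17 * G + 340180) * (Q * L ^ (8 * n + 28) + X / L ^ n) * X"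
        by (rule sum_line_norm_le[OF L(1) XL L0[OF L(2)] G0 small Q])
      also have "\<dots> \<le> M * (Q * L powr E + X * L powr (- A)) * X"
      proof (intro mult_right_mono mult_mono add_mono mult_left_mono)
        show "17 * G + 340180 \<le> M" unfolding M_def by simp
        have "L ^ (8 * n + 28) = L powr real (8 * n + 28)" using L_pos by (simp only: powr_realpow)
        \<comment> \<open>\<open>n \<le> A + 1\<close> gives \<open>8 n + 28 \<le> 8 A + 36\<close>,
          far below \<open>E\<close>.\<close>
        also have "\<dots> \<le> L powr E" unfolding E_def using n assms(1) Lge1 by (intro powr_mono) auto
        finally show "L ^ (8 * n + 28) \<le> L powr E" .
        have "1 / L ^ n = L powr (- real n)" using L_pos by (simp add: powr_minus powr_realpow inverse_eq_divide)
        also have "\<dots> \<le> L powr (- A)" using n Lge1 by (intro powr_mono) auto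
        finally have "X * (1 / L ^ n) \<le> X * L powr (- A)" using X by (intro mult_left_mono) auto
        then show "X / L ^ n \<le> X * L powr (- A)" by simp
      qed (use Q X M_pos L_pos in auto)
      finally show "?S \<le> M * (Q * L powr E + X * L powr (- A)) * X" .
    next
      case False
      have "card {q::nat. 1 \<le> q \<and> real q \<le> Q} \<le> nat \<lfloor>Q\<rfloor>"
      proof -
        have "{q::nat. 1 \<le> q \<and> real q \<le> Q} \<subseteq> {1..nat \<lfloor>Q\<rfloor>}" by (auto simp: le_nat_floor)
        from card_mono[OF _ this] show ?thesis by simp
      qed
      then have cQ: "real (card {q::nat. 1 \<le> q \<and> real q \<le> Q}) \<le> Q" using Q by linarith
      have "?S \<le> (\<Sum>q | 1 \<le> q \<and> real q \<le> Q. 81 * X\<^sup>2)"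
        by (intro sum_mono line_norm_le_trivial)
      also have "\<dots> = real (card {q::nat. 1 \<le> q \<and> real q \<le> Q}) * (81 * X\<^sup>2)" by simp
      also have "\<dots> \<le> Q * (81 * X\<^sup>2)" using cQ by (intro mult_right_mono) auto
      also have "\<dots> = (81 * X) * Q * X" by (simp add: power2_eq_square)
      also have "\<dots> \<le> (M * L powr E) * Q * X"
      proof (intro mult_right_mono)
        have "X \<le> exp L1" using False XL by simp
        moreover have "(ln 2) powr E \<le> L powr E" using L2 assms(1) l2 by (intro powr_mono2) (auto simp: E_def)
        moreover have p0: "(ln 2 :: real) powr E > 0" using l2 by simp
        ultimately have "81 * X \<le> 81 * exp L1 / (ln 2) powr E * L powr E"
        proof -
          have "81 * exp L1 = 81 * exp L1 / (ln 2) powr E * (ln 2) powr E" using p0 by simp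
          also have "\<dots> \<le> 81 * exp L1 / (ln 2) powr E * L powr E"
            using \<open>(ln 2) powr E \<le> L powr E\<close> by (intro mult_left_mono) auto
          finally show ?thesis using \<open>X \<le> exp L1\<close> by linarith
        qed
        also have "\<dots> \<le> M * L powr E" unfolding M_def using G0 by (intro mult_right_mono) auto
        finally show "81 * X \<le> M * L powr E" .
      qed (use Q X in auto)
      also have "\<dots> \<le> M * (Q * L powr E + X * L powr (- A)) * X"
        using M_pos nonneg X by (simp add: algebra_simps)
      finally show "?S \<le> M * (Q * L powr E + X * L powr (- A)) * X" .
    qed
  qed
qed

end
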